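(* Let $(R_1,\mathfrak m_1,\mathsf k)$ and $(R_2,\mathfrak m_2,\mathsf k)$ be Koszul Noetherian local rings with $R_1\neq\mathsf k\neq R_2$, let $R=R_1\times_{\mathsf k}R_2$, let $\mathfrak m$ denote the maximal ideal of $R$, and let $A=G_{\mathfrak m}(R)$. Let $M$ be a finitely generated $R$-module such that $G_{\mathfrak m}(M)$ has a pure resolution over $A$, and let $\cdots\to F_2\xrightarrow{\phi_2}F_1\xrightarrow{\phi_1}F_0\to0$ be a minimal free resolution of $M$ over $R$. Then $\Omega_2^A(G_{\mathfrak m}(M))$ has a linear resolution, and for each $j>2$, the order of every column of the matrix of $\phi_j$ is $1$.
   Context: $R_1\times_{\mathsf k}R_2=\{(a,b)\in R_1\times R_2:\pi_1(a)=\pi_2(b)\}$, where $\pi_i:R_i\to\mathsf k$ are the natural projections; it is a Noetherian local ring with maximal ideal $\mathfrak m\simeq\mathfrak m_1\oplus\mathfrak m_2$. $G_{\mathfrak m}(L)=\bigoplus_{i\ge0}\mathfrak m^iL/\mathfrak m^{i+1}L$ for a finitely generated $R$-module $L$; it is a graded module over $A=G_{\mathfrak m}(R)$, a standard graded $\mathsf k$-algebra. $\Omega_i^A(L)$ is the $i$-th syzygy module in the minimal graded free resolution of a finitely generated graded $A$-module $L$. Such an $L$ has a pure resolution if for each $i$ the graded Betti number $\beta_{i,j}(L)$ is nonzero for at most one $j$; a pure module generated in degree $\delta_0$ has a linear resolution if $\beta_{i,j}(L)\ne0$ implies $j=\delta_0+i$ (the zero module is regarded as having a linear resolution). A standard graded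 $\mathsf k$-algebra is Koszul if $\mathsf k$ has a linear resolution over it; a Noetherian local ring is Koszul if its associated graded ring with respect to its maximal ideal is a Koszul $\mathsf k$-algebra. The order of a nonzero element $x$ of a free module $F$ is the integer $i$ with $x\in\mathfrak m^iF\setminus\mathfrak m^{i+1}F$; a column of the matrix of $\phi_j$ is viewed as an element of $F_{j-1}$. Statements about $\phi_j$ are vacuous when $F_j=0$. *)

theory Defs
  imports "HOL-Algebra.Algebra"
begin

section \<open>Local rings and fibre products\<close>

definition local_ring :: "('a, 'c) ring_scheme \<Rightarrow> bool"
  where "local_ring R \<longleftrightarrow> cring R \<and> (\<exists>!m. maximalideal m R)"

definition max_ideal :: "('a, 'c) ring_scheme \<Rightarrow> 'a set"
  where "max_ideal R = (THE m. maximalideal m R)"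

definition noetherian_local_ring :: "('a, 'c) ring_scheme \<Rightarrow> bool"
  where "noetherian_local_ring R \<longleftrightarrow> local_ring R \<and> noetherian_ring R"

definition fiber_product ::
    "('a, 'c) ring_scheme \<Rightarrow> ('b, 'd) ring_scheme \<Rightarrow> ('a \<Rightarrow> 'k) \<Rightarrow> ('b \<Rightarrow> 'k) \<Rightarrow> ('a \<times> 'b) ring"
  where "fiber_product R1 R2 p1 p2 =
    RDirProd R1 R2 \<lparr>carrier := {(a, b). a \<in> carrier R1 \<and> b \<in> carrier R2 \<and> p1 a = p2 b}\<rparr>"


section \<open>Modules\<close>

text \<open>
  The record type of modules extends that of rings; the fields \<open>mult\<close> and \<open>one\<close> of a module
  play no role and are left \<open>undefined\<close> below.
\<close>

definition self_module :: "('a, 'c) ring_scheme \<Rightarrow> ('a, 'a) module"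
  where "self_module R = \<lparr>carrier = carrier R, monoid.mult = undefined, one = undefined,
    ring.zero = \<zero>\<^bsub>R\<^esub>, add = add R, smult = monoid.mult R\<rparr>"

definition free_module :: "('a, 'c) ring_scheme \<Rightarrow> nat \<Rightarrow> ('a, nat \<Rightarrow> 'a) module"
  where "free_module R n = \<lparr>carrier = {..<n} \<rightarrow>\<^sub>E carrier R, monoid.mult = undefined, one = undefined,
    ring.zero = (\<lambda>i\<in>{..<n}. \<zero>\<^bsub>R\<^esub>), add = (\<lambda>v w. \<lambda>i\<in>{..<n}. v i \<oplus>\<^bsub>R\<^esub> w i),
    smult = (\<lambda>a v. \<lambda>i\<in>{..<n}. a \<otimes>\<^bsub>R\<^esub> v i)\<rparr>"

definition basis_vec :: "('a, 'c) ring_scheme \<Rightarrow> nat \<Rightarrow> nat \<Rightarrow> nat \<Rightarrow> 'a"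
  where "basis_vec R n t = (\<lambda>i\<in>{..<n}. if i = t then \<one>\<^bsub>R\<^esub> else \<zero>\<^bsub>R\<^esub>)"

definition finitely_generated_module ::
    "('a, 'c) ring_scheme \<Rightarrow> ('a, 'b, 'd) module_scheme \<Rightarrow> bool"
  where "finitely_generated_module R M \<longleftrightarrow> module R M \<and>
    (\<exists>S. finite S \<and> S \<subseteq> carrier M \<and> (\<forall>N. submodule N R M \<and> S \<subseteq> N \<longrightarrow> N = carrier M))"

definition module_hom ::
    "('a, 'c) ring_scheme \<Rightarrow> ('a, 'b, 'd) module_scheme \<Rightarrow> ('a, 'e, 'f) module_scheme \<Rightarrow> ('b \<Rightarrow> 'e) set"
  where "module_hom R M N = {h \<in> carrier M \<rightarrow> carrier N.
    (\<forall>x \<in> carrier M. \<forall>y \<in> carrier M. h (x \<oplus>\<^bsub>M\<^esub> y) = h x \<oplus>\<^bsub>N\<^esub> h y) \<and>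
    (\<forall>a \<in> carrier R. \<forall>x \<in> carrier M. h (a \<odot>\<^bsub>M\<^esub> x) = a \<odot>\<^bsub>N\<^esub> h x)}"

text \<open>The submodule \<open>I L\<close>; closure under scalars is automatic since \<open>I\<close> is an ideal.\<close>

definition ideal_smult :: "'a set \<Rightarrow> ('a, 'b, 'd) module_scheme \<Rightarrow> 'b set"
  where "ideal_smult I L = generate (add_monoid L) {a \<odot>\<^bsub>L\<^esub> x |a x. a \<in> I \<and> x \<in> carrier L}"

text \<open>The submodule \<open>I\<^sup>i L\<close>, where \<open>I\<^sup>0 = R\<close>.\<close>

definition ideal_pow_smult ::
    "('a, 'c) ring_scheme \<Rightarrow> 'a set \<Rightarrow> ('a, 'b, 'd) module_scheme \<Rightarrow> nat \<Rightarrow> 'b set"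
  where "ideal_pow_smult R I L i = ideal_smult (I [^]\<^bsub>ideals_set R\<^esub> i) L"

text \<open>An element \<open>x\<close> of \<open>F\<close> has order \<open>i\<close>; in particular this forces \<open>x \<noteq> 0\<close>.\<close>

definition has_order ::
    "('a, 'c) ring_scheme \<Rightarrow> 'a set \<Rightarrow> ('a, 'b, 'd) module_scheme \<Rightarrow> 'b \<Rightarrow> nat \<Rightarrow> bool"
  where "has_order R m F x i \<longleftrightarrow>
    x \<in> ideal_pow_smult R m F i \<and> x \<notin> ideal_pow_smult R m F (Suc i)"


section \<open>Free resolutions\<close>

text \<open>
  Free modules come with a basis: the module in homological degree \<open>i\<close> is \<open>R\<close> to the power
  \<open>r i\<close>, the differential \<open>\<phi> i\<close> goes from degree \<open>i\<close> to degree \<open>i - 1\<close> (\<open>\<phi> 0\<close> is not used), and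
  \<open>\<epsilon>\<close> is the augmentation onto \<open>M\<close>.
\<close>

definition free_resolution ::
    "('a, 'c) ring_scheme \<Rightarrow> ('a, 'b, 'd) module_scheme \<Rightarrow> (nat \<Rightarrow> nat) \<Rightarrow>
     (nat \<Rightarrow> (nat \<Rightarrow> 'a) \<Rightarrow> (nat \<Rightarrow> 'a)) \<Rightarrow> ((nat \<Rightarrow> 'a) \<Rightarrow> 'b) \<Rightarrow> bool"
  where "free_resolution R M r \<phi> \<epsilon> \<longleftrightarrow>
    (let F = (\<lambda>i. free_module R (r i)) in
      \<epsilon> \<in> module_hom R (F 0) M \<and>
      (\<forall>i. \<phi> (Suc i) \<in> module_hom R (F (Suc i)) (F i)) \<and>
      \<epsilon> ` carrier (F 0) = carrier M \<and>
      \<phi> 1 ` carrier (F 1) = a_kernel (F 0) M \<epsilon> \<and>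
      (\<forall>i. \<phi> (Suc (Suc i)) ` carrier (F (Suc (Suc i))) =
           a_kernel (F (Suc i)) (F i) (\<phi> (Suc i))))"

text \<open>
  Minimality with respect to an ideal \<open>I\<close>: the maximal ideal in the local case, the irrelevant
  ideal in the graded case.
\<close>

definition minimal_free_resolution ::
    "('a, 'c) ring_scheme \<Rightarrow> 'a set \<Rightarrow> ('a, 'b, 'd) module_scheme \<Rightarrow> (nat \<Rightarrow> nat) \<Rightarrow>
     (nat \<Rightarrow> (nat \<Rightarrow> 'a) \<Rightarrow> (nat \<Rightarrow> 'a)) \<Rightarrow> ((nat \<Rightarrow> 'a) \<Rightarrow> 'b) \<Rightarrow> bool"
  where "minimal_free_resolution R I M r \<phi> \<epsilon> \<longleftrightarrow> free_resolution R M r \<phi> \<epsilon> \<and>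
    (\<forall>i. \<phi> (Suc i) ` carrier (free_module R (r (Suc i))) \<subseteq> ideal_smult I (free_module R (r i)))"

text \<open>The \<open>t\<close>-th column of the matrix of \<open>\<phi> j\<close>, as an element of the free module in degree \<open>j - 1\<close>.\<close>

definition matrix_column ::
    "('a, 'c) ring_scheme \<Rightarrow> (nat \<Rightarrow> nat) \<Rightarrow> (nat \<Rightarrow> (nat \<Rightarrow> 'a) \<Rightarrow> (nat \<Rightarrow> 'a)) \<Rightarrow>
     nat \<Rightarrow> nat \<Rightarrow> (nat \<Rightarrow> 'a)"
  where "matrix_column R r \<phi> j t = \<phi> j (basis_vec R (r j) t)"


section \<open>Graded rings and modules\<close>

text \<open>
  Rings and modules with an internal grading, recorded by their homogeneous components. Only
  nonnegatively graded modules are needed, so degrees are natural numbers.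
\<close>

record 'a graded_ring = "'a ring" +
  gcomp :: "nat \<Rightarrow> 'a set"

record ('a, 'b) graded_module = "('a, 'b) module" +
  mcomp :: "nat \<Rightarrow> 'b set"

definition irrelevant_ideal :: "('a, 'c) graded_ring_scheme \<Rightarrow> 'a set"
  where "irrelevant_ideal A = Idl\<^bsub>A\<^esub> (\<Union>n\<in>{1..}. gcomp A n)"

text \<open>The residue field of \<open>A\<close>, as a graded \<open>A\<close>-module concentrated in degree \<open>0\<close>.\<close>

definition residue_module :: "('a, 'c) graded_ring_scheme \<Rightarrow> ('a, 'a set) graded_module"
  where "residue_module A =
    (let I = irrelevant_ideal A; Q = A Quot I in
      \<lparr>carrier = carrier Q, monoid.mult = undefined, one = undefined, ring.zero = \<zero>\<^bsub>Q\<^esub>, add = add Q,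
       smult = (\<lambda>a C. (I +>\<^bsub>A\<^esub> a) \<otimes>\<^bsub>Q\<^esub> C),
       mcomp = (\<lambda>j. if j = 0 then carrier Q else {\<zero>\<^bsub>Q\<^esub>})\<rparr>)"

text \<open>The graded free module \<open>\<Oplus>\<^sub>t A(- d t)\<close>, whose \<open>t\<close>-th basis vector has degree \<open>d t\<close>.\<close>

definition graded_free_module ::
    "('a, 'c) graded_ring_scheme \<Rightarrow> nat \<Rightarrow> (nat \<Rightarrow> nat) \<Rightarrow> ('a, nat \<Rightarrow> 'a) graded_module"
  where "graded_free_module A n d = module.extend (free_module A n)
    \<lparr>mcomp = (\<lambda>j. ({..<n} \<rightarrow>\<^sub>E carrier A) \<inter>
       {v. \<forall>t<n. v t \<in> (if d t \<le> j then gcomp A (j - d t) else {\<zero>\<^bsub>A\<^esub>})})\<rparr>"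

definition graded_submodule ::
    "('a, 'b) graded_module \<Rightarrow> 'b set \<Rightarrow> ('a, 'b) graded_module"
  where "graded_submodule L N = L \<lparr>carrier := N, mcomp := (\<lambda>j. mcomp L j \<inter> N)\<rparr>"

definition minimal_graded_free_resolution ::
    "('a, 'c) graded_ring_scheme \<Rightarrow> ('a, 'b) graded_module \<Rightarrow> (nat \<Rightarrow> nat) \<Rightarrow>
     (nat \<Rightarrow> nat \<Rightarrow> nat) \<Rightarrow> (nat \<Rightarrow> (nat \<Rightarrow> 'a) \<Rightarrow> (nat \<Rightarrow> 'a)) \<Rightarrow> ((nat \<Rightarrow> 'a) \<Rightarrow> 'b) \<Rightarrow> bool"
  where "minimal_graded_free_resolution A L r d \<phi> \<epsilon> \<longleftrightarrow>
    minimal_free_resolution A (irrelevant_ideal A) L r \<phi> \<epsilon> \<and>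
    (\<forall>j. \<epsilon> ` mcomp (graded_free_module A (r 0) (d 0)) j \<subseteq> mcomp L j) \<and>
    (\<forall>i j. \<phi> (Suc i) ` mcomp (graded_free_module A (r (Suc i)) (d (Suc i))) j
         \<subseteq> mcomp (graded_free_module A (r i) (d i)) j)"

text \<open>
  The graded Betti numbers, read off from the ranks and the degrees of the basis vectors in a
  minimal graded free resolution.
\<close>

definition graded_betti :: "(nat \<Rightarrow> nat) \<Rightarrow> (nat \<Rightarrow> nat \<Rightarrow> nat) \<Rightarrow> nat \<Rightarrow> nat \<Rightarrow> nat"
  where "graded_betti r d i j = card {t. t < r i \<and> d i t = j}"

text \<open>The \<open>i\<close>-th syzygy module in a given graded resolution, for \<open>i \<ge> 1\<close>.\<close>

definition graded_syzygy ::
    "('a, 'c) graded_ring_scheme \<Rightarrow> (nat \<Rightarrow> nat) \<Rightarrow> (nat \<Rightarrow> nat \<Rightarrow> nat) \<Rightarrow>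
     (nat \<Rightarrow> (nat \<Rightarrow> 'a) \<Rightarrow> (nat \<Rightarrow> 'a)) \<Rightarrow> nat \<Rightarrow> ('a, nat \<Rightarrow> 'a) graded_module"
  where "graded_syzygy A r d \<phi> i =
    graded_submodule (graded_free_module A (r (i - 1)) (d (i - 1)))
      (\<phi> i ` carrier (graded_free_module A (r i) (d i)))"

text \<open>
  Minimal graded free resolutions of finitely generated graded modules exist and are unique up to
  isomorphism, so the following conditions concern the graded Betti numbers of \<open>L\<close> itself.
\<close>

definition has_pure_resolution ::
    "('a, 'c) graded_ring_scheme \<Rightarrow> ('a, 'b) graded_module \<Rightarrow> bool"
  where "has_pure_resolution A L \<longleftrightarrow>
    (\<exists>r d \<phi> \<epsilon>. minimal_graded_free_resolution A L r d \<phi> \<epsilon> \<and>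
      (\<forall>i j j'. graded_betti r d i j \<noteq> 0 \<and> graded_betti r d i j' \<noteq> 0 \<longrightarrow> j = j'))"

text \<open>The zero module satisfies this with all ranks zero.\<close>

definition has_linear_resolution ::
    "('a, 'c) graded_ring_scheme \<Rightarrow> ('a, 'b) graded_module \<Rightarrow> bool"
  where "has_linear_resolution A L \<longleftrightarrow>
    (\<exists>r d \<phi> \<epsilon>. minimal_graded_free_resolution A L r d \<phi> \<epsilon> \<and>
      (\<exists>\<delta>. \<forall>i j. graded_betti r d i j \<noteq> 0 \<longrightarrow> j = \<delta> + i))"

text \<open>Meant for standard graded algebras over a field, such as associated graded rings of local rings.\<close>

definition koszul_algebra :: "('a, 'c) graded_ring_scheme \<Rightarrow> bool"
  where "koszul_algebra A \<longleftrightarrow> has_linear_resolution A (residue_module A)"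


section \<open>Associated graded objects\<close>

text \<open>The abelian group \<open>m\<^sup>i L / m\<^bsup>i+1\<^esup> L\<close>, written multiplicatively.\<close>

definition gr_component ::
    "('a, 'c) ring_scheme \<Rightarrow> 'a set \<Rightarrow> ('a, 'b, 'd) module_scheme \<Rightarrow> nat \<Rightarrow> 'b set monoid"
  where "gr_component R m L i =
    (add_monoid L \<lparr>carrier := ideal_pow_smult R m L i\<rparr>) Mod (ideal_pow_smult R m L (Suc i))"

text \<open>
  The pairing \<open>m\<^sup>i / m\<^bsup>i+1\<^esup> \<times> m\<^sup>j L / m\<^bsup>j+1\<^esup> L \<rightarrow> m\<^bsup>i+j\<^esup> L / m\<^bsup>i+j+1\<^esup> L\<close> induced by scalar
  multiplication; all the cosets in the union coincide.
\<close>

definition gr_pairing ::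
    "('a, 'c) ring_scheme \<Rightarrow> 'a set \<Rightarrow> ('a, 'b, 'd) module_scheme \<Rightarrow> nat \<Rightarrow> nat \<Rightarrow>
     'a set \<Rightarrow> 'b set \<Rightarrow> 'b set"
  where "gr_pairing R m L i j C D =
    (\<Union>a\<in>C. \<Union>x\<in>D. ideal_pow_smult R m L (Suc (i + j)) +>\<^bsub>L\<^esub> (a \<odot>\<^bsub>L\<^esub> x))"

text \<open>
  The direct sum of the groups \<open>m\<^sup>i L / m\<^bsup>i+1\<^esup> L\<close>; its scalars are finitely supported
  families of cosets in \<open>m\<^sup>i / m\<^bsup>i+1\<^esup>\<close>, that is, elements of the associated graded ring.
\<close>

definition assoc_graded_module ::
    "('a, 'c) ring_scheme \<Rightarrow> 'a set \<Rightarrow> ('a, 'b, 'd) module_scheme \<Rightarrow>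
     (nat \<Rightarrow> 'a set, nat \<Rightarrow> 'b set) graded_module"
  where "assoc_graded_module R m L =
    (let G = gr_component R m L; S = sum_group UNIV G in
      \<lparr>carrier = carrier S, monoid.mult = undefined, one = undefined, ring.zero = \<one>\<^bsub>S\<^esub>, add = monoid.mult S,
       smult = (\<lambda>f g n. finprod (G n) (\<lambda>i. gr_pairing R m L i (n - i) (f i) (g (n - i))) {..n}),
       mcomp = (\<lambda>n. {g \<in> carrier S. \<forall>i. i \<noteq> n \<longrightarrow> g i = \<one>\<^bsub>G i\<^esub>})\<rparr>)"

definition assoc_graded_ring ::
    "('a, 'c) ring_scheme \<Rightarrow> 'a set \<Rightarrow> (nat \<Rightarrow> 'a set) graded_ring"
  where "assoc_graded_ring R m =
    (let G = assoc_graded_module R m (self_module R) in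
      \<lparr>carrier = carrier G, monoid.mult = smult G,
       one = (\<lambda>n. if n = 0 then ideal_pow_smult R m (self_module R) 1 +>\<^bsub>R\<^esub> \<one>\<^bsub>R\<^esub>
                  else ideal_pow_smult R m (self_module R) (Suc n)),
       ring.zero = \<zero>\<^bsub>G\<^esub>, add = add G, gcomp = mcomp G\<rparr>)"

definition koszul_local_ring :: "('a, 'c) ring_scheme \<Rightarrow> bool"
  where "koszul_local_ring R \<longleftrightarrow> noetherian_local_ring R \<and>
    koszul_algebra (assoc_graded_ring R (max_ideal R))"

end

theory Submission imports Defs
begin

text \<open>
  Let \<open>L\<close> be the graded module of \<open>M\<close> and \<open>\<delta> i\<close> the degree of the \<open>i\<close>-th generators in a pure minimal
  resolution of \<open>L\<close>. Lifting the columns one stage at a time gives a resolution \<open>\<Phi>\<close> of \<open>M\<close> which is strict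
  for the \<open>m\<close>-adic filtrations: an element of order \<open>c\<close> in the image of \<open>\<Phi> i\<close> comes from an element of order
  \<open>c - (\<delta> (i + 1) - \<delta> i)\<close>; strictness holds up to arbitrarily high powers of \<open>m\<close> by exactness over the
  associated graded ring, hence exactly by Krull's intersection theorem.

  Since \<open>m\<close> is the direct sum of two ideals \<open>J1\<close> and \<open>J2\<close>, a column \<open>y\<close> of a second or higher differential
  splits as \<open>y1 + y2\<close> with both parts cycles. One of them has the same order as \<open>y\<close>, so it is the image of
  some \<open>x\<close> not in \<open>m F\<close>; say it is \<open>y1\<close>. For \<open>b \<in> J2\<close> outside \<open>m\<^sup>2\<close> the element \<open>b x\<close> is a cycle of order one,
  which forces the next degree gap to be \<open>1\<close>. Both claims follow by comparing an arbitrary minimal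
  resolution with the pure one, respectively with its lift.
\<close>

text \<open>Purity makes the lifting uniform: all columns of one stage have the same order, so
  strictness needs a single shift per stage, \<open>gap i\<close>. As \<open>R\<close> need not be
  complete, the corrections made on the way cannot be summed to a limit; this is why an intersection
  theorem has to take over. The splitting starts at the second differential for a reason. A column
  of the first one is killed by the augmentation into \<open>M\<close>, where \<open>J1 M\<close>
  and \<open>J2 M\<close> may meet; a column of a later one is killed by a map of free modules,
  where \<open>J1 F\<close> and \<open>J2 F\<close> meet in zero. The relation \<open>b x\<close>
  lives one stage further up, so the gap \<open>1\<close> first appears at the third differential,
  and linearity is a property of the second syzygy. The element \<open>b\<close> exists because
  neither factor is its own residue field. Purity provides one resolution, whereas the conclusions
  concern all minimal ones; hence the comparison theorem, in homogeneous form over the graded ring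
  and without degrees over \<open>R\<close>.\<close>

lemma free_module_simps:
  "carrier (free_module R n) = {..<n} \<rightarrow>\<^sub>E carrier R"
  "\<zero>\<^bsub>free_module R n\<^esub> = (\<lambda>i\<in>{..<n}. \<zero>\<^bsub>R\<^esub>)"
  "v \<oplus>\<^bsub>free_module R n\<^esub> w = (\<lambda>i\<in>{..<n}. v i \<oplus>\<^bsub>R\<^esub> w i)"
  "a \<odot>\<^bsub>free_module R n\<^esub> v = (\<lambda>i\<in>{..<n}. a \<otimes>\<^bsub>R\<^esub> v i)"
  by (simp_all add: free_module_def)

lemma free_module_coord [simp]:
  assumes "i < n"
  shows "\<zero>\<^bsub>free_module R n\<^esub> i = \<zero>\<^bsub>R\<^esub>"
    and "(v \<oplus>\<^bsub>free_module R n\<^esub> w) i = v i \<oplus>\<^bsub>R\<^esub> w i"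
    and "(a \<odot>\<^bsub>free_module R n\<^esub> v) i = a \<otimes>\<^bsub>R\<^esub> v i"
  using assms by (simp_all add: free_module_simps)

lemma free_module_eqI:
  assumes "v \<in> carrier (free_module R n)" "w \<in> carrier (free_module R n)"
    and "\<And>i. i < n \<Longrightarrow> v i = w i"
  shows "v = w"
  using assms by (auto simp: free_module_simps intro: PiE_ext)

lemma free_module_coord_closed:
  "v \<in> carrier (free_module R n) \<Longrightarrow> i < n \<Longrightarrow> v i \<in> carrier R"
  by (auto simp: free_module_simps)

context cring
begin

lemma free_module_is_module: "module R (free_module R n)"
proof -
  let ?F = "free_module R n"
  have closed: "v \<in> carrier ?F \<Longrightarrow> w \<in> carrier ?F \<Longrightarrow> v \<oplus>\<^bsub>?F\<^esub> w \<in> carrier ?F"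
    "v \<in> carrier ?F \<Longrightarrow> a \<in> carrier R \<Longrightarrow> a \<odot>\<^bsub>?F\<^esub> v \<in> carrier ?F" for v w a
    by (auto simp: free_module_simps)
  have zc: "\<zero>\<^bsub>?F\<^esub> \<in> carrier ?F" by (auto simp: free_module_simps)
  note fc = free_module_coord_closed
  show ?thesis
  proof (rule moduleI)
    show "abelian_group ?F"
    proof (rule abelian_groupI)
      fix x assume x: "x \<in> carrier ?F"
      have "(\<lambda>i\<in>{..<n}. \<ominus> (x i)) \<in> carrier ?F"
        using fc[OF x] by (auto simp: free_module_simps)
      moreover have "(\<lambda>i\<in>{..<n}. \<ominus> (x i)) \<oplus>\<^bsub>?F\<^esub> x = \<zero>\<^bsub>?F\<^esub>"
        using fc[OF x] by (auto simp: free_module_simps l_neg intro!: restrict_ext)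
      ultimately show "\<exists>y\<in>carrier ?F. y \<oplus>\<^bsub>?F\<^esub> x = \<zero>\<^bsub>?F\<^esub>" by blast
    next
      fix x y z assume xyz: "x \<in> carrier ?F" "y \<in> carrier ?F" "z \<in> carrier ?F"
      note [simp] = fc[OF xyz(1)] fc[OF xyz(2)] fc[OF xyz(3)]
      show "x \<oplus>\<^bsub>?F\<^esub> y \<oplus>\<^bsub>?F\<^esub> z = x \<oplus>\<^bsub>?F\<^esub> (y \<oplus>\<^bsub>?F\<^esub> z)"
        by (rule free_module_eqI[of _ R n]) (simp_all add: closed xyz a_assoc)
    next
      fix x y assume xyz: "x \<in> carrier ?F" "y \<in> carrier ?F"
      note [simp] = fc[OF xyz(1)] fc[OF xyz(2)]
      show "x \<oplus>\<^bsub>?F\<^esub> y = y \<oplus>\<^bsub>?F\<^esub> x"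
        by (rule free_module_eqI[of _ R n]) (simp_all add: closed xyz a_comm)
    next
      fix x assume xyz: "x \<in> carrier ?F"
      note [simp] = fc[OF xyz(1)]
      show "\<zero>\<^bsub>?F\<^esub> \<oplus>\<^bsub>?F\<^esub> x = x"
        by (rule free_module_eqI[of _ R n]) (simp_all add: closed zc xyz)
    qed (use closed zc in auto)
  next
    fix a b x y assume xyz: "a \<in> carrier R" "b \<in> carrier R" "x \<in> carrier ?F" "y \<in> carrier ?F"
    note [simp] = fc[OF xyz(3)] fc[OF xyz(4)]
    show "a \<odot>\<^bsub>?F\<^esub> (x \<oplus>\<^bsub>?F\<^esub> y) = a \<odot>\<^bsub>?F\<^esub> x \<oplus>\<^bsub>?F\<^esub> a \<odot>\<^bsub>?F\<^esub> y"
      by (rule free_module_eqI[of _ R n]) (simp_all add: closed xyz r_distr)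
  next
    fix a b x assume xyz: "a \<in> carrier R" "b \<in> carrier R" "x \<in> carrier ?F"
    note [simp] = fc[OF xyz(3)]
    show "(a \<oplus> b) \<odot>\<^bsub>?F\<^esub> x = a \<odot>\<^bsub>?F\<^esub> x \<oplus>\<^bsub>?F\<^esub> b \<odot>\<^bsub>?F\<^esub> x"
      by (rule free_module_eqI[of _ R n]) (simp_all add: closed xyz l_distr)
    show "a \<otimes> b \<odot>\<^bsub>?F\<^esub> x = a \<odot>\<^bsub>?F\<^esub> (b \<odot>\<^bsub>?F\<^esub> x)"
      by (rule free_module_eqI[of _ R n]) (simp_all add: closed xyz m_assoc)
  next
    fix x assume xyz: "x \<in> carrier ?F"
    note [simp] = fc[OF xyz]
    show "\<one> \<odot>\<^bsub>?F\<^esub> x = x"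
      by (rule free_module_eqI[of _ R n]) (simp_all add: closed xyz)
  qed (use closed is_cring in auto)
qed

lemma free_module_minus_coord [simp]:
  assumes "v \<in> carrier (free_module R n)" "i < n"
  shows "(\<ominus>\<^bsub>free_module R n\<^esub> v) i = \<ominus> (v i)"
proof -
  interpret F: module R "free_module R n" by (rule free_module_is_module)
  have "\<ominus>\<^bsub>free_module R n\<^esub> v \<oplus>\<^bsub>free_module R n\<^esub> v = \<zero>\<^bsub>free_module R n\<^esub>"
    using assms by (simp add: F.l_neg)
  then have "(\<ominus>\<^bsub>free_module R n\<^esub> v) i \<oplus> v i = \<zero>"
    using free_module_coord(1,2)[OF assms(2)] by metis
  then show ?thesis
    using assms F.a_inv_closed free_module_coord_closed by (metis minus_equality)
qed

lemma free_module_diff_coord [simp]: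
  assumes "v \<in> carrier (free_module R n)" "w \<in> carrier (free_module R n)" "i < n"
  shows "(v \<ominus>\<^bsub>free_module R n\<^esub> w) i = v i \<ominus> w i"
  using assms by (simp add: a_minus_def)

lemma basis_vec_closed [simp]: "basis_vec R n t \<in> carrier (free_module R n)"
  by (auto simp: basis_vec_def free_module_simps)

lemma free_module_finsum_coord:
  assumes "finite T" "f \<in> T \<rightarrow> carrier (free_module R n)" "i < n"
  shows "finsum (free_module R n) f T i = finsum R (\<lambda>t. f t i) T"
  using assms
proof (induct T)
  case empty
  interpret F: module R "free_module R n" by (rule free_module_is_module)
  show ?case using empty by simp
next
  case (insert x T)
  interpret F: module R "free_module R n" by (rule free_module_is_module)
  have "(\<lambda>t. f t i) \<in> T \<rightarrow> carrier R" "f x i \<in> carrier R"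
    using insert.prems by (auto simp: Pi_iff intro!: free_module_coord_closed[of _ R n])
  then show ?case using insert by (simp add: Pi_iff)
qed

lemma free_module_expand:
  assumes v: "v \<in> carrier (free_module R n)"
  shows "v = finsum (free_module R n) (\<lambda>t. v t \<odot>\<^bsub>free_module R n\<^esub> basis_vec R n t) {..<n}"
proof -
  interpret F: module R "free_module R n" by (rule free_module_is_module)
  have c: "(\<lambda>t. v t \<odot>\<^bsub>free_module R n\<^esub> basis_vec R n t) \<in> {..<n} \<rightarrow> carrier (free_module R n)"
    using free_module_coord_closed[OF v] by auto
  show ?thesis
  proof (rule free_module_eqI[OF v F.finsum_closed[OF c]])
    fix i assume i: "i < n"
    have "finsum R (\<lambda>t. (v t \<odot>\<^bsub>free_module R n\<^esub> basis_vec R n t) i) {..<n}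
        = finsum R (\<lambda>t. if i = t then v t else \<zero>) {..<n}"
      using i v free_module_coord_closed[OF v] by (intro finsum_cong') (auto simp: basis_vec_def)
    also have "\<dots> = v i"
      using i v free_module_coord_closed[OF v] by (subst finsum_singleton) auto
    finally show "v i = finsum (free_module R n) (\<lambda>t. v t \<odot>\<^bsub>free_module R n\<^esub> basis_vec R n t) {..<n} i"
      using free_module_finsum_coord[OF _ c i] by simp
  qed
qed

end

section \<open>Homomorphisms, and maps out of free modules\<close>

lemma module_homD:
  assumes "h \<in> module_hom R M N"
  shows "x \<in> carrier M \<Longrightarrow> h x \<in> carrier N"
    and "x \<in> carrier M \<Longrightarrow> y \<in> carrier M \<Longrightarrow> h (x \<oplus>\<^bsub>M\<^esub> y) = h x \<oplus>\<^bsub>N\<^esub> h y"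
    and "a \<in> carrier R \<Longrightarrow> x \<in> carrier M \<Longrightarrow> h (a \<odot>\<^bsub>M\<^esub> x) = a \<odot>\<^bsub>N\<^esub> h x"
  using assms by (auto simp: module_hom_def)

lemma module_homI:
  assumes "\<And>x. x \<in> carrier M \<Longrightarrow> h x \<in> carrier N"
    and "\<And>x y. x \<in> carrier M \<Longrightarrow> y \<in> carrier M \<Longrightarrow> h (x \<oplus>\<^bsub>M\<^esub> y) = h x \<oplus>\<^bsub>N\<^esub> h y"
    and "\<And>a x. a \<in> carrier R \<Longrightarrow> x \<in> carrier M \<Longrightarrow> h (a \<odot>\<^bsub>M\<^esub> x) = a \<odot>\<^bsub>N\<^esub> h x"
  shows "h \<in> module_hom R M N"
  using assms by (auto simp: module_hom_def)

lemma module_hom_zero: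
  assumes "module R M" "module R N" "h \<in> module_hom R M N"
  shows "h \<zero>\<^bsub>M\<^esub> = \<zero>\<^bsub>N\<^esub>"
proof -
  interpret M: module R M by fact
  interpret N: module R N by fact
  have "h (\<zero>\<^bsub>R\<^esub> \<odot>\<^bsub>M\<^esub> \<zero>\<^bsub>M\<^esub>) = \<zero>\<^bsub>R\<^esub> \<odot>\<^bsub>N\<^esub> h \<zero>\<^bsub>M\<^esub>"
    using module_homD(3)[OF assms(3)] by blast
  then show ?thesis using module_homD(1)[OF assms(3)] by simp
qed

lemma module_hom_minus:
  assumes "module R M" "module R N" "h \<in> module_hom R M N" "x \<in> carrier M"
  shows "h (\<ominus>\<^bsub>M\<^esub> x) = \<ominus>\<^bsub>N\<^esub> h x"
proof -
  interpret M: module R M by fact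
  interpret N: module R N by fact
  have "h (\<ominus>\<^bsub>M\<^esub> x) \<oplus>\<^bsub>N\<^esub> h x = h \<zero>\<^bsub>M\<^esub>"
    using assms(4) module_homD(2)[OF assms(3), of "\<ominus>\<^bsub>M\<^esub> x" x] by (simp add: M.l_neg)
  then show ?thesis
    using module_homD(1)[OF assms(3)] assms(4) module_hom_zero[OF assms(1-3)]
    by (metis M.a_inv_closed N.minus_equality)
qed

lemma module_hom_diff:
  assumes "module R M" "module R N" "h \<in> module_hom R M N" "x \<in> carrier M" "y \<in> carrier M"
  shows "h (x \<ominus>\<^bsub>M\<^esub> y) = h x \<ominus>\<^bsub>N\<^esub> h y"
proof -
  interpret M: module R M by fact
  show ?thesis
  using assms module_homD(2)[OF assms(3)] module_hom_minus[OF assms(1-3)]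
  by (simp add: a_minus_def)
qed

lemma module_hom_comp:
  assumes "f \<in> module_hom R M N" "g \<in> module_hom R N P"
  shows "(\<lambda>x. g (f x)) \<in> module_hom R M P"
  using assms by (auto simp: module_hom_def Pi_iff)

lemma module_hom_sub:
  assumes "module R M" "module R N" "f \<in> module_hom R M N" "g \<in> module_hom R M N"
  shows "(\<lambda>x. f x \<ominus>\<^bsub>N\<^esub> g x) \<in> module_hom R M N"
proof -
  interpret M: module R M by fact
  interpret N: module R N by fact
  show ?thesis
  proof (rule module_homI)
    fix x y assume xy: "x \<in> carrier M" "y \<in> carrier M"
    then show "f (x \<oplus>\<^bsub>M\<^esub> y) \<ominus>\<^bsub>N\<^esub> g (x \<oplus>\<^bsub>M\<^esub> y) = f x \<ominus>\<^bsub>N\<^esub> g x \<oplus>\<^bsub>N\<^esub> (f y \<ominus>\<^bsub>N\<^esub> g y)"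
      using module_homD(1,2)[OF assms(3)] module_homD(1,2)[OF assms(4)]
      by (simp add: a_minus_def N.minus_add N.a_ac)
  next
    fix a x assume "a \<in> carrier R" "x \<in> carrier M"
    then show "f (a \<odot>\<^bsub>M\<^esub> x) \<ominus>\<^bsub>N\<^esub> g (a \<odot>\<^bsub>M\<^esub> x) = a \<odot>\<^bsub>N\<^esub> (f x \<ominus>\<^bsub>N\<^esub> g x)"
      using module_homD[OF assms(3)] module_homD[OF assms(4)]
      by (simp add: a_minus_def N.smult_r_distr N.smult_r_minus)
  qed (use module_homD(1)[OF assms(3)] module_homD(1)[OF assms(4)] in auto)
qed

lemma module_hom_finsum:
  assumes "module R M" "module R N" "h \<in> module_hom R M N"
    and "finite T" "f \<in> T \<rightarrow> carrier M"
  shows "h (finsum M f T) = finsum N (\<lambda>t. h (f t)) T"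
  using assms(4,5)
proof (induct T)
  case empty
  interpret M: module R M by fact
  interpret N: module R N by fact
  show ?case using module_hom_zero[OF assms(1-3)] by simp
next
  case (insert x T)
  interpret M: module R M by fact
  interpret N: module R N by fact
  show ?case using insert module_homD[OF assms(3)] by (simp add: Pi_iff)
qed

lemma module_hom_free_expand:
  assumes N: "module R N" and h: "h \<in> module_hom R (free_module R n) N"
    and v: "v \<in> carrier (free_module R n)"
  shows "h v = finsum N (\<lambda>t. v t \<odot>\<^bsub>N\<^esub> h (basis_vec R n t)) {..<n}"
proof -
  interpret N: module R N by fact
  interpret F: module R "free_module R n" by (rule N.free_module_is_module)
  have "h v = h (finsum (free_module R n) (\<lambda>t. v t \<odot>\<^bsub>free_module R n\<^esub> basis_vec R n t) {..<n})"
    using N.free_module_expand[OF v] by simp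
  also have "\<dots> = finsum N (\<lambda>t. h (v t \<odot>\<^bsub>free_module R n\<^esub> basis_vec R n t)) {..<n}"
    using v by (intro module_hom_finsum[OF F.module_axioms N h])
      (auto simp: free_module_coord_closed)
  also have "\<dots> = finsum N (\<lambda>t. v t \<odot>\<^bsub>N\<^esub> h (basis_vec R n t)) {..<n}"
    using v module_homD[OF h] by (intro N.finsum_cong') (auto simp: free_module_coord_closed)
  finally show ?thesis .
qed

lemma module_hom_free_ext:
  assumes "module R N" "h \<in> module_hom R (free_module R n) N" "h' \<in> module_hom R (free_module R n) N"
    and "\<And>t. t < n \<Longrightarrow> h (basis_vec R n t) = h' (basis_vec R n t)"
    and "v \<in> carrier (free_module R n)"
  shows "h v = h' v"
proof -
  interpret N: module R N by fact
  show ?thesis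
    unfolding module_hom_free_expand[OF assms(1,2,5)] module_hom_free_expand[OF assms(1,3,5)]
    using assms(4,5) module_homD(1)[OF assms(3)]
    by (intro N.finsum_cong') (auto simp: free_module_coord_closed)
qed

lemma module_hom_free_exists:
  assumes N: "module R N" and y: "\<And>t. t < n \<Longrightarrow> y t \<in> carrier N"
  shows "\<exists>h \<in> module_hom R (free_module R n) N. \<forall>t<n. h (basis_vec R n t) = y t"
proof -
  interpret N: module R N by fact
  interpret F: module R "free_module R n" by (rule N.free_module_is_module)
  define h where "h v = finsum N (\<lambda>t. v t \<odot>\<^bsub>N\<^esub> y t) {..<n}" for v
  have "h \<in> module_hom R (free_module R n) N"
  proof (rule module_homI)
    fix v assume "v \<in> carrier (free_module R n)"
    then show "h v \<in> carrier N"
      using y unfolding h_def by (intro N.finsum_closed) (auto simp: free_module_coord_closed)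
  next
    fix v w assume vw: "v \<in> carrier (free_module R n)" "w \<in> carrier (free_module R n)"
    have "h (v \<oplus>\<^bsub>free_module R n\<^esub> w) = finsum N (\<lambda>t. v t \<odot>\<^bsub>N\<^esub> y t \<oplus>\<^bsub>N\<^esub> w t \<odot>\<^bsub>N\<^esub> y t) {..<n}"
      unfolding h_def using vw y
      by (intro N.finsum_cong') (auto simp: free_module_coord_closed N.smult_l_distr)
    also have "\<dots> = h v \<oplus>\<^bsub>N\<^esub> h w"
      unfolding h_def using vw y
      by (intro N.finsum_addf) (auto simp: free_module_coord_closed)
    finally show "h (v \<oplus>\<^bsub>free_module R n\<^esub> w) = h v \<oplus>\<^bsub>N\<^esub> h w" .
  next
    fix a v assume av: "a \<in> carrier R" "v \<in> carrier (free_module R n)"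
    have "h (a \<odot>\<^bsub>free_module R n\<^esub> v) = finsum N (\<lambda>t. a \<odot>\<^bsub>N\<^esub> (v t \<odot>\<^bsub>N\<^esub> y t)) {..<n}"
      unfolding h_def using av y
      by (intro N.finsum_cong') (auto simp: free_module_coord_closed N.smult_assoc1)
    also have "\<dots> = a \<odot>\<^bsub>N\<^esub> h v"
      unfolding h_def using av y
      by (intro N.finsum_smult_ldistr[symmetric]) (auto simp: free_module_coord_closed)
    finally show "h (a \<odot>\<^bsub>free_module R n\<^esub> v) = a \<odot>\<^bsub>N\<^esub> h v" .
  qed
  moreover have "h (basis_vec R n t) = y t" if t: "t < n" for t
  proof -
    have "h (basis_vec R n t) = finsum N (\<lambda>s. if t = s then y s else \<zero>\<^bsub>N\<^esub>) {..<n}"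
      unfolding h_def using y t by (intro N.finsum_cong') (auto simp: basis_vec_def)
    also have "\<dots> = y t" using y t by (subst N.finsum_singleton) auto
    finally show ?thesis .
  qed
  ultimately show ?thesis by blast
qed

text \<open>Projectivity of free modules. The predicate \<open>P\<close> lets the chosen preimage of
  each column carry an extra property; the comparison theorem uses it to keep the columns
  homogeneous.\<close>

lemma module_hom_free_lift:
  assumes N: "module R N" and N': "module R N'"
    and p: "p \<in> module_hom R (free_module R n) N" and q: "q \<in> module_hom R N' N"
    and S: "\<And>t. t < n \<Longrightarrow> \<exists>x\<in>carrier N'. P t x \<and> q x = p (basis_vec R n t)"
  shows "\<exists>f \<in> module_hom R (free_module R n) N'.
     (\<forall>v\<in>carrier (free_module R n). q (f v) = p v) \<and> (\<forall>t<n. P t (f (basis_vec R n t)))"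
proof -
  obtain y where y: "\<And>t. t < n \<Longrightarrow> y t \<in> carrier N' \<and> P t (y t) \<and> q (y t) = p (basis_vec R n t)"
    using S by metis
  obtain f where f: "f \<in> module_hom R (free_module R n) N'" "\<And>t. t < n \<Longrightarrow> f (basis_vec R n t) = y t"
    using module_hom_free_exists[OF N', of n y] y by blast
  have "q (f v) = p v" if "v \<in> carrier (free_module R n)" for v
    by (rule module_hom_free_ext[OF N module_hom_comp[OF f(1) q] p _ that]) (use f(2) y in auto)
  then show ?thesis using f y by (intro bexI[OF _ f(1)]) simp
qed

text \<open>\<open>S\<close> is only asked to be an additive submonoid, so that it can be a single
  homogeneous component, which is not a submodule; scalars occur only inside the terms of the basis
  expansion.\<close>

lemma module_hom_free_closed:
  assumes N: "module R N" and h: "h \<in> module_hom R (free_module R n) N"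
    and v: "v \<in> carrier (free_module R n)"
    and S: "\<zero>\<^bsub>N\<^esub> \<in> S" "\<And>x y. x \<in> S \<Longrightarrow> y \<in> S \<Longrightarrow> x \<oplus>\<^bsub>N\<^esub> y \<in> S" "S \<subseteq> carrier N"
    and t: "\<And>t. t < n \<Longrightarrow> v t \<odot>\<^bsub>N\<^esub> h (basis_vec R n t) \<in> S"
  shows "h v \<in> S"
proof -
  interpret N: module R N by fact
  have "finsum N (\<lambda>t. v t \<odot>\<^bsub>N\<^esub> h (basis_vec R n t)) T \<in> S" if "finite T" "T \<subseteq> {..<n}" for T
    using that
  proof (induct T)
    case (insert x T)
    have "v t \<odot>\<^bsub>N\<^esub> h (basis_vec R n t) \<in> carrier N" if "t \<in> {..<n}" for t
      using t[of t] that S(3) by auto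
    with insert show ?case using S t by (simp add: Pi_iff subset_iff)
  qed (use S in simp)
  then show ?thesis unfolding module_hom_free_expand[OF N h v] by blast
qed

text \<open>The module axioms pass to a surjective image. This yields that the target of an
  augmentation is a module, for instance the associated graded module over its graded ring. The
  condition on zero is separate because the zero of a bare record is not determined by its
  addition.\<close>

lemma module_of_surj_hom:
  assumes "module R M" and h: "h \<in> module_hom R M N" and s: "h ` carrier M = carrier N"
    and z: "h \<zero>\<^bsub>M\<^esub> = \<zero>\<^bsub>N\<^esub>"
  shows "module R N"
proof -
  interpret M: module R M by fact
  note H = module_homD[OF h]
  note hs = H(2)[symmetric] H(3)[symmetric] z[symmetric] s[symmetric]
  show ?thesis
  proof (rule moduleI)
    show "abelian_group N"
    proof (rule abelian_groupI)
      fix x assume "x \<in> carrier N"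
      then obtain x' where "x = h x'" "x' \<in> carrier M" using s by blast
      then show "\<exists>y\<in>carrier N. y \<oplus>\<^bsub>N\<^esub> x = \<zero>\<^bsub>N\<^esub>"
        by (intro bexI[of _ "h (\<ominus>\<^bsub>M\<^esub> x')"]) (auto simp: hs M.l_neg)
    qed (auto simp: hs M.a_ac)
  qed (auto simp: hs M.is_cring M.smult_l_distr M.smult_r_distr M.smult_assoc1)
qed

section \<open>Submodules: images, preimages, intersections and sums\<close>

lemma submodule_rules:
  assumes "module R N" "submodule K R N"
  shows "K \<subseteq> carrier N" "\<zero>\<^bsub>N\<^esub> \<in> K"
    and "x \<in> K \<Longrightarrow> y \<in> K \<Longrightarrow> x \<oplus>\<^bsub>N\<^esub> y \<in> K"
    and "x \<in> K \<Longrightarrow> \<ominus>\<^bsub>N\<^esub> x \<in> K"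
    and "x \<in> K \<Longrightarrow> y \<in> K \<Longrightarrow> x \<ominus>\<^bsub>N\<^esub> y \<in> K"
    and "a \<in> carrier R \<Longrightarrow> x \<in> K \<Longrightarrow> a \<odot>\<^bsub>N\<^esub> x \<in> K"
proof -
  interpret N: module R N by fact
  show "K \<subseteq> carrier N" "\<zero>\<^bsub>N\<^esub> \<in> K"
    using N.submoduleE(1)[OF assms(2)] subgroup.one_closed[OF submodule.axioms(1)[OF assms(2)]] by auto
  show "x \<in> K \<Longrightarrow> y \<in> K \<Longrightarrow> x \<oplus>\<^bsub>N\<^esub> y \<in> K" "x \<in> K \<Longrightarrow> \<ominus>\<^bsub>N\<^esub> x \<in> K"
    "a \<in> carrier R \<Longrightarrow> x \<in> K \<Longrightarrow> a \<odot>\<^bsub>N\<^esub> x \<in> K" "x \<in> K \<Longrightarrow> y \<in> K \<Longrightarrow> x \<ominus>\<^bsub>N\<^esub> y \<in> K"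
    using N.submoduleE[OF assms(2)] by (auto simp: a_minus_def)
qed

lemma submodule_image:
  assumes M: "module R M" and N: "module R N" and h: "h \<in> module_hom R M N" and K: "submodule K R M"
  shows "submodule (h ` K) R N"
proof -
  interpret M: module R M by fact
  interpret N: module R N by fact
  note K' = submodule_rules[OF M K]
  note H = module_homD[OF h]
  have c: "x \<in> K \<Longrightarrow> x \<in> carrier M" for x using K'(1) by blast
  show ?thesis
  proof (rule N.submoduleI)
    show "\<zero>\<^bsub>N\<^esub> \<in> h ` K" using K'(2) module_hom_zero[OF M N h] by (metis imageI)
    fix a assume "a \<in> h ` K"
    then obtain x where "x \<in> K" "a = h x" by blast
    then show "\<ominus>\<^bsub>N\<^esub> a \<in> h ` K" using K'(4) module_hom_minus[OF M N h c] by (metis imageI)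
    fix b assume "b \<in> h ` K"
    then show "a \<oplus>\<^bsub>N\<^esub> b \<in> h ` K"
      using K'(3) H(2)[OF c c] \<open>a \<in> h ` K\<close> by (metis (no_types, lifting) imageE imageI)
  next
    fix a x assume "a \<in> carrier R" "x \<in> h ` K"
    then show "a \<odot>\<^bsub>N\<^esub> x \<in> h ` K"
      using K'(6) H(3)[OF _ c] by (metis (no_types, lifting) imageE imageI)
  qed (use H(1) c in auto)
qed

lemma submodule_preimage:
  assumes M: "module R M" and N: "module R N" and h: "h \<in> module_hom R M N" and K: "submodule K R N"
  shows "submodule {x \<in> carrier M. h x \<in> K} R M"
proof -
  interpret M: module R M by fact
  interpret N: module R N by fact
  show ?thesis
    using submodule_rules[OF N K] module_homD[OF h] module_hom_zero[OF M N h]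
      module_hom_minus[OF M N h]
    by (intro M.submoduleI) auto
qed

lemma submodule_Int:
  assumes "module R M" "submodule K R M" "submodule L R M"
  shows "submodule (K \<inter> L) R M"
proof -
  interpret M: module R M by fact
  show ?thesis
    using submodule_rules[OF assms(1,2)] submodule_rules[OF assms(1,3)]
    by (intro M.submoduleI) auto
qed

lemma submodule_add:
  assumes "module R M" "submodule K R M" "submodule L R M"
  shows "submodule {x \<oplus>\<^bsub>M\<^esub> y |x y. x \<in> K \<and> y \<in> L} R M" (is "submodule ?S R M")
    and "K \<subseteq> {x \<oplus>\<^bsub>M\<^esub> y |x y. x \<in> K \<and> y \<in> L}"
    and "L \<subseteq> {x \<oplus>\<^bsub>M\<^esub> y |x y. x \<in> K \<and> y \<in> L}"
proof -
  interpret M: module R M by fact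
  note K = submodule_rules[OF assms(1,2)] and L = submodule_rules[OF assms(1,3)]
  have c: "x \<in> K \<Longrightarrow> x \<in> carrier M" "x \<in> L \<Longrightarrow> x \<in> carrier M" for x using K(1) L(1) by auto
  show "submodule ?S R M"
  proof (rule M.submoduleI)
    have "\<zero>\<^bsub>M\<^esub> = \<zero>\<^bsub>M\<^esub> \<oplus>\<^bsub>M\<^esub> \<zero>\<^bsub>M\<^esub>" by simp
    then show "\<zero>\<^bsub>M\<^esub> \<in> ?S" using K(2) L(2) by blast
  next
    fix a assume "a \<in> ?S"
    then obtain x y where xy: "x \<in> K" "y \<in> L" "a = x \<oplus>\<^bsub>M\<^esub> y" by blast
    then have "\<ominus>\<^bsub>M\<^esub> a = (\<ominus>\<^bsub>M\<^esub> x) \<oplus>\<^bsub>M\<^esub> (\<ominus>\<^bsub>M\<^esub> y)" using c by (simp add: M.minus_add)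
    then show "\<ominus>\<^bsub>M\<^esub> a \<in> ?S" using xy K(4) L(4) by blast
  next
    fix a b assume "a \<in> ?S" "b \<in> ?S"
    then obtain x y z w where xy: "x \<in> K" "y \<in> L" "a = x \<oplus>\<^bsub>M\<^esub> y" "z \<in> K" "w \<in> L" "b = z \<oplus>\<^bsub>M\<^esub> w"
      by blast
    then have "a \<oplus>\<^bsub>M\<^esub> b = (x \<oplus>\<^bsub>M\<^esub> z) \<oplus>\<^bsub>M\<^esub> (y \<oplus>\<^bsub>M\<^esub> w)" using c by (simp add: M.a_ac)
    then show "a \<oplus>\<^bsub>M\<^esub> b \<in> ?S" using xy K(3) L(3) by blast
  next
    fix r a assume r: "r \<in> carrier R" and "a \<in> ?S"
    then obtain x y where xy: "x \<in> K" "y \<in> L" "a = x \<oplus>\<^bsub>M\<^esub> y" by blast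
    then have "r \<odot>\<^bsub>M\<^esub> a = r \<odot>\<^bsub>M\<^esub> x \<oplus>\<^bsub>M\<^esub> r \<odot>\<^bsub>M\<^esub> y" using c r by (simp add: M.smult_r_distr)
    then show "r \<odot>\<^bsub>M\<^esub> a \<in> ?S" using xy K(6) L(6) r by blast
  qed (use c in auto)
  show "K \<subseteq> {x \<oplus>\<^bsub>M\<^esub> y |x y. x \<in> K \<and> y \<in> L}"
  proof
    fix x assume "x \<in> K"
    then show "x \<in> {x \<oplus>\<^bsub>M\<^esub> y |x y. x \<in> K \<and> y \<in> L}"
      using L(2) c M.r_zero[of x] by (smt (verit) mem_Collect_eq)
  qed
  show "L \<subseteq> {x \<oplus>\<^bsub>M\<^esub> y |x y. x \<in> K \<and> y \<in> L}"
  proof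
    fix x assume "x \<in> L"
    then show "x \<in> {x \<oplus>\<^bsub>M\<^esub> y |x y. x \<in> K \<and> y \<in> L}"
      using K(2) c M.l_zero[of x] by (smt (verit) mem_Collect_eq)
  qed
qed

lemma cyclic_submodule:
  assumes "module R M" "x \<in> carrier M"
  shows "submodule {a \<odot>\<^bsub>M\<^esub> x |a. a \<in> carrier R} R M" and "x \<in> {a \<odot>\<^bsub>M\<^esub> x |a. a \<in> carrier R}"
proof -
  interpret M: module R M by fact
  let ?S = "{a \<odot>\<^bsub>M\<^esub> x |a. a \<in> carrier R}"
  have I: "a \<in> carrier R \<Longrightarrow> y = a \<odot>\<^bsub>M\<^esub> x \<Longrightarrow> y \<in> ?S" for a y by blast
  show "submodule ?S R M"
  proof (rule M.submoduleI)
    show "\<zero>\<^bsub>M\<^esub> \<in> ?S" by (rule I[of "\<zero>\<^bsub>R\<^esub>"]) (use assms(2) in simp_all)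
  next
    fix a assume "a \<in> ?S"
    then obtain b where "b \<in> carrier R" "a = b \<odot>\<^bsub>M\<^esub> x" by blast
    then show "\<ominus>\<^bsub>M\<^esub> a \<in> ?S" using assms(2) by (intro I[of "\<ominus>\<^bsub>R\<^esub> b"]) (simp_all add: M.smult_l_minus)
  next
    fix a c assume "a \<in> ?S" "c \<in> ?S"
    then obtain b d where "b \<in> carrier R" "a = b \<odot>\<^bsub>M\<^esub> x" "d \<in> carrier R" "c = d \<odot>\<^bsub>M\<^esub> x" by blast
    then show "a \<oplus>\<^bsub>M\<^esub> c \<in> ?S" using assms(2) by (intro I[of "b \<oplus>\<^bsub>R\<^esub> d"]) (simp_all add: M.smult_l_distr)
  next
    fix r a assume r: "r \<in> carrier R" and "a \<in> ?S"
    then obtain b where "b \<in> carrier R" "a = b \<odot>\<^bsub>M\<^esub> x" by blast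
    then show "r \<odot>\<^bsub>M\<^esub> a \<in> ?S"
      using assms(2) r by (intro I[of "r \<otimes>\<^bsub>R\<^esub> b"]) (simp_all add: M.smult_assoc1)
  qed (use assms(2) in auto)
  show "x \<in> ?S" by (rule I[of "\<one>\<^bsub>R\<^esub>"]) (use assms(2) in simp_all)
qed

lemma scaled_submodule:
  assumes "module R M" "a \<in> carrier R"
  shows "submodule ((\<odot>\<^bsub>M\<^esub>) a ` carrier M) R M"
proof -
  interpret M: module R M by fact
  have "(\<odot>\<^bsub>M\<^esub>) a \<in> module_hom R M M"
  proof (rule module_homI)
    fix b x assume "b \<in> carrier R" "x \<in> carrier M"
    then show "a \<odot>\<^bsub>M\<^esub> (b \<odot>\<^bsub>M\<^esub> x) = b \<odot>\<^bsub>M\<^esub> (a \<odot>\<^bsub>M\<^esub> x)"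
      using assms(2) by (metis M.R.m_comm M.smult_assoc1)
  qed (use assms(2) M.smult_r_distr in auto)
  from submodule_image[OF assms(1,1) this M.carrier_is_submodule] show ?thesis .
qed

section \<open>Powers of an ideal acting on a module\<close>

lemma ideal_smult_incl:
  assumes "a \<in> I" "x \<in> carrier N"
  shows "a \<odot>\<^bsub>N\<^esub> x \<in> ideal_smult I N"
  unfolding ideal_smult_def using assms by (intro generate.incl) blast

lemma ideal_smult_least:
  assumes N: "module R N" and K: "submodule K R N"
    and "\<And>a x. a \<in> I \<Longrightarrow> x \<in> carrier N \<Longrightarrow> a \<odot>\<^bsub>N\<^esub> x \<in> K"
  shows "ideal_smult I N \<subseteq> K"
proof -
  interpret N: module R N by fact
  show ?thesis unfolding ideal_smult_def
    by (rule N.add.generate_subgroup_incl) (use assms(3) submodule.axioms(1)[OF K] in auto)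
qed

lemma ideal_smult_submodule:
  assumes N: "module R N" and I: "ideal I R"
  shows "submodule (ideal_smult I N) R N"
proof -
  interpret N: module R N by fact
  let ?G = "{a \<odot>\<^bsub>N\<^esub> x |a x. a \<in> I \<and> x \<in> carrier N}"
  have G: "?G \<subseteq> carrier (add_monoid N)" using ideal.Icarr[OF I] by auto
  have c: "ideal_smult I N \<subseteq> carrier N"
    unfolding ideal_smult_def using N.add.generate_incl[of ?G] G by simp
  have sg: "subgroup (ideal_smult I N) (add_monoid N)"
    unfolding ideal_smult_def using N.add.generate_is_subgroup[of ?G] G by simp
  have "a \<odot>\<^bsub>N\<^esub> x \<in> ideal_smult I N" if a: "a \<in> carrier R" and x: "x \<in> ideal_smult I N" for a x
    using x unfolding ideal_smult_def
  proof (induct rule: generate.induct)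
    case one then show ?case using a generate.one[of "add_monoid N"] by simp
  next
    case (incl h)
    then obtain b y where by': "b \<in> I" "y \<in> carrier N" "h = b \<odot>\<^bsub>N\<^esub> y" by blast
    then have "a \<odot>\<^bsub>N\<^esub> h = (a \<otimes>\<^bsub>R\<^esub> b) \<odot>\<^bsub>N\<^esub> y"
      using a ideal.Icarr[OF I] by (simp add: N.smult_assoc1)
    then show ?case using by' ideal.I_l_closed[OF I _ a] by (intro generate.incl) blast
  next
    case (inv h)
    then obtain b y where by': "b \<in> I" "y \<in> carrier N" "h = b \<odot>\<^bsub>N\<^esub> y" by blast
    then have "a \<odot>\<^bsub>N\<^esub> h = (a \<otimes>\<^bsub>R\<^esub> b) \<odot>\<^bsub>N\<^esub> y"
      using a ideal.Icarr[OF I] by (simp add: N.smult_assoc1)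
    then have "a \<odot>\<^bsub>N\<^esub> h \<in> ?G" using by' ideal.I_l_closed[OF I _ a] by blast
    from generate.inv[OF this, of "add_monoid N"]
    show ?case using a by' ideal.Icarr[OF I] N.smult_r_minus[OF a, of h] by (simp add: a_inv_def)
  next
    case (eng h1 h2)
    have "h1 \<in> carrier N" "h2 \<in> carrier N"
      using c eng(1,3) unfolding ideal_smult_def by auto
    then show ?case using generate.eng[OF eng(2,4)] a by (simp add: N.smult_r_distr)
  qed
  then show ?thesis
    using sg by (intro submodule.intro submodule_axioms.intro)
qed

lemma ideal_smult_hom:
  assumes "module R M" "module R N" and h: "h \<in> module_hom R M N" and I: "ideal I R"
    and "x \<in> ideal_smult I M"
  shows "h x \<in> ideal_smult I N"
proof -
  have "ideal_smult I M \<subseteq> {x \<in> carrier M. h x \<in> ideal_smult I N}"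
    by (rule ideal_smult_least[OF assms(1)
        submodule_preimage[OF assms(1-3) ideal_smult_submodule[OF assms(2) I]]])
      (use module_homD[OF h] ideal.Icarr[OF I] module.smult_closed[OF assms(1)] in \<open>auto intro: ideal_smult_incl\<close>)
  then show ?thesis using assms by blast
qed

lemma (in cring) free_module_vecs_submodule:
  assumes I: "ideal I R"
  shows "submodule ({..<n} \<rightarrow>\<^sub>E I) R (free_module R n)"
proof -
  interpret F: module R "free_module R n" by (rule free_module_is_module)
  interpret I: ideal I R by fact
  have c: "({..<n} \<rightarrow>\<^sub>E I) \<subseteq> carrier (free_module R n)"
    unfolding free_module_simps using I.a_subset by (intro PiE_mono)
  show ?thesis
  proof (rule F.submoduleI[OF c])
    fix a assume a: "a \<in> {..<n} \<rightarrow>\<^sub>E I"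
    then have "\<ominus>\<^bsub>free_module R n\<^esub> a \<in> carrier (free_module R n)" using c by blast
    then have "\<ominus>\<^bsub>free_module R n\<^esub> a \<in> extensional {..<n}" by (auto simp: free_module_simps PiE_iff)
    then show "\<ominus>\<^bsub>free_module R n\<^esub> a \<in> {..<n} \<rightarrow>\<^sub>E I"
      using a c by (auto simp: PiE_iff subset_iff)
  qed (use I.I_l_closed in \<open>auto simp: free_module_simps PiE_iff\<close>)
qed

text \<open>Membership in \<open>I F\<close> becomes a condition on coordinates. Applied to powers
  of \<open>m\<close>, to the irrelevant ideal and to the summands \<open>J1\<close> and
  \<open>J2\<close>, this lets order, minimality and the splitting be checked one coordinate at a
  time.\<close>

lemma (in cring) ideal_smult_free_module:
  assumes I: "ideal I R"
  shows "ideal_smult I (free_module R n) = ({..<n} \<rightarrow>\<^sub>E I)"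
proof
  interpret I: ideal I R by fact
  show "ideal_smult I (free_module R n) \<subseteq> ({..<n} \<rightarrow>\<^sub>E I)"
    by (rule ideal_smult_least[OF free_module_is_module free_module_vecs_submodule[OF I]])
      (auto simp: free_module_simps PiE_iff intro: I.I_r_closed)
  show "({..<n} \<rightarrow>\<^sub>E I) \<subseteq> ideal_smult I (free_module R n)"
  proof
    fix v assume v: "v \<in> {..<n} \<rightarrow>\<^sub>E I"
    let ?F = "free_module R n"
    interpret F: module R ?F by (rule free_module_is_module)
    note S = submodule_rules[OF free_module_is_module ideal_smult_submodule[OF free_module_is_module I]]
    have vc: "v \<in> carrier ?F" using v by (auto simp: free_module_simps PiE_iff)
    \<comment> \<open>The identity is used as a homomorphism in order to invoke the basis expansion
      of \<open>v\<close>, each term of which is a generator of \<open>I F\<close>.\<close>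
    have "id v \<in> ideal_smult I ?F"
      by (rule module_hom_free_closed[OF free_module_is_module _ vc])
        (use v S in \<open>auto simp: module_hom_def intro!: ideal_smult_incl\<close>)
    then show "v \<in> ideal_smult I ?F" by simp
  qed
qed

section \<open>The \<open>m\<close>-adic filtration of rings and modules\<close>

locale adic = cring R for R (structure) +
  fixes m assumes m_ideal: "ideal m R"
begin

definition mpow :: "nat \<Rightarrow> 'a set" where "mpow i = m [^]\<^bsub>ideals_set R\<^esub> i"

lemma mpow_ideal: "ideal (mpow i) R"
proof -
  interpret S: comm_monoid "ideals_set R" by (rule ideals_set_is_comm_monoid)
  show ?thesis using S.nat_pow_closed[of m i] m_ideal by (simp add: ideals_set_def mpow_def)
qed

lemma mpow_0 [simp]: "mpow 0 = carrier R"
  by (simp add: ideals_set_def nat_pow_def mpow_def)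

lemma mpow_add: "mpow (i + j) = mpow i \<cdot> mpow j"
proof -
  interpret S: comm_monoid "ideals_set R" by (rule ideals_set_is_comm_monoid)
  have "mpow i \<otimes>\<^bsub>ideals_set R\<^esub> mpow j = mpow (i + j)"
    unfolding mpow_def by (rule S.nat_pow_mult) (simp add: ideals_set_def m_ideal)
  then show ?thesis by (simp add: ideals_set_def)
qed

lemma mpow_1 [simp]: "mpow (Suc 0) = m"
proof -
  interpret S: comm_monoid "ideals_set R" by (rule ideals_set_is_comm_monoid)
  show ?thesis using S.nat_pow_eone[of m] by (simp add: ideals_set_def m_ideal mpow_def)
qed

lemma mpow_mult: "x \<in> mpow i \<Longrightarrow> y \<in> mpow j \<Longrightarrow> x \<otimes> y \<in> mpow (i + j)"
  unfolding mpow_add by (rule ideal_prod.prod)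

lemma mpow_carr: "x \<in> mpow i \<Longrightarrow> x \<in> carrier R"
  using ideal.Icarr[OF mpow_ideal] .

lemma mpow_antimono:
  assumes "i \<le> j" shows "mpow j \<subseteq> mpow i"
proof -
  have "mpow (i + (j - i)) \<subseteq> mpow i"
    unfolding mpow_add using ideal_prod_inter[OF mpow_ideal mpow_ideal] by blast
  then show ?thesis using assms by simp
qed

abbreviation Mp where "Mp N i \<equiv> ideal_pow_smult R m N i"

lemma Mp_alt: "Mp N i = ideal_smult (mpow i) N"
  by (simp add: ideal_pow_smult_def mpow_def)

context
  fixes N assumes N: "module R N"
begin

interpretation N: module R N by (rule N)

lemma Mp_submodule: "submodule (Mp N i) R N"
  unfolding Mp_alt by (rule ideal_smult_submodule[OF N mpow_ideal])

lemmas Mp_rules = submodule_rules[OF N Mp_submodule]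

lemma Mp_carr: "x \<in> Mp N i \<Longrightarrow> x \<in> carrier N"
  using Mp_rules(1) by blast

lemma Mp_0 [simp]: "Mp N 0 = carrier N"
proof
  show "carrier N \<subseteq> Mp N 0"
  proof
    fix x assume x: "x \<in> carrier N"
    then have "\<one> \<odot>\<^bsub>N\<^esub> x \<in> Mp N 0" unfolding Mp_alt by (intro ideal_smult_incl) simp_all
    then show "x \<in> Mp N 0" using x by simp
  qed
qed (rule Mp_rules)

lemma Mp_antimono:
  assumes "i \<le> j" shows "Mp N j \<subseteq> Mp N i"
  unfolding Mp_alt
  by (rule ideal_smult_least[OF N ideal_smult_submodule[OF N mpow_ideal]])
    (use mpow_antimono[OF assms] in \<open>auto intro: ideal_smult_incl\<close>)

text \<open>The elements that \<open>a\<close> sends into \<open>Mp N (i + j)\<close> form a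
  submodule, so only the generators \<open>b x\<close> with \<open>b\<close> in
  \<open>mpow j\<close> have to be checked.\<close>

lemma Mp_smult:
  assumes a: "a \<in> mpow i" and x: "x \<in> Mp N j"
  shows "a \<odot>\<^bsub>N\<^esub> x \<in> Mp N (i + j)"
proof -
  have ac: "a \<in> carrier R" using a mpow_carr by blast
  have "(\<odot>\<^bsub>N\<^esub>) a \<in> module_hom R N N"
  proof (rule module_homI)
    fix b x assume "b \<in> carrier R" "x \<in> carrier N"
    then show "a \<odot>\<^bsub>N\<^esub> (b \<odot>\<^bsub>N\<^esub> x) = b \<odot>\<^bsub>N\<^esub> (a \<odot>\<^bsub>N\<^esub> x)"
      using ac by (metis m_comm N.smult_assoc1)
  qed (use ac N.smult_r_distr in auto)
  then have "submodule {x \<in> carrier N. a \<odot>\<^bsub>N\<^esub> x \<in> Mp N (i + j)} R N"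
    by (rule submodule_preimage[OF N N _ Mp_submodule])
  then have "Mp N j \<subseteq> {x \<in> carrier N. a \<odot>\<^bsub>N\<^esub> x \<in> Mp N (i + j)}"
    unfolding Mp_alt[of _ j]
  proof (rule ideal_smult_least[OF N])
    fix b x assume bx: "b \<in> mpow j" "x \<in> carrier N"
    have "(a \<otimes> b) \<odot>\<^bsub>N\<^esub> x \<in> Mp N (i + j)"
      unfolding Mp_alt using mpow_mult[OF a bx(1)] bx(2) by (rule ideal_smult_incl)
    then show "b \<odot>\<^bsub>N\<^esub> x \<in> {x \<in> carrier N. a \<odot>\<^bsub>N\<^esub> x \<in> Mp N (i + j)}"
      using bx ac mpow_carr by (simp add: N.smult_assoc1)
  qed
  then show ?thesis using x by blast
qed

end

lemma Mp_hom:
  assumes "module R M" "module R N" "h \<in> module_hom R M N" "x \<in> Mp M i"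
  shows "h x \<in> Mp N i"
  using ideal_smult_hom[OF assms(1-3) mpow_ideal] assms(4) unfolding Mp_alt .

lemma Mp_free: "Mp (free_module R n) i = ({..<n} \<rightarrow>\<^sub>E mpow i)"
  unfolding Mp_alt by (rule ideal_smult_free_module[OF mpow_ideal])

lemma Mp_free_coord: "v \<in> Mp (free_module R n) i \<Longrightarrow> t < n \<Longrightarrow> v t \<in> mpow i"
  by (auto simp: Mp_free)

text \<open>The easy half of the order estimate. The converse, that an image of high order has a
  preimage of high order, is strictness and rests on exactness over the graded ring.\<close>

lemma Mp_free_hom:
  assumes N: "module R N" and h: "h \<in> module_hom R (free_module R n) N"
    and t: "\<And>t. t < n \<Longrightarrow> h (basis_vec R n t) \<in> Mp N a" and v: "v \<in> Mp (free_module R n) b"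
  shows "h v \<in> Mp N (b + a)"
proof (rule module_hom_free_closed[OF N h Mp_carr[OF free_module_is_module v]])
  show "v s \<odot>\<^bsub>N\<^esub> h (basis_vec R n s) \<in> Mp N (b + a)" if "s < n" for s
    using Mp_smult[OF N Mp_free_coord[OF v that] t[OF that]] .
qed (use Mp_rules[OF N] in auto)

end

section \<open>Noetherian modules and Krull's intersection theorem\<close>

text \<open>Finite generation is phrased without a span: \<open>K\<close> is the least submodule
  containing \<open>S\<close>.\<close>

definition noetherian_module :: "('a, 'c) ring_scheme \<Rightarrow> ('a, 'b, 'd) module_scheme \<Rightarrow> bool"
  where "noetherian_module R N \<longleftrightarrow> module R N \<and>
    (\<forall>K. submodule K R N \<longrightarrow> (\<exists>S. finite S \<and> S \<subseteq> K \<and> (\<forall>K'. submodule K' R N \<longrightarrow> S \<subseteq> K' \<longrightarrow> K \<subseteq> K')))"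

lemma noetherian_moduleD:
  assumes "noetherian_module R N" "submodule K R N"
  shows "\<exists>S. finite S \<and> S \<subseteq> K \<and> (\<forall>K'. submodule K' R N \<longrightarrow> S \<subseteq> K' \<longrightarrow> K \<subseteq> K')"
  using assms unfolding noetherian_module_def by simp

text \<open>Zorn's lemma applies because the union of a chain is finitely generated, its generators
  already lie in one member, and so the union is that member.\<close>

lemma noetherian_module_maximal:
  assumes N: "noetherian_module R N" and S: "\<And>K. K \<in> S \<Longrightarrow> submodule K R N" and ne: "S \<noteq> {}"
  shows "\<exists>K\<in>S. \<forall>K'\<in>S. K \<subseteq> K' \<longrightarrow> K' = K"
proof -
  have mod: "module R N" using N by (simp add: noetherian_module_def)
  interpret N: module R N by (rule mod)
  show ?thesis
  proof (rule subset_Zorn_nonempty[OF ne])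
    fix C assume C: "C \<noteq> {}" "subset.chain S C"
    then have CS: "C \<subseteq> S" and lin: "\<And>W Y. W \<in> C \<Longrightarrow> Y \<in> C \<Longrightarrow> W \<subseteq> Y \<or> Y \<subseteq> W"
      by (auto simp: pred_on.chain_def)
    have sub: "\<And>W. W \<in> C \<Longrightarrow> submodule W R N" using CS S by blast
    have fin: "\<exists>W\<in>C. T \<subseteq> W" if "finite T" "T \<subseteq> \<Union>C" for T
      using that
    proof (induct T)
      case (insert t T)
      then obtain W Y where "W \<in> C" "T \<subseteq> W" "Y \<in> C" "t \<in> Y" by auto
      then show ?case using lin[of W Y] by blast
    qed (use C in blast)
    have "submodule (\<Union>C) R N"
    proof (rule N.submoduleI)
      fix a b assume ab: "a \<in> \<Union>C" "b \<in> \<Union>C"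
      then obtain W where "W \<in> C" "a \<in> W" "b \<in> W" using fin[of "{a, b}"] by auto
      then show "a \<oplus>\<^bsub>N\<^esub> b \<in> \<Union>C" using submodule_rules(3)[OF mod sub] by blast
    next
      obtain W where "W \<in> C" using C by blast
      then show "\<zero>\<^bsub>N\<^esub> \<in> \<Union>C" using submodule_rules(2)[OF mod sub] by blast
    next
      show "\<Union>C \<subseteq> carrier N" using submodule_rules(1)[OF mod sub] by blast
    next
      fix a assume "a \<in> \<Union>C"
      then show "\<ominus>\<^bsub>N\<^esub> a \<in> \<Union>C" using submodule_rules(4)[OF mod sub] by blast
    next
      fix r a assume "r \<in> carrier R" "a \<in> \<Union>C"
      then show "r \<odot>\<^bsub>N\<^esub> a \<in> \<Union>C" using submodule_rules(6)[OF mod sub] by blast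
    qed
    from noetherian_moduleD[OF N this]
    obtain T where T: "finite T" "T \<subseteq> \<Union>C"
      "\<forall>K'. submodule K' R N \<longrightarrow> T \<subseteq> K' \<longrightarrow> \<Union>C \<subseteq> K'" by blast
    obtain W where W: "W \<in> C" "T \<subseteq> W" using fin[OF T(1,2)] by blast
    have "\<Union>C = W" using T(3)[rule_format, OF sub[OF W(1)] W(2)] W(1) by blast
    then show "\<Union>C \<in> S" using W(1) CS by blast
  qed
qed

text \<open>Generators of the preimage of a submodule map to generators of the submodule. The
  intended surjection is an augmentation, which presents a module as an image of a free one.\<close>

lemma noetherian_module_image:
  assumes M: "noetherian_module R M" and N: "module R N"
    and h: "h \<in> module_hom R M N" and surj: "h ` carrier M = carrier N"
  shows "noetherian_module R N"
proof -
  have M': "module R M" using M by (simp add: noetherian_module_def)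
  show ?thesis unfolding noetherian_module_def
  proof (intro conjI N allI impI)
    fix K assume K: "submodule K R N"
    obtain S where S: "finite S" "S \<subseteq> {x \<in> carrier M. h x \<in> K}"
      "\<forall>K'. submodule K' R M \<longrightarrow> S \<subseteq> K' \<longrightarrow> {x \<in> carrier M. h x \<in> K} \<subseteq> K'"
      using noetherian_moduleD[OF M submodule_preimage[OF M' N h K]] by blast
    have "K \<subseteq> K'" if K': "submodule K' R N" "h ` S \<subseteq> K'" for K'
    proof
      fix y assume y: "y \<in> K"
      then obtain x where x: "x \<in> carrier M" "y = h x"
        using submodule_rules(1)[OF N K] surj by blast
      have "{x \<in> carrier M. h x \<in> K} \<subseteq> {x \<in> carrier M. h x \<in> K'}"
        by (rule S(3)[rule_format, OF submodule_preimage[OF M' N h K'(1)]]) (use S(2) K'(2) in auto)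
      then show "y \<in> K'" using x y by blast
    qed
    then show "\<exists>S. finite S \<and> S \<subseteq> K \<and> (\<forall>K'. submodule K' R N \<longrightarrow> S \<subseteq> K' \<longrightarrow> K \<subseteq> K')"
      using S(1,2) by (intro exI[of _ "h ` S"]) blast
  qed
qed

lemma noetherian_free_module:
  fixes R (structure)
  assumes cr: "cring R" and no: "noetherian_ring R"
  shows "noetherian_module R (free_module R n)"
proof -
  interpret cring R by fact
  interpret noetherian_ring R by fact
  let ?F = "free_module R n"
  interpret F: module R ?F by (rule free_module_is_module)
  note Fm = F.module_axioms
  have "\<exists>S. finite S \<and> S \<subseteq> K \<and> (\<forall>K'. submodule K' R ?F \<longrightarrow> S \<subseteq> K' \<longrightarrow> K \<subseteq> K')"
    if "submodule K R ?F" "\<forall>v\<in>K. \<forall>i<n. k \<le> i \<longrightarrow> v i = \<zero>" "k \<le> n" for K k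
    using that
  proof (induct k arbitrary: K)
    case 0
    then have "\<forall>v\<in>K. v = \<zero>\<^bsub>?F\<^esub>"
      using submodule_rules(1)[OF Fm] F.zero_closed
      by (intro ballI free_module_eqI[of _ R n]) auto
    then have "K \<subseteq> K'" if "submodule K' R ?F" for K' using submodule_rules(2)[OF Fm that] by auto
    then show ?case by (intro exI[of _ "{}"]) simp
  next
    case (Suc k)
    note K = submodule_rules[OF Fm Suc(2)]
    have kn: "k < n" using Suc by simp
    have Kc: "v \<in> K \<Longrightarrow> v \<in> carrier ?F" "v \<in> K \<Longrightarrow> v k \<in> carrier R" for v
      using K(1) free_module_coord_closed[OF _ kn] by auto
    \<comment> \<open>The intersection with an arbitrary submodule \<open>K'\<close> is allowed
      because, once \<open>K'\<close> contains the generators, this ideal is compared with that of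
      \<open>K\<close>: every entry of a vector of \<open>K\<close> is then the entry of a vector in
      both.\<close>
    have idl: "ideal ((\<lambda>v. v k) ` (K \<inter> K')) R" if K': "submodule K' R ?F" for K'
    proof -
      note I = submodule_rules[OF Fm submodule_Int[OF Fm Suc(2) K']]
      show ?thesis
      proof (rule idealI[OF ring_axioms])
        show "subgroup ((\<lambda>v. v k) ` (K \<inter> K')) (add_monoid R)"
        proof (rule add.subgroupI)
          fix a assume "a \<in> (\<lambda>v. v k) ` (K \<inter> K')"
          then obtain v where v: "v \<in> K \<inter> K'" "a = v k" by blast
          then have "\<ominus> a = (\<ominus>\<^bsub>?F\<^esub> v) k" using Kc kn by simp
          then show "\<ominus> a \<in> (\<lambda>v. v k) ` (K \<inter> K')" using I(4)[OF v(1)] by blast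
          fix b assume "b \<in> (\<lambda>v. v k) ` (K \<inter> K')"
          then obtain w where w: "w \<in> K \<inter> K'" "b = w k" by blast
          then have "a \<oplus> b = (v \<oplus>\<^bsub>?F\<^esub> w) k" using v kn by simp
          then show "a \<oplus> b \<in> (\<lambda>v. v k) ` (K \<inter> K')" using I(3)[OF v(1) w(1)] by blast
        qed (use Kc I(2) in auto)
        fix a r assume "a \<in> (\<lambda>v. v k) ` (K \<inter> K')" and r: "r \<in> carrier R"
        then obtain v where v: "v \<in> K \<inter> K'" "a = v k" by blast
        then have "r \<otimes> a = (r \<odot>\<^bsub>?F\<^esub> v) k" using kn by simp
        then show "r \<otimes> a \<in> (\<lambda>v. v k) ` (K \<inter> K')" using I(6)[OF r v(1)] by blast
        then show "a \<otimes> r \<in> (\<lambda>v. v k) ` (K \<inter> K')" using v Kc r by (simp add: m_comm)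
      qed
    qed
    have "ideal ((\<lambda>v. v k) ` K) R"
      using idl[OF Suc(2)] by simp
    from finetely_gen[OF this]
    obtain A where A: "A \<subseteq> carrier R" "finite A" "(\<lambda>v. v k) ` K = Idl A" by blast
    then have "A \<subseteq> (\<lambda>v. v k) ` K" using genideal_self by blast
    then obtain S1 where S1: "finite S1" "S1 \<subseteq> K" "A = (\<lambda>v. v k) ` S1"
      using A(2) by (meson finite_subset_image)
    define K0 where "K0 = {v \<in> K. v k = \<zero>}"
    have K0: "submodule K0 R ?F"
      using K Kc kn unfolding K0_def by (intro F.submoduleI) auto
    have "\<forall>v\<in>K0. \<forall>i<n. k \<le> i \<longrightarrow> v i = \<zero>"
      using Suc(3) by (auto simp: K0_def le_less Suc_le_eq) (metis Suc_lessI)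
    from Suc(1)[OF K0 this less_imp_le[OF kn]] obtain S0 where S0: "finite S0" "S0 \<subseteq> K0"
      "\<forall>K'. submodule K' R ?F \<longrightarrow> S0 \<subseteq> K' \<longrightarrow> K0 \<subseteq> K'" by auto
    have "K \<subseteq> K'" if K': "submodule K' R ?F" "S0 \<union> S1 \<subseteq> K'" for K'
    proof
      fix v assume v: "v \<in> K"
      have "Idl A \<subseteq> (\<lambda>v. v k) ` (K \<inter> K')"
        by (rule genideal_minimal[OF idl[OF K'(1)]]) (use S1 K' in auto)
      then obtain w where w: "w \<in> K \<inter> K'" "v k = w k" using v A(3) by blast
      then have "v \<ominus>\<^bsub>?F\<^esub> w \<in> K0" using K(5) v Kc kn by (simp add: K0_def r_neg a_minus_def)
      then have d: "v \<ominus>\<^bsub>?F\<^esub> w \<in> K'" using S0(3)[rule_format, OF K'(1)] K'(2) by blast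
      have "v = (v \<ominus>\<^bsub>?F\<^esub> w) \<oplus>\<^bsub>?F\<^esub> w" using v w Kc by (simp add: a_minus_def F.a_assoc F.l_neg)
      moreover have "(v \<ominus>\<^bsub>?F\<^esub> w) \<oplus>\<^bsub>?F\<^esub> w \<in> K'" using submodule_rules(3)[OF Fm K'(1) d] w by blast
      ultimately show "v \<in> K'" by simp
    qed
    moreover have "S0 \<union> S1 \<subseteq> K" using S0(2) S1(2) by (auto simp: K0_def)
    ultimately show ?case using S0(1) S1(1) by (intro exI[of _ "S0 \<union> S1"]) simp
  qed
  note L = this
  show ?thesis unfolding noetherian_module_def
    using L[of _ n] Fm by auto
qed

lemma (in noetherian_ring) maximal_ideal_principle:
  assumes "\<And>I. I \<in> S \<Longrightarrow> ideal I R" "S \<noteq> {}"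
  shows "\<exists>I\<in>S. \<forall>J\<in>S. I \<subseteq> J \<longrightarrow> J = I"
proof (rule subset_Zorn_nonempty[OF assms(2)])
  fix C assume C: "C \<noteq> {}" "subset.chain S C"
  then have "subset.chain {I. ideal I R} C" using assms(1) by (auto simp: pred_on.chain_def)
  then have "\<Union>C \<in> C" using C(1) by (intro ideal_chain_is_trivial)
  then show "\<Union>C \<in> S" using C by (auto simp: pred_on.chain_def)
qed

locale noetherian_local_adic = adic R m + noetherian_ring R for R (structure) and m +
  assumes unit_of_notin: "x \<in> carrier R \<Longrightarrow> x \<notin> m \<Longrightarrow> x \<in> Units R"
    and one_notin: "\<one> \<notin> m"
begin

text \<open>Passes from nilpotence of each element of \<open>m\<close> modulo \<open>B\<close> to
  nilpotence of \<open>m\<close> itself. In a maximal counterexample \<open>Q\<close> some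
  \<open>a\<close> in \<open>m\<close> is missing, and \<open>E k\<close> is Q + (a^k). By
  maximality \<open>E 1\<close> contains some \<open>mpow s\<close>, hence \<open>E k\<close>
  contains \<open>mpow (s * k)\<close>; but \<open>E n\<close> is inside \<open>Q\<close> as soon as
  a^n is.\<close>

lemma mpow_le_of_nilpotent:
  assumes B: "ideal B R" and nil: "\<And>a. a \<in> m \<Longrightarrow> \<exists>n::nat. a [^] n \<in> B"
  shows "\<exists>s. mpow s \<subseteq> B"
proof (rule ccontr)
  assume neg: "\<not> ?thesis"
  define S where "S = {B. ideal B R \<and> (\<forall>a\<in>m. \<exists>n::nat. a [^] n \<in> B) \<and> \<not> (\<exists>s. mpow s \<subseteq> B)}"
  have "B \<in> S" using B nil neg unfolding S_def by simp
  then have "\<exists>Q\<in>S. \<forall>W\<in>S. Q \<subseteq> W \<longrightarrow> W = Q"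
    by (intro maximal_ideal_principle) (auto simp: S_def)
  then obtain Q where Q: "Q \<in> S" "\<And>W. W \<in> S \<Longrightarrow> Q \<subseteq> W \<Longrightarrow> W = Q" by blast
  then have Qi: "ideal Q R" and Qn: "\<And>s. \<not> mpow s \<subseteq> Q" and Qnil: "\<And>a. a \<in> m \<Longrightarrow> \<exists>n::nat. a [^] n \<in> Q"
    by (auto simp: S_def)
  interpret Q: ideal Q R by fact
  interpret m: ideal m R by (rule m_ideal)
  obtain a where a: "a \<in> m" "a \<notin> Q" using Qn[of 1] by auto
  have ac: "a \<in> carrier R" using a m.Icarr by blast
  define E where "E k = {q \<oplus> r \<otimes> a [^] k |q r. q \<in> Q \<and> r \<in> carrier R}" for k :: nat
  have EI: "x = q \<oplus> r \<otimes> a [^] k \<Longrightarrow> q \<in> Q \<Longrightarrow> r \<in> carrier R \<Longrightarrow> x \<in> E k" for x q r k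
    unfolding E_def by blast
  have Eadd: "x \<oplus> y \<in> E k" if xy: "x \<in> E k" "y \<in> E k" for x y k
  proof -
    obtain q r q' r' where "q \<in> Q" "r \<in> carrier R" "x = q \<oplus> r \<otimes> a [^] k"
      "q' \<in> Q" "r' \<in> carrier R" "y = q' \<oplus> r' \<otimes> a [^] k" using xy by (auto simp: E_def)
    then show ?thesis using ac Q.Icarr
      by (intro EI[of _ "q \<oplus> q'" "r \<oplus> r'"]) (auto simp: l_distr a_ac)
  qed
  have Ei: "ideal (E k) R" for k
  proof (rule idealI[OF ring_axioms])
    show "subgroup (E k) (add_monoid R)"
    proof (rule add.subgroupI)
      have "\<zero> \<in> E k" by (rule EI[of _ \<zero> \<zero>]) (use ac in auto)
      then show "E k \<noteq> {}" by blast
      fix x assume "x \<in> E k"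
      then obtain q r where "q \<in> Q" "r \<in> carrier R" "x = q \<oplus> r \<otimes> a [^] k" by (auto simp: E_def)
      then show "\<ominus> x \<in> E k" using ac Q.Icarr
        by (intro EI[of _ "\<ominus> q" "\<ominus> r"]) (auto simp: minus_add l_minus)
      fix y assume "y \<in> E k"
      then show "x \<oplus> y \<in> E k" using Eadd \<open>x \<in> E k\<close> by blast
    qed (use Q.Icarr ac in \<open>auto simp: E_def\<close>)
    fix x z assume "x \<in> E k" and z: "z \<in> carrier R"
    then obtain q r where "q \<in> Q" "r \<in> carrier R" "x = q \<oplus> r \<otimes> a [^] k" by (auto simp: E_def)
    then show "z \<otimes> x \<in> E k" using ac z Q.Icarr Q.I_l_closed
      by (intro EI[of _ "z \<otimes> q" "z \<otimes> r"]) (auto simp: r_distr m_assoc)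
    then show "x \<otimes> z \<in> E k" using \<open>q \<in> Q\<close> \<open>r \<in> carrier R\<close> \<open>x = q \<oplus> r \<otimes> a [^] k\<close> ac z Q.Icarr
      by (simp add: m_comm)
  qed
  have QE: "Q \<subseteq> E k" for k
    using Q.Icarr ac by (auto intro!: EI[of _ _ \<zero>])
  have aE: "a \<in> E 1" using ac by (intro EI[of _ \<zero> \<one>]) auto
  have "E 1 \<noteq> Q" using aE a by blast
  then have "E 1 \<notin> S" using Q(2)[of "E 1"] QE by blast
  then obtain s where s: "mpow s \<subseteq> E 1"
    using Ei[of 1] Qnil QE by (auto simp: S_def) blast
  have prod: "x \<otimes> y \<in> E (Suc k)" if xy: "x \<in> E k" "y \<in> E 1" for x y k
  proof -
    obtain q r q' r' where *: "q \<in> Q" "r \<in> carrier R" "x = q \<oplus> r \<otimes> a [^] k"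
      "q' \<in> Q" "r' \<in> carrier R" "y = q' \<oplus> r' \<otimes> a" using xy ac by (auto simp: E_def)
    then have c: "q \<in> carrier R" "q' \<in> carrier R" using Q.Icarr by auto
    have "x \<otimes> y = (q \<otimes> q' \<oplus> q \<otimes> (r' \<otimes> a) \<oplus> r \<otimes> a [^] k \<otimes> q') \<oplus> (r \<otimes> r') \<otimes> a [^] Suc k"
      using c * ac by (simp add: l_distr r_distr a_ac m_ac)
    moreover have "q \<otimes> q' \<oplus> q \<otimes> (r' \<otimes> a) \<oplus> r \<otimes> a [^] k \<otimes> q' \<in> Q"
      using * ac c by (intro Q.a_closed Q.I_r_closed Q.I_l_closed) auto
    ultimately show ?thesis using * by (intro EI[of _ _ "r \<otimes> r'"]) auto
  qed
  have pw: "mpow (s * k) \<subseteq> E k" for k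
  proof (induct k)
    case 0
    have "carrier R \<subseteq> E 0" by (auto intro!: EI[of _ \<zero>])
    then show ?case by simp
  next
    case (Suc k)
    have "mpow (s * k) \<cdot> mpow s \<subseteq> E (Suc k)"
    proof
      fix x assume "x \<in> mpow (s * k) \<cdot> mpow s"
      then show "x \<in> E (Suc k)"
        by (induct rule: ideal_prod.induct) (use Suc s prod Eadd in blast)+
    qed
    then show ?case by (simp add: mpow_add[symmetric] add.commute)
  qed
  obtain n :: nat where n: "a [^] n \<in> Q" using Qnil a by blast
  have "E n \<subseteq> Q" using n by (auto simp: E_def intro!: Q.a_closed Q.I_l_closed)
  then show False using pw[of n] Qn[of "s * n"] by blast
qed

text \<open>
  If \<open>Q\<close> is maximal among the submodules with \<open>K \<subseteq> Q \<subset> P\<close>, where \<open>P\<close> is the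
  intersection of all \<open>K + m\<^sup>n N\<close>, then \<open>m P \<subseteq> Q\<close>; a submodule \<open>L\<close> maximal with \<open>L \<inter> P = Q\<close>
  then contains some \<open>m\<^sup>s N\<close>, whence \<open>P \<subseteq> L\<close>.
\<close>

theorem Krull_intersection:
  assumes noe: "noetherian_module R N" and K: "submodule K R N" and x: "x \<in> carrier N"
    and inter: "\<And>n. \<exists>k\<in>K. x \<ominus>\<^bsub>N\<^esub> k \<in> Mp N n"
  shows "x \<in> K"
proof (rule ccontr)
  assume xK: "x \<notin> K"
  have N: "module R N" using noe by (simp add: noetherian_module_def)
  interpret N: module R N by (rule N)
  interpret m: ideal m R by (rule m_ideal)
  note Kr = submodule_rules[OF N K]
  note sub = submodule_rules[OF N]
  define P where "P = {x \<in> carrier N. \<forall>n. \<exists>k\<in>K. x \<ominus>\<^bsub>N\<^esub> k \<in> Mp N n}"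
  have xP: "x \<in> P" using x inter by (auto simp: P_def)
  have Kc: "k \<in> K \<Longrightarrow> k \<in> carrier N" for k using Kr(1) by blast
  have P: "submodule P R N"
  proof (rule N.submoduleI)
    show "\<zero>\<^bsub>N\<^esub> \<in> P"
      using Kr(2) Mp_rules(2,4)[OF N]
      by (auto simp: P_def a_minus_def intro!: bexI[of _ "\<zero>\<^bsub>N\<^esub>"])
  next
    fix a assume a: "a \<in> P"
    have "\<exists>k\<in>K. (\<ominus>\<^bsub>N\<^esub> a) \<ominus>\<^bsub>N\<^esub> k \<in> Mp N n" for n
    proof -
      obtain k where k: "k \<in> K" "a \<ominus>\<^bsub>N\<^esub> k \<in> Mp N n" using a by (auto simp: P_def)
      have "\<ominus>\<^bsub>N\<^esub> (a \<ominus>\<^bsub>N\<^esub> k) = (\<ominus>\<^bsub>N\<^esub> a) \<ominus>\<^bsub>N\<^esub> (\<ominus>\<^bsub>N\<^esub> k)"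
        using k a Kc by (simp add: a_minus_def N.minus_add P_def)
      then show ?thesis using Mp_rules(4)[OF N k(2)] Kr(4)[OF k(1)] by auto
    qed
    then show "\<ominus>\<^bsub>N\<^esub> a \<in> P" using a by (auto simp: P_def)
  next
    fix a b assume ab: "a \<in> P" "b \<in> P"
    have "\<exists>k\<in>K. (a \<oplus>\<^bsub>N\<^esub> b) \<ominus>\<^bsub>N\<^esub> k \<in> Mp N n" for n
    proof -
      obtain k where k: "k \<in> K" "a \<ominus>\<^bsub>N\<^esub> k \<in> Mp N n" using ab by (auto simp: P_def)
      obtain l where l: "l \<in> K" "b \<ominus>\<^bsub>N\<^esub> l \<in> Mp N n" using ab by (auto simp: P_def)
      have "(a \<oplus>\<^bsub>N\<^esub> b) \<ominus>\<^bsub>N\<^esub> (k \<oplus>\<^bsub>N\<^esub> l) = (a \<ominus>\<^bsub>N\<^esub> k) \<oplus>\<^bsub>N\<^esub> (b \<ominus>\<^bsub>N\<^esub> l)"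
        using k l ab Kc by (simp add: a_minus_def N.minus_add P_def N.a_ac)
      then show ?thesis using Mp_rules(3)[OF N k(2) l(2)]
        by (intro bexI[OF _ Kr(3)[OF k(1) l(1)]]) simp
    qed
    then show "a \<oplus>\<^bsub>N\<^esub> b \<in> P" using ab by (auto simp: P_def)
  next
    fix r a assume r: "r \<in> carrier R" and a: "a \<in> P"
    have "\<exists>k\<in>K. (r \<odot>\<^bsub>N\<^esub> a) \<ominus>\<^bsub>N\<^esub> k \<in> Mp N n" for n
    proof -
      obtain k where k: "k \<in> K" "a \<ominus>\<^bsub>N\<^esub> k \<in> Mp N n" using a by (auto simp: P_def)
      have "(r \<odot>\<^bsub>N\<^esub> a) \<ominus>\<^bsub>N\<^esub> (r \<odot>\<^bsub>N\<^esub> k) = r \<odot>\<^bsub>N\<^esub> (a \<ominus>\<^bsub>N\<^esub> k)"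
        using k a Kc r by (simp add: a_minus_def N.smult_r_distr N.smult_r_minus P_def)
      then show ?thesis using Mp_rules(6)[OF N r k(2)]
        by (intro bexI[OF _ Kr(6)[OF r k(1)]]) simp
    qed
    then show "r \<odot>\<^bsub>N\<^esub> a \<in> P" using a r by (auto simp: P_def)
  qed (auto simp: P_def)
  note Pr = sub[OF P]
  have KP: "K \<subseteq> P"
  proof
    fix k assume k: "k \<in> K"
    then have "k \<ominus>\<^bsub>N\<^esub> k \<in> Mp N n" for n
      using Kc Mp_rules(2)[OF N] by (simp add: a_minus_def N.r_neg)
    then show "k \<in> P" using k Kc by (auto simp: P_def)
  qed
  obtain Q where Q: "submodule Q R N" "K \<subseteq> Q" "Q \<subset> P"
    and Qmax: "\<And>W. submodule W R N \<Longrightarrow> W \<subset> P \<Longrightarrow> Q \<subseteq> W \<Longrightarrow> W = Q"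
  proof -
    let ?S = "{W. submodule W R N \<and> K \<subseteq> W \<and> W \<subset> P}"
    have "K \<noteq> P" using xP xK by auto
    then have "K \<in> ?S" using K KP by (simp add: psubset_eq)
    then have "?S \<noteq> {}" by (metis empty_iff)
    have "\<exists>Q\<in>?S. \<forall>W\<in>?S. Q \<subseteq> W \<longrightarrow> W = Q"
      by (rule noetherian_module_maximal[OF noe _ \<open>?S \<noteq> {}\<close>]) simp
    then obtain Q where q: "Q \<in> ?S" and mx: "\<forall>W\<in>?S. Q \<subseteq> W \<longrightarrow> W = Q" by (rule bexE)
    show ?thesis
    proof (rule that[of Q])
      fix W assume W: "submodule W R N" "W \<subset> P" "Q \<subseteq> W"
      have "K \<subseteq> Q" using q by simp
      then have "K \<subseteq> W" using W(3) by (rule subset_trans)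
      then show "W = Q" using mx W by simp
    qed (use q in simp_all)
  qed
  note Qr = sub[OF Q(1)]
  obtain z where z: "z \<in> P" "z \<notin> Q" using Q by blast
  have zc: "z \<in> carrier N" using z Pr(1) by blast
  \<comment> \<open>By maximality of \<open>Q\<close> nothing lies strictly between \<open>Q\<close>
    and \<open>P\<close>, so \<open>Q\<close> and any \<open>y\<close> in \<open>P\<close> outside
    \<open>Q\<close> generate \<open>P\<close>.\<close>
  have step: "\<exists>q\<in>Q. \<exists>r\<in>carrier R. p = q \<oplus>\<^bsub>N\<^esub> r \<odot>\<^bsub>N\<^esub> y" if y: "y \<in> P" "y \<notin> Q" and p: "p \<in> P" for y p
  proof -
    have yc: "y \<in> carrier N" using y Pr(1) by blast
    let ?W = "{u \<oplus>\<^bsub>N\<^esub> v |u v. u \<in> Q \<and> v \<in> {r \<odot>\<^bsub>N\<^esub> y |r. r \<in> carrier R}}"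
    note W = submodule_add[OF N Q(1) cyclic_submodule(1)[OF N yc]]
    have "?W \<subseteq> P"
    proof
      fix w assume "w \<in> ?W"
      then obtain u r where u: "u \<in> Q" "r \<in> carrier R" "w = u \<oplus>\<^bsub>N\<^esub> r \<odot>\<^bsub>N\<^esub> y" by blast
      then show "w \<in> P" using Pr(3)[OF _ Pr(6)[OF u(2) y(1)]] Q(3) by blast
    qed
    moreover have "y \<in> ?W" using W(3) cyclic_submodule(2)[OF N yc] by blast
    ultimately have "?W = P" using Qmax[OF W(1)] W(2) y by blast
    then show ?thesis using p by blast
  qed
  \<comment> \<open>A form of Nakayama's lemma: otherwise p = q + r a p for some \<open>q\<close> in
    \<open>Q\<close>, and 1 - r a is a unit because r a lies in \<open>m\<close>, which puts
    \<open>p\<close> into \<open>Q\<close>.\<close>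
  have mP: "a \<odot>\<^bsub>N\<^esub> p \<in> Q" if a: "a \<in> m" and p: "p \<in> P" for a p
  proof (rule ccontr)
    assume apQ: "a \<odot>\<^bsub>N\<^esub> p \<notin> Q"
    have ac: "a \<in> carrier R" using a m.Icarr by blast
    obtain q r where qr: "q \<in> Q" "r \<in> carrier R" "p = q \<oplus>\<^bsub>N\<^esub> r \<odot>\<^bsub>N\<^esub> (a \<odot>\<^bsub>N\<^esub> p)"
      using step[of "a \<odot>\<^bsub>N\<^esub> p" p] apQ p Pr(6)[OF ac p] by blast
    have c: "p \<in> carrier N" "q \<in> carrier N" using p Pr(1) qr(1) Qr(1) by blast+
    have u: "\<one> \<ominus> r \<otimes> a \<in> Units R"
    proof (rule unit_of_notin)
      show "\<one> \<ominus> r \<otimes> a \<notin> m"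
      proof
        assume "\<one> \<ominus> r \<otimes> a \<in> m"
        then have "(\<one> \<ominus> r \<otimes> a) \<oplus> r \<otimes> a \<in> m" using m.a_closed m.I_l_closed[OF a qr(2)] by blast
        moreover have "(\<one> \<ominus> r \<otimes> a) \<oplus> r \<otimes> a = \<one>" using qr ac by (simp add: a_minus_def a_assoc l_neg)
        ultimately show False using one_notin by simp
      qed
    qed (use qr ac in auto)
    have "(\<one> \<ominus> r \<otimes> a) \<odot>\<^bsub>N\<^esub> p = p \<oplus>\<^bsub>N\<^esub> (\<ominus>\<^bsub>N\<^esub> (r \<odot>\<^bsub>N\<^esub> (a \<odot>\<^bsub>N\<^esub> p)))"
      using qr(2) ac c by (simp add: a_minus_def N.smult_l_distr N.smult_l_minus N.smult_assoc1)
    also have "\<dots> = (q \<oplus>\<^bsub>N\<^esub> r \<odot>\<^bsub>N\<^esub> (a \<odot>\<^bsub>N\<^esub> p)) \<oplus>\<^bsub>N\<^esub> (\<ominus>\<^bsub>N\<^esub> (r \<odot>\<^bsub>N\<^esub> (a \<odot>\<^bsub>N\<^esub> p)))"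
      using qr(3) by simp
    also have "\<dots> = q" using qr(2) ac c by (simp add: N.a_assoc N.r_neg)
    finally have e: "(\<one> \<ominus> r \<otimes> a) \<odot>\<^bsub>N\<^esub> p \<in> Q" using qr(1) by simp
    have "inv (\<one> \<ominus> r \<otimes> a) \<odot>\<^bsub>N\<^esub> ((\<one> \<ominus> r \<otimes> a) \<odot>\<^bsub>N\<^esub> p) \<in> Q"
      by (rule Qr(6)[OF _ e]) (use u in simp)
    moreover have "inv (\<one> \<ominus> r \<otimes> a) \<odot>\<^bsub>N\<^esub> ((\<one> \<ominus> r \<otimes> a) \<odot>\<^bsub>N\<^esub> p) = p"
      using u c by (simp add: N.smult_assoc1[symmetric] Units_closed)
    ultimately have "p \<in> Q" by simp
    then show False using apQ Qr(6)[OF ac] by blast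
  qed
  obtain L where L: "submodule L R N" "L \<inter> P = Q"
    and Lmax: "\<And>W. submodule W R N \<Longrightarrow> W \<inter> P = Q \<Longrightarrow> L \<subseteq> W \<Longrightarrow> W = L"
  proof -
    let ?S = "{W. submodule W R N \<and> W \<inter> P = Q}"
    have "Q \<inter> P = Q" using Q(3) by (simp add: Int_absorb2 less_imp_le)
    then have "Q \<in> ?S" using Q(1) by simp
    then have "?S \<noteq> {}" by (metis empty_iff)
    have "\<exists>L\<in>?S. \<forall>W\<in>?S. L \<subseteq> W \<longrightarrow> W = L"
      by (rule noetherian_module_maximal[OF noe _ \<open>?S \<noteq> {}\<close>]) simp
    then obtain L where "L \<in> ?S" and "\<forall>W\<in>?S. L \<subseteq> W \<longrightarrow> W = L" by (rule bexE)
    then show ?thesis using that[of L] by simp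
  qed
  note Lr = sub[OF L(1)]
  \<comment> \<open>\<open>B\<close> is the annihilator of N / L; the goal is to find a power of
    \<open>m\<close> inside it.\<close>
  define B where "B = {a \<in> carrier R. \<forall>y\<in>carrier N. a \<odot>\<^bsub>N\<^esub> y \<in> L}"
  have B: "ideal B R"
  proof (rule idealI[OF ring_axioms])
    show "subgroup B (add_monoid R)"
    proof (rule add.subgroupI)
      show "B \<noteq> {}" using Lr(2) by (auto simp: B_def intro!: exI[of _ \<zero>])
    qed (use Lr in \<open>auto simp: B_def N.smult_l_distr N.smult_l_minus\<close>)
    fix a r assume "a \<in> B" "r \<in> carrier R"
    then show "r \<otimes> a \<in> B" using Lr(6) by (auto simp: B_def N.smult_assoc1)
    then show "a \<otimes> r \<in> B" using \<open>a \<in> B\<close> \<open>r \<in> carrier R\<close> by (simp add: m_comm B_def)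
  qed
  \<comment> \<open>The submodules (L : a^n) ascend and become stationary at some \<open>n\<close>.
    If l + a^n y lies in \<open>P\<close>, multiplication by \<open>a\<close> moves it into
    \<open>Q\<close>, hence a^(n+1) y lies in \<open>L\<close> and so does a^n y. Thus L + a^n N
    still meets \<open>P\<close> in \<open>Q\<close>, and maximality of \<open>L\<close> puts a^n N
    inside \<open>L\<close>.\<close>
  have "\<exists>n::nat. a [^] n \<in> B" if a: "a \<in> m" for a
  proof -
    have ac: "a \<in> carrier R" using a m.Icarr by blast
    have pc: "a [^] n \<in> carrier R" for n :: nat using ac by simp
    have sm: "submodule {y \<in> carrier N. a [^] n \<odot>\<^bsub>N\<^esub> y \<in> L} R N" for n :: nat
    proof -
      have "(\<odot>\<^bsub>N\<^esub>) (a [^] n) \<in> module_hom R N N"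
      proof (rule module_homI)
        fix b x assume "b \<in> carrier R" "x \<in> carrier N"
        then show "a [^] n \<odot>\<^bsub>N\<^esub> (b \<odot>\<^bsub>N\<^esub> x) = b \<odot>\<^bsub>N\<^esub> (a [^] n \<odot>\<^bsub>N\<^esub> x)"
          using pc by (metis m_comm N.smult_assoc1)
      qed (use pc N.smult_r_distr in auto)
      from submodule_preimage[OF N N this L(1)] show ?thesis .
    qed
    let ?S = "range (\<lambda>n::nat. {y \<in> carrier N. a [^] n \<odot>\<^bsub>N\<^esub> y \<in> L})"
    have step': "{y \<in> carrier N. a [^] n \<odot>\<^bsub>N\<^esub> y \<in> L} \<subseteq> {y \<in> carrier N. a [^] Suc n \<odot>\<^bsub>N\<^esub> y \<in> L}" for n
      using Lr(6)[OF ac] ac pc by (auto simp: N.smult_assoc1 m_comm[of "a [^] n" a for n])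
    have "\<exists>W\<in>?S. \<forall>W'\<in>?S. W \<subseteq> W' \<longrightarrow> W' = W"
    proof (rule noetherian_module_maximal[OF noe])
      fix W assume "W \<in> ?S"
      then obtain n :: nat where "W = {y \<in> carrier N. a [^] n \<odot>\<^bsub>N\<^esub> y \<in> L}" by (rule rangeE)
      then show "submodule W R N" using sm by simp
    qed simp
    then obtain W where W: "W \<in> ?S" "\<forall>W'\<in>?S. W \<subseteq> W' \<longrightarrow> W' = W" by (rule bexE)
    from W(1) obtain n :: nat where n: "W = {y \<in> carrier N. a [^] n \<odot>\<^bsub>N\<^esub> y \<in> L}" by (rule rangeE)
    have stab: "a [^] n \<odot>\<^bsub>N\<^esub> y \<in> L" if "y \<in> carrier N" "a [^] Suc n \<odot>\<^bsub>N\<^esub> y \<in> L" for y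
    proof -
      have "{y \<in> carrier N. a [^] Suc n \<odot>\<^bsub>N\<^esub> y \<in> L} = W"
        using W(2)[rule_format, OF rangeI[of _ "Suc n"]] step'[of n] unfolding n by simp
      then show ?thesis using that unfolding n by blast
    qed
    let ?Y = "{u \<oplus>\<^bsub>N\<^esub> v |u v. u \<in> L \<and> v \<in> (\<odot>\<^bsub>N\<^esub>) (a [^] n) ` carrier N}"
    note Y = submodule_add[OF N L(1) scaled_submodule[OF N pc]]
    have "?Y \<inter> P \<subseteq> Q"
    proof
      fix p assume p: "p \<in> ?Y \<inter> P"
      then obtain l y where ly: "l \<in> L" "y \<in> carrier N" "p = l \<oplus>\<^bsub>N\<^esub> a [^] n \<odot>\<^bsub>N\<^esub> y" by blast
      have lc: "l \<in> carrier N" using ly Lr(1) by blast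
      have "a \<odot>\<^bsub>N\<^esub> p = a \<odot>\<^bsub>N\<^esub> l \<oplus>\<^bsub>N\<^esub> a [^] Suc n \<odot>\<^bsub>N\<^esub> y"
        using ly lc ac pc by (simp add: N.smult_r_distr N.smult_assoc1 m_comm[of "a [^] n" a for n])
      then have "a [^] Suc n \<odot>\<^bsub>N\<^esub> y = a \<odot>\<^bsub>N\<^esub> p \<ominus>\<^bsub>N\<^esub> a \<odot>\<^bsub>N\<^esub> l"
        using ly lc ac pc[of "Suc n"] by (simp add: a_minus_def N.a_comm N.r_neg1 del: nat_pow_Suc)
      moreover have "a \<odot>\<^bsub>N\<^esub> p \<in> L" using mP[OF a] p L(2) by blast
      ultimately have "a [^] Suc n \<odot>\<^bsub>N\<^esub> y \<in> L" using Lr(5) Lr(6)[OF ac ly(1)] by (simp del: nat_pow_Suc)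
      then have "p \<in> L" using stab ly Lr(3) by blast
      then show "p \<in> Q" using p L(2) by blast
    qed
    then have "?Y = L" using Lmax[OF Y(1)] Y(2) L(2) by blast
    then show ?thesis using Y(3) pc by (intro exI[of _ n]) (auto simp: B_def)
  qed
  then obtain s where s: "mpow s \<subseteq> B" using mpow_le_of_nilpotent[OF B] by blast
  have "Mp N s \<subseteq> L"
    unfolding Mp_alt by (rule ideal_smult_least[OF N L(1)]) (use s in \<open>auto simp: B_def\<close>)
  moreover obtain k where k: "k \<in> K" "z \<ominus>\<^bsub>N\<^esub> k \<in> Mp N s" using z by (auto simp: P_def)
  ultimately have "(z \<ominus>\<^bsub>N\<^esub> k) \<oplus>\<^bsub>N\<^esub> k \<in> L" using Lr(3) Q(2) L(2) by blast
  moreover have "(z \<ominus>\<^bsub>N\<^esub> k) \<oplus>\<^bsub>N\<^esub> k = z" using zc Kc k by (simp add: a_minus_def N.a_assoc N.l_neg)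
  ultimately show False using z L(2) by auto
qed

end

section \<open>Comparison of free resolutions\<close>

lemma a_kernel_iff: "x \<in> a_kernel M N h \<longleftrightarrow> x \<in> carrier M \<and> h x = \<zero>\<^bsub>N\<^esub>"
  by (simp add: a_kernel_def kernel_def)

lemma free_resolutionD:
  assumes "free_resolution R L r \<phi> \<epsilon>"
  shows "\<epsilon> \<in> module_hom R (free_module R (r 0)) L"
    and "\<phi> (Suc i) \<in> module_hom R (free_module R (r (Suc i))) (free_module R (r i))"
    and "\<epsilon> ` carrier (free_module R (r 0)) = carrier L"
    and "\<phi> (Suc 0) ` carrier (free_module R (r (Suc 0)))
      = {v \<in> carrier (free_module R (r 0)). \<epsilon> v = \<zero>\<^bsub>L\<^esub>}"
    and "\<phi> (Suc (Suc i)) ` carrier (free_module R (r (Suc (Suc i))))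
      = {v \<in> carrier (free_module R (r (Suc i))). \<phi> (Suc i) v = \<zero>\<^bsub>free_module R (r i)\<^esub>}"
  using assms by (auto simp: free_resolution_def Let_def set_eq_iff a_kernel_iff)

text \<open>The augmentation sends zero to zero because the zero vector is a boundary and boundaries
  are killed; with that, the module axioms are transported along the surjection.\<close>

lemma free_resolution_module:
  assumes "cring R" and res: "free_resolution R L r \<phi> \<epsilon>"
  shows "module R L"
proof -
  interpret cring R by fact
  note F = free_module_is_module
  have "\<phi> (Suc 0) \<zero>\<^bsub>free_module R (r (Suc 0))\<^esub> = \<zero>\<^bsub>free_module R (r 0)\<^esub>"
    by (rule module_hom_zero[OF F F free_resolutionD(2)[OF res]])
  moreover have "\<zero>\<^bsub>free_module R (r (Suc 0))\<^esub> \<in> carrier (free_module R (r (Suc 0)))"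
    using submodule_rules(2)[OF F module.carrier_is_submodule[OF F]] .
  ultimately have "\<zero>\<^bsub>free_module R (r 0)\<^esub> \<in> \<phi> (Suc 0) ` carrier (free_module R (r (Suc 0)))"
    by (metis imageI)
  then have z: "\<epsilon> \<zero>\<^bsub>free_module R (r 0)\<^esub> = \<zero>\<^bsub>L\<^esub>"
    unfolding free_resolutionD(4)[OF res] by simp
  show ?thesis
    by (rule module_of_surj_hom[OF F free_resolutionD(1)[OF res] free_resolutionD(3)[OF res]]) (rule z)
qed

lemma (in abelian_group) add_diff_cancel_left:
  assumes "x \<in> carrier G" "y \<in> carrier G"
  shows "(x \<oplus> y) \<ominus> x = y"
  using assms by (simp add: a_comm[of x y] a_minus_def a_assoc r_neg)

text \<open>One stage of the comparison theorem, building maps in both directions and a homotopy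
  together. Here \<open>p\<close> and \<open>p'\<close> are the differentials into the previous
  stage, or the augmentations, and \<open>h0\<close> is the contribution of the previous homotopy.
  Since \<open>h0\<close> and the boundaries of \<open>q\<close> land in \<open>I F\<close>, so does
  the difference between \<open>g' f'\<close> and the identity.\<close>

lemma comparison_step:
  fixes R (structure) and n n' n2 :: nat
  assumes cr: "cring R" and I: "ideal I R" and N: "module R N" and N': "module R N'"
  defines "F \<equiv> free_module R n" and "F' \<equiv> free_module R n'" and "F2 \<equiv> free_module R n2"
  assumes p: "p \<in> module_hom R F N" and p': "p' \<in> module_hom R F' N'"
    and f: "f \<in> module_hom R N N'" and g: "g \<in> module_hom R N' N"
    and gp: "\<And>v. v \<in> carrier F' \<Longrightarrow> g (p' v) \<in> p ` carrier F"
    and h0: "h0 \<in> module_hom R F F" "\<And>v. v \<in> carrier F \<Longrightarrow> h0 v \<in> ideal_smult I F"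
    and gfp: "\<And>v. v \<in> carrier F \<Longrightarrow> g (f (p v)) = p v \<oplus>\<^bsub>N\<^esub> p (h0 v)"
    and q: "q \<in> module_hom R F2 F" "q ` carrier F2 = {v \<in> carrier F. p v = \<zero>\<^bsub>N\<^esub>}"
      "q ` carrier F2 \<subseteq> ideal_smult I F"
    and lift: "\<And>t. t < n \<Longrightarrow> \<exists>x\<in>carrier F'. P t x \<and> p' x = f (p (basis_vec R n t))"
  shows "\<exists>f' g' h'. f' \<in> module_hom R F F' \<and> g' \<in> module_hom R F' F \<and> h' \<in> module_hom R F F2 \<and>
    (\<forall>v\<in>carrier F. p' (f' v) = f (p v)) \<and> (\<forall>v\<in>carrier F'. p (g' v) = g (p' v)) \<and>
    (\<forall>v\<in>carrier F. g' (f' v) = (v \<oplus>\<^bsub>F\<^esub> h0 v) \<oplus>\<^bsub>F\<^esub> q (h' v)) \<and>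
    (\<forall>v\<in>carrier F. g' (f' v) \<ominus>\<^bsub>F\<^esub> v \<in> ideal_smult I F) \<and> (\<forall>t<n. P t (f' (basis_vec R n t)))"
proof -
  interpret cring R by fact
  have Fm: "module R F" and Fm': "module R F'" and Fm2: "module R F2"
    unfolding F_def F'_def F2_def by (rule free_module_is_module)+
  interpret F: module R F by (rule Fm)
  interpret N: module R N by (rule N)
  obtain f' where f': "f' \<in> module_hom R F F'" "\<And>v. v \<in> carrier F \<Longrightarrow> p' (f' v) = f (p v)"
    "\<And>t. t < n \<Longrightarrow> P t (f' (basis_vec R n t))"
    using module_hom_free_lift[OF N' Fm' module_hom_comp[OF p[unfolded F_def] f] p' lift]
    unfolding F_def by blast
  have "\<exists>x\<in>carrier F. True \<and> p x = g (p' (basis_vec R n' t))" if "t < n'" for t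
    using gp[of "basis_vec R n' t"] by (auto simp: F'_def)
  from module_hom_free_lift[OF N Fm module_hom_comp[OF p'[unfolded F'_def] g] p this]
  obtain g' where g': "g' \<in> module_hom R F' F" "\<And>v. v \<in> carrier F' \<Longrightarrow> p (g' v) = g (p' v)"
    unfolding F'_def by blast
  note f'c = module_homD(1)[OF f'(1)] and g'c = module_homD(1)[OF g'(1)] and h0c = module_homD(1)[OF h0(1)]
  \<comment> \<open>The defect of \<open>g' f'\<close> from the identity plus \<open>h0\<close>. It
    is killed by \<open>p\<close>, so exactness factors it through \<open>q\<close>; the factor is
    the new homotopy.\<close>
  define e where "e v = (g' (f' v) \<ominus>\<^bsub>F\<^esub> v) \<ominus>\<^bsub>F\<^esub> h0 v" for v
  have idh: "(\<lambda>v. v) \<in> module_hom R F F" by (auto simp: module_hom_def)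
  have e: "e \<in> module_hom R F F"
    unfolding e_def
    by (rule module_hom_sub[OF Fm Fm module_hom_sub[OF Fm Fm module_hom_comp[OF f'(1) g'(1)] idh] h0(1)])
  have pe: "p (e v) = \<zero>\<^bsub>N\<^esub>" if v: "v \<in> carrier F" for v
  proof -
    have "p (e v) = (p (g' (f' v)) \<ominus>\<^bsub>N\<^esub> p v) \<ominus>\<^bsub>N\<^esub> p (h0 v)"
      unfolding e_def using v f'c g'c h0c by (simp add: module_hom_diff[OF Fm N p])
    also have "p (g' (f' v)) = p v \<oplus>\<^bsub>N\<^esub> p (h0 v)"
      using v f'c by (simp add: g'(2) f'(2) gfp)
    finally show ?thesis
      using v h0c module_homD(1)[OF p]
      by (simp add: N.add_diff_cancel_left) (simp add: a_minus_def N.r_neg)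
  qed
  have eq: "e v \<in> q ` carrier F2" if "v \<in> carrier F" for v
    using pe[OF that] module_homD(1)[OF e that] unfolding q(2) by simp
  have "\<exists>x\<in>carrier F2. True \<and> q x = e (basis_vec R n t)" if "t < n" for t
    using eq[of "basis_vec R n t"] by (auto simp: F_def)
  from module_hom_free_lift[OF Fm[unfolded F_def] Fm2 e[unfolded F_def] q(1)[unfolded F_def] this]
  obtain h' where h': "h' \<in> module_hom R F F2" "\<And>v. v \<in> carrier F \<Longrightarrow> q (h' v) = e v"
    unfolding F_def by blast
  note h'c = module_homD(1)[OF h'(1)]
  have eqn: "g' (f' v) = (v \<oplus>\<^bsub>F\<^esub> h0 v) \<oplus>\<^bsub>F\<^esub> q (h' v)" if v: "v \<in> carrier F" for v
    unfolding h'(2)[OF v] e_def using v f'c g'c h0c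
    by (simp add: a_minus_def F.a_ac F.r_neg F.r_neg1 F.r_neg2)
  note S = submodule_rules[OF Fm ideal_smult_submodule[OF Fm I]]
  have "g' (f' v) \<ominus>\<^bsub>F\<^esub> v \<in> ideal_smult I F" if v: "v \<in> carrier F" for v
  proof -
    have qh: "q (h' v) \<in> ideal_smult I F" using q(3) h'c[OF v] by blast
    have "g' (f' v) \<ominus>\<^bsub>F\<^esub> v = h0 v \<oplus>\<^bsub>F\<^esub> q (h' v)"
      unfolding eqn[OF v] using v h0c h'c module_homD(1)[OF q(1)]
      by (simp add: F.a_assoc F.add_diff_cancel_left)
    then show ?thesis using S(3)[OF h0(2)[OF v] qh] by simp
  qed
  then show ?thesis using f' g' h'(1) eqn
    by (intro exI[of _ f'] exI[of _ g'] exI[of _ h']) simp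
qed

text \<open>
  The sets \<open>H i j\<close>, \<open>H' i j\<close>, \<open>HL j\<close> play the role of the homogeneous components of degree \<open>j\<close>, so
  that the comparison maps are homogeneous; for ungraded resolutions one takes them to be everything.
\<close>

locale two_resolutions = cring R for R (structure) +
  fixes I and L :: "('a, 'l, 'e) module_scheme" and r \<phi> \<epsilon> r' \<phi>' \<epsilon>'
    and d :: "nat \<Rightarrow> nat \<Rightarrow> nat" and H H' :: "nat \<Rightarrow> nat \<Rightarrow> (nat \<Rightarrow> 'a) set" and HL :: "nat \<Rightarrow> 'l set"
  assumes I: "ideal I R"
    and res: "minimal_free_resolution R I L r \<phi> \<epsilon>"
    and res': "free_resolution R L r' \<phi>' \<epsilon>'"
    and H_aug: "\<And>t. t < r 0 \<Longrightarrow> \<epsilon> (basis_vec R (r 0) t) \<in> HL (d 0 t)"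
    and H_diff: "\<And>i t. t < r (Suc i) \<Longrightarrow> \<phi> (Suc i) (basis_vec R (r (Suc i)) t) \<in> H i (d (Suc i) t)"
    and lift_aug: "\<And>y j. y \<in> carrier L \<Longrightarrow> y \<in> HL j \<Longrightarrow>
      \<exists>x\<in>carrier (free_module R (r' 0)). x \<in> H' 0 j \<and> \<epsilon>' x = y"
    and lift_diff: "\<And>y i j. y \<in> \<phi>' (Suc i) ` carrier (free_module R (r' (Suc i))) \<Longrightarrow> y \<in> H' i j \<Longrightarrow>
      \<exists>x\<in>carrier (free_module R (r' (Suc i))). x \<in> H' (Suc i) j \<and> \<phi>' (Suc i) x = y"
    and hom_H: "\<And>f i j v. f \<in> module_hom R (free_module R (r i)) (free_module R (r' i)) \<Longrightarrow>
      (\<And>t. t < r i \<Longrightarrow> f (basis_vec R (r i) t) \<in> H' i (d i t)) \<Longrightarrow>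
      v \<in> carrier (free_module R (r i)) \<Longrightarrow> v \<in> H i j \<Longrightarrow> f v \<in> H' i j"
begin

abbreviation F where "F i \<equiv> free_module R (r i)"
abbreviation F' where "F' i \<equiv> free_module R (r' i)"

text \<open>An invariant fit for induction on the stage. The homotopy identity is imposed only on
  boundaries, where the term coming from the homotopy of the stage below vanishes. The congruence
  modulo \<open>I F\<close> is what is extracted in the end, and the last clause records homogeneity
  of the columns.\<close>

definition comparison where
  "comparison i f g h \<longleftrightarrow> f \<in> module_hom R (F i) (F' i) \<and> g \<in> module_hom R (F' i) (F i) \<and>
    h \<in> module_hom R (F i) (F (Suc i)) \<and>
    (\<forall>v\<in>carrier (F (Suc i)). f (\<phi> (Suc i) v) \<in> \<phi>' (Suc i) ` carrier (F' (Suc i))) \<and>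
    (\<forall>v\<in>carrier (F' (Suc i)). g (\<phi>' (Suc i) v) \<in> \<phi> (Suc i) ` carrier (F (Suc i))) \<and>
    (\<forall>v\<in>carrier (F (Suc i)). g (f (\<phi> (Suc i) v))
       = \<phi> (Suc i) v \<oplus>\<^bsub>F i\<^esub> \<phi> (Suc i) (h (\<phi> (Suc i) v))) \<and>
    (\<forall>v\<in>carrier (F i). g (f v) \<ominus>\<^bsub>F i\<^esub> v \<in> ideal_smult I (F i)) \<and>
    (\<forall>t<r i. f (basis_vec R (r i) t) \<in> H' i (d i t))"

lemma res0: "free_resolution R L r \<phi> \<epsilon>"
  and minimal: "\<phi> (Suc i) ` carrier (F (Suc i)) \<subseteq> ideal_smult I (F i)"
  using res by (auto simp: minimal_free_resolution_def)

lemmas D = free_resolutionD[OF res0] and D' = free_resolutionD[OF res']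

lemma Fm: "module R (F i)" and Fm': "module R (F' i)"
  by (rule free_module_is_module)+

text \<open>Below stage zero stands \<open>L\<close> itself, with identity maps in both directions
  and the zero homotopy.\<close>

lemma comparison_0: "\<exists>f g h. comparison 0 f g h"
proof -
  have L: "module R L" by (rule free_resolution_module[OF is_cring res0])
  interpret L: module R L by (rule L)
  interpret F0: module R "F 0" by (rule Fm)
  have idh: "(\<lambda>v. v) \<in> module_hom R L L" by (auto simp: module_hom_def)
  have h0: "(\<lambda>v. \<zero>\<^bsub>F 0\<^esub>) \<in> module_hom R (F 0) (F 0)" by (auto simp: module_hom_def)
  note S = submodule_rules[OF Fm ideal_smult_submodule[OF Fm I]]
  have "\<exists>f' g' h'. f' \<in> module_hom R (F 0) (F' 0) \<and> g' \<in> module_hom R (F' 0) (F 0) \<and>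
    h' \<in> module_hom R (F 0) (F (Suc 0)) \<and>
    (\<forall>v\<in>carrier (F 0). \<epsilon>' (f' v) = \<epsilon> v) \<and> (\<forall>v\<in>carrier (F' 0). \<epsilon> (g' v) = \<epsilon>' v) \<and>
    (\<forall>v\<in>carrier (F 0). g' (f' v) = (v \<oplus>\<^bsub>F 0\<^esub> \<zero>\<^bsub>F 0\<^esub>) \<oplus>\<^bsub>F 0\<^esub> \<phi> (Suc 0) (h' v)) \<and>
    (\<forall>v\<in>carrier (F 0). g' (f' v) \<ominus>\<^bsub>F 0\<^esub> v \<in> ideal_smult I (F 0)) \<and>
    (\<forall>t<r 0. f' (basis_vec R (r 0) t) \<in> H' 0 (d 0 t))"
  proof (rule comparison_step[OF is_cring I L L D(1) D'(1) idh idh _ h0 _ _ D(2,4) minimal])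
    fix v assume "v \<in> carrier (F' 0)"
    then show "\<epsilon>' v \<in> \<epsilon> ` carrier (F 0)" using D(3) D'(3) by blast
  next
    fix t assume "t < r 0"
    then show "\<exists>x\<in>carrier (F' 0). x \<in> H' 0 (d 0 t) \<and> \<epsilon>' x = \<epsilon> (basis_vec R (r 0) t)"
      by (intro lift_aug H_aug module_homD(1)[OF D(1)]) simp
  qed (use S(2) module_homD(1)[OF D(1)] module_hom_zero[OF Fm L D(1)] in auto)
  then obtain f g h where *: "f \<in> module_hom R (F 0) (F' 0)" "g \<in> module_hom R (F' 0) (F 0)"
    "h \<in> module_hom R (F 0) (F (Suc 0))"
    "\<And>v. v\<in>carrier (F 0) \<Longrightarrow> \<epsilon>' (f v) = \<epsilon> v" "\<And>v. v\<in>carrier (F' 0) \<Longrightarrow> \<epsilon> (g v) = \<epsilon>' v"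
    "\<And>v. v\<in>carrier (F 0) \<Longrightarrow> g (f v) = (v \<oplus>\<^bsub>F 0\<^esub> \<zero>\<^bsub>F 0\<^esub>) \<oplus>\<^bsub>F 0\<^esub> \<phi> (Suc 0) (h v)"
    "\<And>v. v\<in>carrier (F 0) \<Longrightarrow> g (f v) \<ominus>\<^bsub>F 0\<^esub> v \<in> ideal_smult I (F 0)"
    "\<And>t. t<r 0 \<Longrightarrow> f (basis_vec R (r 0) t) \<in> H' 0 (d 0 t)" by blast
  note pc = module_homD(1)[OF D(2)] and p'c = module_homD(1)[OF D'(2)]
  have k: "\<epsilon> (\<phi> (Suc 0) v) = \<zero>\<^bsub>L\<^esub>" if "v \<in> carrier (F (Suc 0))" for v
    using D(4) that by blast
  have k': "\<epsilon>' (\<phi>' (Suc 0) v) = \<zero>\<^bsub>L\<^esub>" if "v \<in> carrier (F' (Suc 0))" for v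
    using D'(4) that by blast
  have "comparison 0 f g h"
    unfolding comparison_def D(4) D'(4)
    using * pc p'c k k' module_homD(1)[OF *(1)] module_homD(1)[OF *(2)] by simp
  then show ?thesis by blast
qed

text \<open>The commuting square is part of the conclusion because the order of a column is later
  read off through it.\<close>

lemma comparison_Suc:
  assumes "comparison i f g h"
  shows "\<exists>f' g' h'. comparison (Suc i) f' g' h' \<and>
    (\<forall>v\<in>carrier (F (Suc i)). \<phi>' (Suc i) (f' v) = f (\<phi> (Suc i) v))"
proof -
  interpret Fi: module R "F i" by (rule Fm)
  interpret FS: module R "F (Suc i)" by (rule Fm)
  have f: "f \<in> module_hom R (F i) (F' i)" and g: "g \<in> module_hom R (F' i) (F i)"
    and h: "h \<in> module_hom R (F i) (F (Suc i))"
    and a: "\<And>v. v\<in>carrier (F (Suc i)) \<Longrightarrow> f (\<phi> (Suc i) v) \<in> \<phi>' (Suc i) ` carrier (F' (Suc i))"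
    and b: "\<And>v. v\<in>carrier (F' (Suc i)) \<Longrightarrow> g (\<phi>' (Suc i) v) \<in> \<phi> (Suc i) ` carrier (F (Suc i))"
    and c: "\<And>v. v\<in>carrier (F (Suc i)) \<Longrightarrow> g (f (\<phi> (Suc i) v))
       = \<phi> (Suc i) v \<oplus>\<^bsub>F i\<^esub> \<phi> (Suc i) (h (\<phi> (Suc i) v))"
    and fH: "\<And>t. t<r i \<Longrightarrow> f (basis_vec R (r i) t) \<in> H' i (d i t)"
    using assms unfolding comparison_def by auto
  note pc = module_homD(1)[OF D(2)] and p'c = module_homD(1)[OF D'(2)]
  have h0: "(\<lambda>v. h (\<phi> (Suc i) v)) \<in> module_hom R (F (Suc i)) (F (Suc i))"
    by (rule module_hom_comp[OF D(2) h])
  have "\<exists>f' g' h'. f' \<in> module_hom R (F (Suc i)) (F' (Suc i)) \<and> g' \<in> module_hom R (F' (Suc i)) (F (Suc i)) \<and>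
    h' \<in> module_hom R (F (Suc i)) (F (Suc (Suc i))) \<and>
    (\<forall>v\<in>carrier (F (Suc i)). \<phi>' (Suc i) (f' v) = f (\<phi> (Suc i) v)) \<and>
    (\<forall>v\<in>carrier (F' (Suc i)). \<phi> (Suc i) (g' v) = g (\<phi>' (Suc i) v)) \<and>
    (\<forall>v\<in>carrier (F (Suc i)). g' (f' v)
      = (v \<oplus>\<^bsub>F (Suc i)\<^esub> h (\<phi> (Suc i) v)) \<oplus>\<^bsub>F (Suc i)\<^esub> \<phi> (Suc (Suc i)) (h' v)) \<and>
    (\<forall>v\<in>carrier (F (Suc i)). g' (f' v) \<ominus>\<^bsub>F (Suc i)\<^esub> v \<in> ideal_smult I (F (Suc i))) \<and>
    (\<forall>t<r (Suc i). f' (basis_vec R (r (Suc i)) t) \<in> H' (Suc i) (d (Suc i) t))"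
  proof (rule comparison_step[OF is_cring I Fm Fm' D(2)[of i] D'(2)[of i] f g _ h0 _ _
        D(2)[of "Suc i"] D(5)[of i] minimal[of "Suc i"]])
    fix v assume "v \<in> carrier (F' (Suc i))"
    then show "g (\<phi>' (Suc i) v) \<in> \<phi> (Suc i) ` carrier (F (Suc i))" by (rule b)
  next
    fix v assume v: "v \<in> carrier (F (Suc i))"
    have "\<phi> (Suc i) v \<in> ideal_smult I (F i)" using minimal v by blast
    then show "h (\<phi> (Suc i) v) \<in> ideal_smult I (F (Suc i))"
      by (rule ideal_smult_hom[OF Fm Fm h I])
    show "g (f (\<phi> (Suc i) v)) = \<phi> (Suc i) v \<oplus>\<^bsub>F i\<^esub> \<phi> (Suc i) (h (\<phi> (Suc i) v))" by (rule c[OF v])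
  next
    fix t assume t: "t < r (Suc i)"
    show "\<exists>x\<in>carrier (F' (Suc i)). x \<in> H' (Suc i) (d (Suc i) t) \<and>
       \<phi>' (Suc i) x = f (\<phi> (Suc i) (basis_vec R (r (Suc i)) t))"
      by (intro lift_diff a hom_H[OF f fH] H_diff t pc basis_vec_closed)
  qed
  then obtain f' g' h' where *: "f' \<in> module_hom R (F (Suc i)) (F' (Suc i))"
    "g' \<in> module_hom R (F' (Suc i)) (F (Suc i))"
    "h' \<in> module_hom R (F (Suc i)) (F (Suc (Suc i)))"
    "\<And>v. v\<in>carrier (F (Suc i)) \<Longrightarrow> \<phi>' (Suc i) (f' v) = f (\<phi> (Suc i) v)"
    "\<And>v. v\<in>carrier (F' (Suc i)) \<Longrightarrow> \<phi> (Suc i) (g' v) = g (\<phi>' (Suc i) v)"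
    "\<And>v. v\<in>carrier (F (Suc i)) \<Longrightarrow> g' (f' v)
      = (v \<oplus>\<^bsub>F (Suc i)\<^esub> h (\<phi> (Suc i) v)) \<oplus>\<^bsub>F (Suc i)\<^esub> \<phi> (Suc (Suc i)) (h' v)"
    "\<And>v. v\<in>carrier (F (Suc i)) \<Longrightarrow> g' (f' v) \<ominus>\<^bsub>F (Suc i)\<^esub> v \<in> ideal_smult I (F (Suc i))"
    "\<And>t. t<r (Suc i) \<Longrightarrow> f' (basis_vec R (r (Suc i)) t) \<in> H' (Suc i) (d (Suc i) t)" by blast
  have k: "\<phi> (Suc i) (\<phi> (Suc (Suc i)) v) = \<zero>\<^bsub>F i\<^esub>" if "v \<in> carrier (F (Suc (Suc i)))" for v
    using D(5)[of i] that by blast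
  have k': "\<phi>' (Suc i) (\<phi>' (Suc (Suc i)) v) = \<zero>\<^bsub>F' i\<^esub>" if "v \<in> carrier (F' (Suc (Suc i)))" for v
    using D'(5)[of i] that by blast
  have "comparison (Suc i) f' g' h'"
    unfolding comparison_def D(5) D'(5)
    using * pc p'c k k' module_homD(1)[OF *(1)] module_homD(1)[OF *(2)]
      module_hom_zero[OF Fm Fm' f] module_hom_zero[OF Fm' Fm g] module_hom_zero[OF Fm Fm h] by simp
  then show ?thesis using *(4) by blast
qed

lemma comparison_exists: "\<exists>f g h. comparison i f g h"
  by (induct i) (use comparison_0 comparison_Suc in blast)+

end

section \<open>The associated graded ring and associated graded modules\<close>

lemma (in abelian_group) a_inv_zero [simp]: "\<ominus> \<zero> = \<zero>"
  by (rule minus_equality) simp_all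

context adic
begin

definition gr_class where "gr_class N n x = Mp N (Suc n) +>\<^bsub>N\<^esub> x"

text \<open>Finitely supported families of representatives: for the ring itself the Rees algebra,
  for general \<open>N\<close> the Rees module, with \<open>gr_of\<close> as the quotient map onto
  the associated graded object.\<close>

definition gr_seq where
  "gr_seq N = {x. (\<forall>n. x n \<in> Mp N n) \<and> (\<exists>k. \<forall>n>k. x n = \<zero>\<^bsub>N\<^esub>)}"

definition gr_of where "gr_of N x = (\<lambda>n. gr_class N n (x n))"

abbreviation gr where "gr N \<equiv> assoc_graded_module R m N"

definition cauchy where
  "cauchy N a x = (\<lambda>n. finsum N (\<lambda>i. a i \<odot>\<^bsub>N\<^esub> x (n - i)) {..n})"

context
  fixes N assumes N: "module R N"
begin

interpretation N: module R N by (rule N)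

lemma Mp_abelian_subgroup: "abelian_subgroup (Mp N i) N"
  by (rule abelian_subgroupI3)
    (use submodule.axioms(1)[OF Mp_submodule[OF N]] in \<open>auto intro: additive_subgroup.intro N.abelian_group_axioms\<close>)

lemma gr_class_eq_iff:
  assumes "x \<in> carrier N" "y \<in> carrier N"
  shows "gr_class N n x = gr_class N n y \<longleftrightarrow> x \<ominus>\<^bsub>N\<^esub> y \<in> Mp N (Suc n)"
proof -
  interpret S: abelian_subgroup "Mp N (Suc n)" N by (rule Mp_abelian_subgroup)
  show ?thesis
  proof
    assume "gr_class N n x = gr_class N n y"
    then have "x \<in> Mp N (Suc n) +>\<^bsub>N\<^esub> y"
      using S.a_rcos_self[OF assms(1)] by (simp add: gr_class_def)
    then show "x \<ominus>\<^bsub>N\<^esub> y \<in> Mp N (Suc n)"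
      using S.a_rcos_module[OF assms(2,1)] by (simp add: a_minus_def)
  next
    assume "x \<ominus>\<^bsub>N\<^esub> y \<in> Mp N (Suc n)"
    then have "x \<in> Mp N (Suc n) +>\<^bsub>N\<^esub> y"
      using S.a_rcos_module[OF assms(2,1)] by (simp add: a_minus_def)
    then show "gr_class N n x = gr_class N n y"
      using S.a_repr_independence'[OF _ assms(2)] unfolding gr_class_def by simp
  qed
qed

lemma gr_class_zero: "gr_class N n \<zero>\<^bsub>N\<^esub> = Mp N (Suc n)"
  unfolding gr_class_def using Mp_rules(1)[OF N, of "Suc n"] by simp

lemma gr_component_carrier: "carrier (gr_component R m N n) = gr_class N n ` Mp N n"
  by (auto simp: gr_component_def FactGroup_def RCOSETS_def r_coset_def gr_class_def a_r_coset_def)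

lemma gr_component_one: "\<one>\<^bsub>gr_component R m N n\<^esub> = Mp N (Suc n)"
  by (simp add: gr_component_def FactGroup_def)

lemma gr_component_mult:
  assumes "x \<in> carrier N" "y \<in> carrier N"
  shows "gr_class N n x \<otimes>\<^bsub>gr_component R m N n\<^esub> gr_class N n y = gr_class N n (x \<oplus>\<^bsub>N\<^esub> y)"
proof -
  interpret S: abelian_subgroup "Mp N (Suc n)" N by (rule Mp_abelian_subgroup)
  show ?thesis
    using S.a_rcos_sum[OF assms]
    by (simp add: gr_component_def FactGroup_def gr_class_def set_add_def set_mult_def)
qed

lemma gr_component_comm_group: "comm_group (gr_component R m N n)"
proof -
  note c = Mp_carr[OF N]
  show ?thesis
  proof (rule comm_groupI)
    fix x assume "x \<in> carrier (gr_component R m N n)"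
    then obtain u where "u \<in> Mp N n" "x = gr_class N n u" by (auto simp: gr_component_carrier)
    then show "\<exists>y\<in>carrier (gr_component R m N n). y \<otimes>\<^bsub>gr_component R m N n\<^esub> x = \<one>\<^bsub>gr_component R m N n\<^esub>"
      using Mp_rules(4)[OF N] c unfolding gr_component_carrier
      by (intro bexI[of _ "gr_class N n (\<ominus>\<^bsub>N\<^esub> u)"])
        (auto simp: gr_component_mult gr_component_one N.l_neg gr_class_zero)
  qed (use Mp_rules(2,3)[OF N] c in \<open>auto simp: gr_component_carrier gr_component_one gr_component_mult
      gr_class_zero[symmetric] N.a_ac\<close>)
qed

lemma gr_component_finprod:
  assumes "finite T" "u \<in> T \<rightarrow> Mp N n"
  shows "finprod (gr_component R m N n) (\<lambda>i. gr_class N n (u i)) T = gr_class N n (finsum N u T)"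
proof -
  interpret G: comm_group "gr_component R m N n" by (rule gr_component_comm_group)
  note c = Mp_carr[OF N]
  show ?thesis using assms
  proof (induct T)
    case empty then show ?case by (simp add: gr_component_one gr_class_zero)
  next
    case (insert x T)
    have "(\<lambda>i. gr_class N n (u i)) \<in> T \<rightarrow> carrier (gr_component R m N n)"
      "gr_class N n (u x) \<in> carrier (gr_component R m N n)"
      using insert by (auto simp: gr_component_carrier)
    moreover have "u \<in> T \<rightarrow> carrier N" "u x \<in> carrier N" using insert c by (auto simp: Pi_iff)
    ultimately show ?case using insert by (simp add: gr_component_mult Pi_iff)
  qed
qed

lemma gr_seqD: "x \<in> gr_seq N \<Longrightarrow> x n \<in> Mp N n" "x \<in> gr_seq N \<Longrightarrow> x n \<in> carrier N"
  using Mp_carr[OF N] by (auto simp: gr_seq_def)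

lemma gr_sum_group_carrier: "carrier (sum_group UNIV (gr_component R m N)) = gr_of N ` gr_seq N"
proof -
  have g: "group (gr_component R m N i)" for i
    using gr_component_comm_group by (simp add: comm_group_def)
  show ?thesis
  proof (intro equalityI subsetI)
    fix g assume "g \<in> carrier (sum_group UNIV (gr_component R m N))"
    then have 1: "\<And>n. g n \<in> gr_class N n ` Mp N n" and 2: "finite {n. g n \<noteq> Mp N (Suc n)}"
      by (auto simp: carrier_sum_group g gr_component_carrier gr_component_one)
    from 1 have "\<forall>n. \<exists>x. x \<in> Mp N n \<and> g n = gr_class N n x" by (simp add: image_iff Bex_def)
    from choice[OF this] obtain x where "\<forall>n. x n \<in> Mp N n \<and> g n = gr_class N n (x n)"
      by (rule exE)
    then have x: "\<And>n. x n \<in> Mp N n" "\<And>n. g n = gr_class N n (x n)" by simp_all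
    \<comment> \<open>A trivial coset gets the representative zero, so that finite support of the
      cosets gives finite support of the representatives.\<close>
    define y where "y n = (if g n = Mp N (Suc n) then \<zero>\<^bsub>N\<^esub> else x n)" for n
    obtain k where k: "\<And>n. n > k \<Longrightarrow> g n = Mp N (Suc n)"
      using 2 finite_nat_set_iff_bounded_le[of "{n. g n \<noteq> Mp N (Suc n)}"] by (auto simp: not_le[symmetric])
    have "y \<in> gr_seq N"
      using x(1) k Mp_rules(2)[OF N] by (auto simp: gr_seq_def y_def intro!: exI[of _ k])
    moreover have "g = gr_of N y" using x(2) by (auto simp: gr_of_def y_def gr_class_zero fun_eq_iff)
    ultimately show "g \<in> gr_of N ` gr_seq N" by blast
  next
    fix g assume "g \<in> gr_of N ` gr_seq N"
    then obtain x where x: "x \<in> gr_seq N" "g = gr_of N x" by blast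
    then obtain k where k: "\<And>n. n > k \<Longrightarrow> x n = \<zero>\<^bsub>N\<^esub>" by (auto simp: gr_seq_def)
    have "{n. g n \<noteq> Mp N (Suc n)} \<subseteq> {..k}"
      using k by (auto simp: x(2) gr_of_def gr_class_zero not_le[symmetric])
    then have "finite {n. g n \<noteq> Mp N (Suc n)}" using finite_subset by blast
    then show "g \<in> carrier (sum_group UNIV (gr_component R m N))"
      using gr_seqD(1)[OF x(1)]
      by (auto simp: carrier_sum_group g gr_component_carrier gr_component_one x(2) gr_of_def)
  qed
qed

lemma gr_carrier: "carrier (gr N) = gr_of N ` gr_seq N"
  by (simp add: assoc_graded_module_def Let_def gr_sum_group_carrier)

lemma gr_zero: "\<zero>\<^bsub>gr N\<^esub> = gr_of N (\<lambda>_. \<zero>\<^bsub>N\<^esub>)"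
  by (auto simp: assoc_graded_module_def Let_def gr_component_one gr_of_def gr_class_zero)

lemma gr_add:
  assumes "x \<in> gr_seq N" "y \<in> gr_seq N"
  shows "gr_of N x \<oplus>\<^bsub>gr N\<^esub> gr_of N y = gr_of N (\<lambda>n. x n \<oplus>\<^bsub>N\<^esub> y n)"
  using gr_seqD(2)[OF assms(1)] gr_seqD(2)[OF assms(2)]
  by (auto simp: assoc_graded_module_def Let_def gr_of_def gr_component_mult)

lemma gr_mcomp:
  "mcomp (gr N) j = {gr_of N (\<lambda>n. if n = j then x else \<zero>\<^bsub>N\<^esub>) |x. x \<in> Mp N j}"
proof (intro equalityI subsetI)
  fix g assume "g \<in> mcomp (gr N) j"
  then have g: "g \<in> gr_of N ` gr_seq N" "\<And>i. i \<noteq> j \<Longrightarrow> g i = Mp N (Suc i)"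
    by (auto simp: assoc_graded_module_def Let_def gr_component_one gr_sum_group_carrier)
  then obtain x where x: "x \<in> gr_seq N" "g = gr_of N x" by blast
  have "g = gr_of N (\<lambda>n. if n = j then x j else \<zero>\<^bsub>N\<^esub>)"
    using g(2) by (auto simp: x(2) gr_of_def gr_class_zero fun_eq_iff)
  then show "g \<in> {gr_of N (\<lambda>n. if n = j then x else \<zero>\<^bsub>N\<^esub>) |x. x \<in> Mp N j}"
    using gr_seqD(1)[OF x(1)] by blast
next
  fix g assume "g \<in> {gr_of N (\<lambda>n. if n = j then x else \<zero>\<^bsub>N\<^esub>) |x. x \<in> Mp N j}"
  then obtain x where x: "x \<in> Mp N j" "g = gr_of N (\<lambda>n. if n = j then x else \<zero>\<^bsub>N\<^esub>)" by blast
  then have "(\<lambda>n. if n = j then x else \<zero>\<^bsub>N\<^esub>) \<in> gr_seq N"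
    using Mp_rules(2)[OF N] by (auto simp: gr_seq_def intro!: exI[of _ j])
  then show "g \<in> mcomp (gr N) j"
    using x(2) by (auto simp: assoc_graded_module_def Let_def gr_component_one gr_sum_group_carrier
      gr_of_def gr_class_zero)
qed

end

lemma self_module_simps:
  "carrier (self_module R) = carrier R" "\<zero>\<^bsub>self_module R\<^esub> = \<zero>"
  "x \<oplus>\<^bsub>self_module R\<^esub> y = x \<oplus> y" "a \<odot>\<^bsub>self_module R\<^esub> x = a \<otimes> x"
  "add (self_module R) = add R"
  by (simp_all add: self_module_def)

lemma self_module_is_module: "module R (self_module R)"
proof (rule moduleI)
  show "abelian_group (self_module R)"
  proof (rule abelian_groupI)
    fix x assume "x \<in> carrier (self_module R)"
    then show "\<exists>y\<in>carrier (self_module R). y \<oplus>\<^bsub>self_module R\<^esub> x = \<zero>\<^bsub>self_module R\<^esub>"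
      by (intro bexI[of _ "\<ominus> x"]) (simp_all add: self_module_simps l_neg)
  qed (auto simp: self_module_simps a_ac)
qed (auto simp: self_module_simps is_cring l_distr r_distr m_assoc)

lemma self_module_finsum:
  assumes "finite T" "f \<in> T \<rightarrow> carrier R"
  shows "finsum (self_module R) f T = finsum R f T"
  using assms
proof (induct T)
  case empty
  interpret S: module R "self_module R" by (rule self_module_is_module)
  show ?case by (simp add: self_module_simps)
next
  case (insert x T)
  interpret S: module R "self_module R" by (rule self_module_is_module)
  have "f \<in> T \<rightarrow> carrier (self_module R)" "f x \<in> carrier (self_module R)"
    using insert by (auto simp: self_module_simps)
  then show ?case using insert by (simp add: self_module_simps Pi_iff)
qed

lemma self_module_a_inv:
  assumes "x \<in> carrier R" shows "\<ominus>\<^bsub>self_module R\<^esub> x = \<ominus> x"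
proof -
  interpret S: module R "self_module R" by (rule self_module_is_module)
  show ?thesis using assms S.minus_equality[of "\<ominus> x" x] by (simp add: self_module_simps l_neg)
qed

lemma self_module_minus:
  assumes "y \<in> carrier R" shows "x \<ominus>\<^bsub>self_module R\<^esub> y = x \<ominus> y"
  using assms by (simp add: a_minus_def self_module_a_inv self_module_simps)

lemma Mp_self [simp]: "Mp (self_module R) i = mpow i"
proof
  interpret I: ideal "mpow i" R by (rule mpow_ideal)
  interpret S: module R "self_module R" by (rule self_module_is_module)
  have "submodule (mpow i) R (self_module R)"
    using I.a_subset I.a_inv_closed
    by (intro S.submoduleI) (auto simp: self_module_simps self_module_a_inv I.Icarr I.I_l_closed)
  then show "Mp (self_module R) i \<subseteq> mpow i"
    unfolding Mp_alt by (rule ideal_smult_least[OF self_module_is_module])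
      (auto simp: self_module_simps I.I_r_closed)
  show "mpow i \<subseteq> Mp (self_module R) i"
  proof
    fix x assume x: "x \<in> mpow i"
    have "x \<odot>\<^bsub>self_module R\<^esub> \<one> \<in> Mp (self_module R) i"
      unfolding Mp_alt using x by (intro ideal_smult_incl) (simp_all add: self_module_simps)
    then show "x \<in> Mp (self_module R) i" using mpow_carr[OF x] by (simp add: self_module_simps)
  qed
qed

abbreviation R_seq where "R_seq \<equiv> gr_seq (self_module R)"
abbreviation R_of where "R_of \<equiv> gr_of (self_module R)"

lemma R_seqD: "a \<in> R_seq \<Longrightarrow> a n \<in> mpow n" "a \<in> R_seq \<Longrightarrow> a n \<in> carrier R"
  using gr_seqD[OF self_module_is_module, of a n] by (auto simp: self_module_simps)

context
  fixes N assumes N: "module R N"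
begin

interpretation N: module R N by (rule N)

lemma cauchy_closed:
  assumes a: "a \<in> R_seq" and x: "x \<in> gr_seq N"
  shows "cauchy N a x \<in> gr_seq N"
proof -
  note ac = R_seqD[OF a] and xc = gr_seqD[OF N x]
  obtain k l where k: "\<And>n. n > k \<Longrightarrow> a n = \<zero>" and l: "\<And>n. n > l \<Longrightarrow> x n = \<zero>\<^bsub>N\<^esub>"
    using a x by (auto simp: gr_seq_def self_module_simps)
  have "cauchy N a x n = \<zero>\<^bsub>N\<^esub>" if "n > k + l" for n
  proof -
    have "a i \<odot>\<^bsub>N\<^esub> x (n - i) = \<zero>\<^bsub>N\<^esub>" for i
      using k[of i] l[of "n - i"] ac xc that by (cases "i > k") auto
    then show ?thesis unfolding cauchy_def by simp
  qed
  moreover have "cauchy N a x n \<in> Mp N n" for n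
  proof -
    have "finsum N (\<lambda>i. a i \<odot>\<^bsub>N\<^esub> x (n - i)) T \<in> Mp N n" if "finite T" "T \<subseteq> {..n}" for T
      using that
    proof (induct T)
      case (insert i T)
      have "a i \<odot>\<^bsub>N\<^esub> x (n - i) \<in> Mp N (i + (n - i))"
        by (rule Mp_smult[OF N ac(1) xc(1)])
      then show ?case using insert Mp_rules(3)[OF N] ac xc by simp
    qed (use Mp_rules(2)[OF N] in simp)
    then show ?thesis unfolding cauchy_def by simp
  qed
  ultimately show ?thesis unfolding gr_seq_def by blast
qed

text \<open>Well-definedness of the pairing: replacing \<open>a\<close> and \<open>x\<close> by c +
  a and y = z + x, with \<open>c\<close> in m^(i+1) and \<open>z\<close> in m^(j+1) N, changes the
  product by c y + a z, which lies in m^(i+j+1) N.\<close>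

lemma gr_pairing_class:
  assumes a: "a \<in> mpow i" and x: "x \<in> Mp N j"
  shows "gr_pairing R m N i j (gr_class (self_module R) i a) (gr_class N j x)
    = gr_class N (i + j) (a \<odot>\<^bsub>N\<^esub> x)"
proof -
  interpret S: abelian_subgroup "Mp N (Suc j)" N by (rule Mp_abelian_subgroup[OF N])
  interpret T: abelian_subgroup "Mp (self_module R) (Suc i)" "self_module R"
    by (rule Mp_abelian_subgroup[OF self_module_is_module])
  have ac: "a \<in> carrier R" and xc: "x \<in> carrier N" using a x mpow_carr Mp_carr[OF N] by auto
  have main: "gr_class N (i + j) (b \<odot>\<^bsub>N\<^esub> y) = gr_class N (i + j) (a \<odot>\<^bsub>N\<^esub> x)"
    if b: "b \<in> gr_class (self_module R) i a" and y: "y \<in> gr_class N j x" for b y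
  proof -
    obtain c where c: "c \<in> mpow (Suc i)" "b = c \<oplus> a"
      using b by (auto simp: gr_class_def a_r_coset_def r_coset_def self_module_simps)
    obtain z where z: "z \<in> Mp N (Suc j)" "y = z \<oplus>\<^bsub>N\<^esub> x"
      using y by (auto simp: gr_class_def a_r_coset_def r_coset_def)
    have cc: "c \<in> carrier R" "z \<in> carrier N" using c z mpow_carr Mp_carr[OF N] by auto
    have "b \<odot>\<^bsub>N\<^esub> y = (c \<odot>\<^bsub>N\<^esub> y \<oplus>\<^bsub>N\<^esub> a \<odot>\<^bsub>N\<^esub> z) \<oplus>\<^bsub>N\<^esub> a \<odot>\<^bsub>N\<^esub> x"
      using cc c(2) z(2) ac xc by (simp add: N.smult_l_distr N.smult_r_distr N.a_ac)
    then have eq: "b \<odot>\<^bsub>N\<^esub> y \<ominus>\<^bsub>N\<^esub> a \<odot>\<^bsub>N\<^esub> x = c \<odot>\<^bsub>N\<^esub> y \<oplus>\<^bsub>N\<^esub> a \<odot>\<^bsub>N\<^esub> z"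
      using cc ac xc z(2) by (simp add: a_minus_def N.a_assoc N.r_neg)
    have "y \<in> Mp N j" using z x Mp_rules(3)[OF N] Mp_antimono[OF N, of j "Suc j"] by auto
    then have "c \<odot>\<^bsub>N\<^esub> y \<in> Mp N (Suc i + j)" by (rule Mp_smult[OF N c(1)])
    moreover have "a \<odot>\<^bsub>N\<^esub> z \<in> Mp N (i + Suc j)" by (rule Mp_smult[OF N a z(1)])
    ultimately have "b \<odot>\<^bsub>N\<^esub> y \<ominus>\<^bsub>N\<^esub> a \<odot>\<^bsub>N\<^esub> x \<in> Mp N (Suc (i + j))"
      unfolding eq using Mp_rules(3)[OF N] by simp
    then show ?thesis
      using gr_class_eq_iff[OF N] cc ac xc c(2) z(2) by simp
  qed
  have "a \<in> gr_class (self_module R) i a" "x \<in> gr_class N j x"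
    using S.a_rcos_self[of x] T.a_rcos_self[of a] ac xc by (auto simp: gr_class_def self_module_simps)
  then show ?thesis
    unfolding gr_pairing_def gr_class_def[of N "i + j", symmetric] using main by blast
qed

lemma gr_smult:
  assumes a: "a \<in> R_seq" and x: "x \<in> gr_seq N"
  shows "R_of a \<odot>\<^bsub>gr N\<^esub> gr_of N x = gr_of N (cauchy N a x)"
proof
  fix n
  note ac = R_seqD[OF a] and xc = gr_seqD[OF N x]
  interpret G: comm_group "gr_component R m N n" by (rule gr_component_comm_group[OF N])
  have t: "a i \<odot>\<^bsub>N\<^esub> x (n - i) \<in> Mp N n" if "i \<le> n" for i
    using Mp_smult[OF N ac(1)[of i] xc(1)[of "n - i"]] that by simp
  have "(R_of a \<odot>\<^bsub>gr N\<^esub> gr_of N x) n = finprod (gr_component R m N n)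
    (\<lambda>i. gr_pairing R m N i (n - i) (R_of a i) (gr_of N x (n - i))) {..n}"
    by (simp add: assoc_graded_module_def Let_def)
  also have "\<dots> = finprod (gr_component R m N n) (\<lambda>i. gr_class N n (a i \<odot>\<^bsub>N\<^esub> x (n - i))) {..n}"
    using t by (intro G.finprod_cong') (auto simp: gr_of_def gr_pairing_class ac xc gr_component_carrier[OF N])
  also have "\<dots> = gr_class N n (cauchy N a x n)"
    unfolding cauchy_def using t by (intro gr_component_finprod[OF N]) auto
  finally show "(R_of a \<odot>\<^bsub>gr N\<^esub> gr_of N x) n = gr_of N (cauchy N a x) n" by (simp add: gr_of_def)
qed

end

abbreviation A where "A \<equiv> assoc_graded_ring R m"

lemma A_carrier: "carrier A = R_of ` R_seq"
  by (simp add: assoc_graded_ring_def Let_def gr_carrier[OF self_module_is_module])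

lemma A_zero: "\<zero>\<^bsub>A\<^esub> = R_of (\<lambda>_. \<zero>)"
  by (simp add: assoc_graded_ring_def Let_def gr_zero[OF self_module_is_module] self_module_simps)

lemma A_one: "\<one>\<^bsub>A\<^esub> = R_of (\<lambda>n. if n = 0 then \<one> else \<zero>)"
  using gr_class_zero[OF self_module_is_module]
  by (auto simp: assoc_graded_ring_def Let_def gr_of_def gr_class_def fun_eq_iff a_r_coset_def r_coset_def
      self_module_simps)

lemma A_add: "x \<in> R_seq \<Longrightarrow> y \<in> R_seq \<Longrightarrow> R_of x \<oplus>\<^bsub>A\<^esub> R_of y = R_of (\<lambda>n. x n \<oplus> y n)"
  using gr_add[OF self_module_is_module, of x y] by (simp add: assoc_graded_ring_def Let_def self_module_simps)

lemma A_mult: "x \<in> R_seq \<Longrightarrow> y \<in> R_seq \<Longrightarrow> R_of x \<otimes>\<^bsub>A\<^esub> R_of y = R_of (cauchy (self_module R) x y)"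
  using gr_smult[OF self_module_is_module, of x y] by (simp add: assoc_graded_ring_def Let_def)

lemma A_gcomp: "gcomp A j = {R_of (\<lambda>n. if n = j then x else \<zero>) |x. x \<in> mpow j}"
  using gr_mcomp[OF self_module_is_module, of j]
  by (simp add: assoc_graded_ring_def Let_def self_module_simps cong: if_cong)

text \<open>\<open>A\<close> is a quotient of the Rees algebra, which is a subring of the polynomial ring over \<open>R\<close>.\<close>

lemma A_cring: "cring A"
proof -
  define P where "P = UP R"
  have up: "R_seq \<subseteq> up R"
  proof
    fix a assume a: "a \<in> R_seq"
    then obtain k where "\<And>n. n > k \<Longrightarrow> a n = \<zero>" by (auto simp: gr_seq_def self_module_simps)
    then have "bound \<zero> k a" by (intro bound.intro) simp
    then show "a \<in> up R" using R_seqD(2)[OF a] by (intro mem_upI) (simp, rule exI)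
  qed
  have Pc: "carrier P = up R" by (simp add: P_def UP_def)
  have Padd: "x \<oplus>\<^bsub>P\<^esub> y = (\<lambda>n. x n \<oplus> y n)" if "x \<in> R_seq" "y \<in> R_seq" for x y
    using subsetD[OF up that(1)] subsetD[OF up that(2)] by (simp add: P_def UP_def)
  have Pmult: "x \<otimes>\<^bsub>P\<^esub> y = cauchy (self_module R) x y" if "x \<in> R_seq" "y \<in> R_seq" for x y
  proof -
    have "finsum (self_module R) (\<lambda>i. x i \<otimes> y (n - i)) {..n} = finsum R (\<lambda>i. x i \<otimes> y (n - i)) {..n}" for n
      using R_seqD(2)[OF that(1)] R_seqD(2)[OF that(2)] by (intro self_module_finsum) auto
    then show ?thesis using subsetD[OF up that(1)] subsetD[OF up that(2)]
      by (simp add: P_def UP_def cauchy_def self_module_simps)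
  qed
  have Pone: "\<one>\<^bsub>P\<^esub> = (\<lambda>n. if n = 0 then \<one> else \<zero>)" by (simp add: P_def UP_def)
  have Pzero: "\<zero>\<^bsub>P\<^esub> = (\<lambda>n. \<zero>)" by (simp add: P_def UP_def)
  note R_l_neg = l_neg
  interpret UP_cring R P by unfold_locales (rule eq_reflection, rule P_def)
  note mr = ideal.axioms(1)[OF mpow_ideal]
  have one: "(\<lambda>n. if n = 0 then \<one> else \<zero>) \<in> R_seq"
    using additive_subgroup.zero_closed[OF mr] by (auto simp: gr_seq_def self_module_simps)
  have minus: "\<ominus>\<^bsub>P\<^esub> x \<in> R_seq" if x: "x \<in> R_seq" for x
  proof -
    obtain k where "\<And>n. n > k \<Longrightarrow> x n = \<zero>" using x by (auto simp: gr_seq_def self_module_simps)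
    then have y: "(\<lambda>n. \<ominus> (x n)) \<in> R_seq"
      using R_seqD(1)[OF x] additive_subgroup.a_inv_closed[OF mr]
      by (auto simp: gr_seq_def self_module_simps intro!: exI[of _ k])
    have "(\<lambda>n. \<ominus> (x n)) \<oplus>\<^bsub>P\<^esub> x = \<zero>\<^bsub>P\<^esub>"
      unfolding Padd[OF y x] Pzero using R_seqD(2)[OF x] by (simp add: R_l_neg)
    then have "\<ominus>\<^bsub>P\<^esub> x = (\<lambda>n. \<ominus> (x n))"
      using subsetD[OF up x] subsetD[OF up y] unfolding Pc[symmetric] by (intro P.minus_equality)
    then show ?thesis using y by simp
  qed
  have add: "(\<lambda>n. x n \<oplus> y n) \<in> R_seq" if x: "x \<in> R_seq" and y: "y \<in> R_seq" for x y
  proof -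
    obtain k l where "\<And>n. n > k \<Longrightarrow> x n = \<zero>" "\<And>n. n > l \<Longrightarrow> y n = \<zero>"
      using x y by (auto simp: gr_seq_def self_module_simps)
    then show ?thesis using R_seqD[OF x] R_seqD[OF y]
      by (auto simp: gr_seq_def self_module_simps additive_subgroup.a_closed[OF mr] intro!: exI[of _ "k + l"])
  qed
  have "subring R_seq P"
  proof (rule ring.subringI)
    show "ring P" by (rule P.ring_axioms)
    show "R_seq \<subseteq> carrier P" using up Pc by simp
    show "\<one>\<^bsub>P\<^esub> \<in> R_seq" using one Pone by simp
  qed (use minus add Padd Pmult cauchy_closed[OF self_module_is_module] in auto)
  then interpret B: ring "P\<lparr>carrier := R_seq\<rparr>" by (rule P.subring_is_ring)
  have hom: "R_of \<in> ring_hom (P\<lparr>carrier := R_seq\<rparr>) A"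
    using A_carrier by (auto simp: ring_hom_def Pmult Padd A_mult A_add A_one Pone)
  have "ring (A\<lparr>carrier := R_of ` carrier (P\<lparr>carrier := R_seq\<rparr>), zero := R_of \<zero>\<^bsub>P\<lparr>carrier := R_seq\<rparr>\<^esub>\<rparr>)"
    by (rule B.ring_hom_imp_img_ring[OF hom])
  moreover have "A\<lparr>carrier := R_of ` carrier (P\<lparr>carrier := R_seq\<rparr>), zero := R_of \<zero>\<^bsub>P\<lparr>carrier := R_seq\<rparr>\<^esub>\<rparr> = A"
    using A_carrier A_zero Pzero by simp
  ultimately have ring: "ring A" by simp
  have "x \<otimes>\<^bsub>A\<^esub> y = y \<otimes>\<^bsub>A\<^esub> x" if xy: "x \<in> carrier A" "y \<in> carrier A" for x y
  proof -
    obtain a b where ab: "a \<in> R_seq" "b \<in> R_seq" "x = R_of a" "y = R_of b"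
      using xy A_carrier by auto
    have "a \<otimes>\<^bsub>P\<^esub> b = b \<otimes>\<^bsub>P\<^esub> a" using ab up Pc by (intro P.m_comm) auto
    then show ?thesis using ab by (simp add: A_mult Pmult)
  qed
  then show ?thesis using ring by (intro cring.intro comm_monoid.intro comm_monoid_axioms.intro) (auto simp: ring_def)
qed

end

section \<open>Representatives of homogeneous components\<close>

context adic
begin

text \<open>A relation and not a function, because a component determines its representative only
  modulo the next power of \<open>m\<close>. It is the interface through which statements over
  \<open>A\<close> are translated into statements over \<open>R\<close>.\<close>

definition gr_rep where
  "gr_rep N g n x \<longleftrightarrow> g \<in> carrier (gr N) \<and> x \<in> Mp N n \<and> g n = gr_class N n x"

context
  fixes N assumes N: "module R N"
begin

interpretation N: module R N by (rule N)

lemma gr_rep_carr: "gr_rep N g n x \<Longrightarrow> x \<in> Mp N n"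
  by (simp add: gr_rep_def)

lemma gr_rep_exists: "g \<in> carrier (gr N) \<Longrightarrow> \<exists>x. gr_rep N g n x"
  unfolding gr_rep_def gr_carrier[OF N] using gr_seqD(1)[OF N] by (auto simp: gr_of_def)

lemma gr_rep_eq:
  assumes "gr_rep N g n x" "y \<in> carrier N"
  shows "gr_rep N g n y \<longleftrightarrow> x \<ominus>\<^bsub>N\<^esub> y \<in> Mp N (Suc n)"
proof -
  have x: "x \<in> Mp N n" "x \<in> carrier N" using assms(1) Mp_carr[OF N] by (auto simp: gr_rep_def)
  have "y \<in> Mp N n" if "x \<ominus>\<^bsub>N\<^esub> y \<in> Mp N (Suc n)"
  proof -
    have "x \<ominus>\<^bsub>N\<^esub> y \<in> Mp N n" using that Mp_antimono[OF N, of n "Suc n"] by auto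
    then have "x \<ominus>\<^bsub>N\<^esub> (x \<ominus>\<^bsub>N\<^esub> y) \<in> Mp N n" using x(1) Mp_rules(5)[OF N] by blast
    then show ?thesis using x(2) assms(2)
      by (simp add: a_minus_def N.minus_add N.r_neg1 N.r_neg2)
  qed
  then show ?thesis using assms x gr_class_eq_iff[OF N x(2) assms(2), of n]
    by (auto simp: gr_rep_def)
qed

end

lemma gr_rep_eq_self:
  assumes "gr_rep (self_module R) g n x" "y \<in> carrier R"
  shows "gr_rep (self_module R) g n y \<longleftrightarrow> x \<ominus> y \<in> mpow (Suc n)"
  using gr_rep_eq[OF self_module_is_module assms(1)] assms(2)
  by (simp add: self_module_simps self_module_minus)

context
  fixes N assumes N: "module R N"
begin

interpretation N: module R N by (rule N)

lemma gr_rep_zero: "gr_rep N \<zero>\<^bsub>gr N\<^esub> n \<zero>\<^bsub>N\<^esub>"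
proof -
  have "(\<lambda>_. \<zero>\<^bsub>N\<^esub>) \<in> gr_seq N" using Mp_rules(2)[OF N] by (auto simp: gr_seq_def)
  then show ?thesis
    unfolding gr_rep_def gr_carrier[OF N] gr_zero[OF N] using Mp_rules(2)[OF N] by (simp add: gr_of_def)
qed

lemma gr_rep_ext:
  assumes "\<And>n. \<exists>x. gr_rep N g n x \<and> gr_rep N h n x"
  shows "g = h"
  using assms by (fastforce simp: gr_rep_def)

lemma gr_rep_add:
  assumes "gr_rep N g n x" "gr_rep N h n y"
  shows "gr_rep N (g \<oplus>\<^bsub>gr N\<^esub> h) n (x \<oplus>\<^bsub>N\<^esub> y)"
proof -
  have xy: "x \<in> carrier N" "y \<in> carrier N" using assms Mp_carr[OF N] by (auto simp: gr_rep_def)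
  obtain u v where uv: "u \<in> gr_seq N" "v \<in> gr_seq N" "g = gr_of N u" "h = gr_of N v"
    using assms by (auto simp: gr_rep_def gr_carrier[OF N])
  have "(\<lambda>n. u n \<oplus>\<^bsub>N\<^esub> v n) \<in> gr_seq N"
  proof -
    obtain k l where "\<And>n. n > k \<Longrightarrow> u n = \<zero>\<^bsub>N\<^esub>" "\<And>n. n > l \<Longrightarrow> v n = \<zero>\<^bsub>N\<^esub>"
      using uv by (auto simp: gr_seq_def)
    then show ?thesis using gr_seqD(1)[OF N uv(1)] gr_seqD(1)[OF N uv(2)] Mp_rules(3)[OF N]
      by (auto simp: gr_seq_def intro!: exI[of _ "k + l"])
  qed
  then have "g \<oplus>\<^bsub>gr N\<^esub> h \<in> carrier (gr N)"
    unfolding uv(3,4) gr_add[OF N uv(1,2)] gr_carrier[OF N] by blast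
  moreover have "(g \<oplus>\<^bsub>gr N\<^esub> h) n = gr_class N n (x \<oplus>\<^bsub>N\<^esub> y)"
    using assms gr_component_mult[OF N xy, of n] by (simp add: assoc_graded_module_def Let_def gr_rep_def)
  ultimately show ?thesis using assms Mp_rules(3)[OF N] by (auto simp: gr_rep_def)
qed

lemma homog_seq:
  assumes "u \<in> Mp N a" shows "(\<lambda>k. if k = a then u else \<zero>\<^bsub>N\<^esub>) \<in> gr_seq N"
  using assms Mp_rules(2)[OF N] by (auto simp: gr_seq_def intro!: exI[of _ a])

text \<open>Homogeneity expressed degree by degree: one representative in degree \<open>a\<close>
  and zero in all others. In this form it can be carried through an abstract relation of
  representatives, without reference to a grading.\<close>

lemma gr_rep_homog:
  assumes u: "u \<in> Mp N a"
  shows "(\<forall>k. gr_rep N g k (if k = a then u else \<zero>\<^bsub>N\<^esub>)) \<longleftrightarrow> g = gr_of N (\<lambda>k. if k = a then u else \<zero>\<^bsub>N\<^esub>)"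
proof
  assume "\<forall>k. gr_rep N g k (if k = a then u else \<zero>\<^bsub>N\<^esub>)"
  then have "g k = gr_of N (\<lambda>k. if k = a then u else \<zero>\<^bsub>N\<^esub>) k" for k
    by (simp add: gr_rep_def gr_of_def)
  then show "g = gr_of N (\<lambda>k. if k = a then u else \<zero>\<^bsub>N\<^esub>)" by blast
next
  assume "g = gr_of N (\<lambda>k. if k = a then u else \<zero>\<^bsub>N\<^esub>)"
  then show "\<forall>k. gr_rep N g k (if k = a then u else \<zero>\<^bsub>N\<^esub>)"
    using homog_seq[OF u] u Mp_rules(2)[OF N] by (auto simp: gr_rep_def gr_carrier[OF N] gr_of_def)
qed

lemma gr_rep_mcomp:
  "g \<in> mcomp (gr N) a \<longleftrightarrow> (\<exists>u\<in>Mp N a. \<forall>k. gr_rep N g k (if k = a then u else \<zero>\<^bsub>N\<^esub>))"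
  unfolding gr_mcomp[OF N] using gr_rep_homog by auto

text \<open>As \<open>g\<close> is homogeneous, at most one term of the Cauchy product survives in
  each degree, so \<open>z\<close> may be arbitrary. The degrees below \<open>a\<close> are stated
  separately since they are not of the form \<open>n + a\<close>.\<close>

lemma gr_rep_smult:
  assumes z: "gr_rep (self_module R) z n x"
    and g: "\<And>k. gr_rep N g k (if k = a then u else \<zero>\<^bsub>N\<^esub>)"
  shows "gr_rep N (z \<odot>\<^bsub>gr N\<^esub> g) (n + a) (x \<odot>\<^bsub>N\<^esub> u)"
    and "c < a \<Longrightarrow> gr_rep N (z \<odot>\<^bsub>gr N\<^esub> g) c \<zero>\<^bsub>N\<^esub>"
proof -
  have u: "u \<in> Mp N a" "u \<in> carrier N" using g[of a] Mp_carr[OF N] by (auto simp: gr_rep_def)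
  obtain s where s: "s \<in> R_seq" "z = R_of s"
    using z by (auto simp: gr_rep_def gr_carrier[OF self_module_is_module])
  note sc = R_seqD[OF s(1)]
  let ?g = "\<lambda>k. if k = a then u else \<zero>\<^bsub>N\<^esub>"
  have "g = gr_of N ?g" using gr_rep_homog[OF u(1)] g by blast
  then have zg: "z \<odot>\<^bsub>gr N\<^esub> g = gr_of N (cauchy N s ?g)"
    using gr_smult[OF N s(1) homog_seq[OF u(1)]] s(2) by simp
  have seq: "cauchy N s ?g \<in> gr_seq N" by (rule cauchy_closed[OF N s(1) homog_seq[OF u(1)]])
  have rep: "gr_rep N (z \<odot>\<^bsub>gr N\<^esub> g) k (cauchy N s ?g k)" for k
    unfolding zg using seq gr_seqD(1)[OF N seq] by (auto simp: gr_rep_def gr_carrier[OF N] gr_of_def)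
  have "cauchy N s ?g (n + a) = finsum N (\<lambda>i. if n = i then s i \<odot>\<^bsub>N\<^esub> u else \<zero>\<^bsub>N\<^esub>) {..n + a}"
    unfolding cauchy_def using sc u by (intro N.finsum_cong') auto
  also have "\<dots> = s n \<odot>\<^bsub>N\<^esub> u" using sc u by (subst N.finsum_singleton) auto
  finally have r: "gr_rep N (z \<odot>\<^bsub>gr N\<^esub> g) (n + a) (s n \<odot>\<^bsub>N\<^esub> u)" using rep by metis
  have x: "x \<in> carrier R" using z mpow_carr by (auto simp: gr_rep_def)
  have "gr_rep (self_module R) z n (s n)"
    unfolding s(2) using s sc by (auto simp: gr_rep_def gr_carrier[OF self_module_is_module] gr_of_def)
  then have "s n \<ominus> x \<in> mpow (Suc n)"
    using gr_rep_eq_self[of z n "s n" x] z x by simp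
  then have "(s n \<ominus> x) \<odot>\<^bsub>N\<^esub> u \<in> Mp N (Suc n + a)" by (rule Mp_smult[OF N _ u(1)])
  moreover have "(s n \<ominus> x) \<odot>\<^bsub>N\<^esub> u = s n \<odot>\<^bsub>N\<^esub> u \<ominus>\<^bsub>N\<^esub> x \<odot>\<^bsub>N\<^esub> u"
    using sc x u by (simp add: a_minus_def N.smult_l_distr N.smult_l_minus)
  ultimately show "gr_rep N (z \<odot>\<^bsub>gr N\<^esub> g) (n + a) (x \<odot>\<^bsub>N\<^esub> u)"
    using gr_rep_eq[OF N r] x u by simp
  assume "c < a"
  then have "cauchy N s ?g c = finsum N (\<lambda>i. \<zero>\<^bsub>N\<^esub>) {..c}"
    unfolding cauchy_def using sc u by (intro N.finsum_cong') auto
  then show "gr_rep N (z \<odot>\<^bsub>gr N\<^esub> g) c \<zero>\<^bsub>N\<^esub>" using rep[of c] by simp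
qed

end

abbreviation A_rep where "A_rep \<equiv> gr_rep (self_module R)"

lemma A_gr:
  "carrier A = carrier (gr (self_module R))" "\<zero>\<^bsub>A\<^esub> = \<zero>\<^bsub>gr (self_module R)\<^esub>"
  "x \<oplus>\<^bsub>A\<^esub> y = x \<oplus>\<^bsub>gr (self_module R)\<^esub> y" "x \<otimes>\<^bsub>A\<^esub> y = x \<odot>\<^bsub>gr (self_module R)\<^esub> y"
  "gcomp A = mcomp (gr (self_module R))"
  by (simp_all add: assoc_graded_ring_def Let_def)

lemmas selfm = self_module_is_module

lemma A_rep_carr: "A_rep z n x \<Longrightarrow> x \<in> mpow n" "A_rep z n x \<Longrightarrow> x \<in> carrier R" "A_rep z n x \<Longrightarrow> z \<in> carrier A"
  using mpow_carr by (auto simp: gr_rep_def A_gr)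

lemma A_rep_zero: "A_rep \<zero>\<^bsub>A\<^esub> n \<zero>"
  using gr_rep_zero[OF selfm, of n] by (simp add: A_gr self_module_simps)

lemma A_rep_add: "A_rep z n x \<Longrightarrow> A_rep w n y \<Longrightarrow> A_rep (z \<oplus>\<^bsub>A\<^esub> w) n (x \<oplus> y)"
  using gr_rep_add[OF selfm, of z n x w y] by (simp add: A_gr self_module_simps)

lemma A_rep_mult:
  assumes "A_rep z n x" "\<And>k. A_rep w k (if k = a then u else \<zero>)"
  shows "A_rep (z \<otimes>\<^bsub>A\<^esub> w) (n + a) (x \<otimes> u)" and "c < a \<Longrightarrow> A_rep (z \<otimes>\<^bsub>A\<^esub> w) c \<zero>"
  using gr_rep_smult[OF selfm assms(1), of w a u] assms(2) by (simp_all add: A_gr self_module_simps cong: if_cong)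

lemma A_rep_exists: "z \<in> carrier A \<Longrightarrow> \<exists>x. A_rep z n x"
  using gr_rep_exists[OF selfm] by (simp add: A_gr)

lemma A_gcomp_rep: "z \<in> gcomp A a \<longleftrightarrow> (\<exists>u\<in>mpow a. \<forall>k. A_rep z k (if k = a then u else \<zero>))"
  using gr_rep_mcomp[OF selfm, of z a] by (simp add: A_gr self_module_simps cong: if_cong)

lemma A_rep_homog_exists: "u \<in> mpow a \<Longrightarrow> \<exists>z\<in>carrier A. \<forall>k. A_rep z k (if k = a then u else \<zero>)"
  using gr_rep_homog[OF selfm, of u a "R_of (\<lambda>k. if k = a then u else \<zero>)"]
  by (intro bexI[of _ "R_of (\<lambda>k. if k = a then u else \<zero>)"])
    (auto simp: self_module_simps gr_rep_def A_gr cong: if_cong)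

lemma A_one_gcomp: "\<one>\<^bsub>A\<^esub> \<in> gcomp A 0"
  unfolding A_gcomp A_one by auto

lemma A_zero_gcomp: "\<zero>\<^bsub>A\<^esub> \<in> gcomp A j"
  unfolding A_gcomp_rep using A_rep_zero additive_subgroup.zero_closed[OF ideal.axioms(1)[OF mpow_ideal]]
  by (intro bexI[of _ \<zero>]) auto

lemma A_gcomp_carrier: "gcomp A j \<subseteq> carrier A"
  using A_gcomp_rep A_rep_carr(3) by blast

lemma A_gcomp_add:
  assumes "z \<in> gcomp A a" "w \<in> gcomp A a" shows "z \<oplus>\<^bsub>A\<^esub> w \<in> gcomp A a"
proof -
  obtain u v where uv: "u \<in> mpow a" "v \<in> mpow a" "\<And>k. A_rep z k (if k = a then u else \<zero>)"
    "\<And>k. A_rep w k (if k = a then v else \<zero>)" using assms by (auto simp: A_gcomp_rep)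
  have "A_rep (z \<oplus>\<^bsub>A\<^esub> w) k (if k = a then u \<oplus> v else \<zero>)" for k
    using A_rep_add[OF uv(3)[of k] uv(4)[of k]] by (auto split: if_splits)
  moreover have "u \<oplus> v \<in> mpow a"
    using uv by (intro additive_subgroup.a_closed[OF ideal.axioms(1)[OF mpow_ideal]])
  ultimately show ?thesis unfolding A_gcomp_rep by blast
qed

lemma A_gcomp_mult:
  assumes "z \<in> gcomp A a" "w \<in> gcomp A b" shows "z \<otimes>\<^bsub>A\<^esub> w \<in> gcomp A (a + b)"
proof -
  obtain u v where uv: "u \<in> mpow a" "v \<in> mpow b" "\<And>k. A_rep z k (if k = a then u else \<zero>)"
    "\<And>k. A_rep w k (if k = b then v else \<zero>)" using assms by (auto simp: A_gcomp_rep)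
  have c: "u \<in> carrier R" "v \<in> carrier R" using uv mpow_carr by auto
  have "A_rep (z \<otimes>\<^bsub>A\<^esub> w) k (if k = a + b then u \<otimes> v else \<zero>)" for k
  proof (cases "k < b")
    case True
    then show ?thesis using A_rep_mult(2)[OF uv(3) uv(4)] by auto
  next
    case False
    then have "k = (k - b) + b" by simp
    then show ?thesis using A_rep_mult(1)[OF uv(3)[of "k - b"] uv(4)] c by (auto split: if_splits)
  qed
  then show ?thesis unfolding A_gcomp_rep using mpow_mult[OF uv(1,2)] by blast
qed

lemma irrelevant_ideal_ideal: "ideal (irrelevant_ideal A) A"
proof -
  interpret A: cring A by (rule A_cring)
  show ?thesis unfolding irrelevant_ideal_def
    by (rule A.genideal_ideal) (use A_gcomp_carrier in auto)
qed

lemma gcomp_irrelevant: "n \<ge> 1 \<Longrightarrow> gcomp A n \<subseteq> irrelevant_ideal A"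
proof -
  interpret A: cring A by (rule A_cring)
  assume "n \<ge> 1"
  moreover have "(\<Union>n\<in>{1..}. gcomp A n) \<subseteq> irrelevant_ideal A"
    unfolding irrelevant_ideal_def by (rule A.genideal_self) (use A_gcomp_carrier in auto)
  ultimately show ?thesis by auto
qed

text \<open>Neither factor is homogeneous here, but in degree zero the Cauchy product consists of
  one term, a product whose second factor lies in \<open>m\<close>.\<close>

lemma A_rep_mult_0:
  assumes z: "z \<in> carrier A" and w: "A_rep w 0 \<zero>"
  shows "A_rep (z \<otimes>\<^bsub>A\<^esub> w) 0 \<zero>"
proof -
  interpret A: cring A by (rule A_cring)
  interpret S: module R "self_module R" by (rule selfm)
  have wc: "w \<in> carrier A" using w A_rep_carr by blast
  obtain a b where ab: "a \<in> R_seq" "b \<in> R_seq" "z = R_of a" "w = R_of b"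
    using z wc A_carrier by auto
  note ac = R_seqD[OF ab(1)] and bc = R_seqD[OF ab(2)]
  have rep: "A_rep (R_of s) 0 (s 0)" if s: "s \<in> R_seq" for s
    using s R_seqD[OF s] by (auto simp: gr_rep_def gr_carrier[OF selfm] gr_of_def)
  have "b 0 \<ominus> \<zero> \<in> mpow (Suc 0)"
    using gr_rep_eq_self[OF rep[OF ab(2)], of \<zero>] w ab(4) by simp
  then have b0: "b 0 \<in> mpow (Suc 0)" using bc(2)[of 0] by (simp add: a_minus_def)
  have "cauchy (self_module R) a b 0 = a 0 \<otimes> b 0"
    using ac(2)[of 0] bc(2)[of 0] by (simp add: cauchy_def self_module_simps)
  then have "A_rep (z \<otimes>\<^bsub>A\<^esub> w) 0 (a 0 \<otimes> b 0)"
    using rep[OF cauchy_closed[OF selfm ab(1,2)]] by (simp add: ab A_mult)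
  moreover have "a 0 \<otimes> b 0 \<in> mpow (Suc 0)"
    using mpow_mult[OF ac(1)[of 0] b0] by simp
  ultimately show ?thesis
    using gr_rep_eq_self[of "z \<otimes>\<^bsub>A\<^esub> w" 0 "a 0 \<otimes> b 0" \<zero>] ac(2) bc(2) by (simp add: a_minus_def)
qed

text \<open>The elements without component in degree zero form an ideal that contains all generators
  of the irrelevant ideal.\<close>

lemma irrelevant_rep:
  assumes "z \<in> irrelevant_ideal A" shows "A_rep z 0 \<zero>"
proof -
  interpret A: cring A by (rule A_cring)
  let ?I = "{z. A_rep z 0 \<zero>}"
  have "ideal ?I A"
  proof (rule idealI[OF A.ring_axioms])
    show "subgroup ?I (add_monoid A)"
    proof (rule A.add.subgroupI)
      show "?I \<noteq> {}" using A_rep_zero by blast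
      show "?I \<subseteq> carrier A" using A_rep_carr(3) by blast
      fix z assume z: "z \<in> ?I"
      then have zc: "z \<in> carrier A" using A_rep_carr(3) by blast
      \<comment> \<open>Negation is multiplication by minus one, so closure under it follows from
        absorption.\<close>
      have "A_rep ((\<ominus>\<^bsub>A\<^esub> \<one>\<^bsub>A\<^esub>) \<otimes>\<^bsub>A\<^esub> z) 0 \<zero>" using z by (intro A_rep_mult_0) auto
      then show "\<ominus>\<^bsub>A\<^esub> z \<in> ?I" using zc by (simp add: A.l_minus)
      fix w assume "w \<in> ?I"
      then show "z \<oplus>\<^bsub>A\<^esub> w \<in> ?I" using A_rep_add[of z 0 \<zero> w \<zero>] z by simp
    qed
    fix z w assume z: "z \<in> ?I" and w: "w \<in> carrier A"
    then show "w \<otimes>\<^bsub>A\<^esub> z \<in> ?I" by (simp add: A_rep_mult_0)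
    then show "z \<otimes>\<^bsub>A\<^esub> w \<in> ?I" using z w A_rep_carr(3) by (auto simp: A.m_comm[of z w])
  qed
  moreover have "(\<Union>n\<in>{1..}. gcomp A n) \<subseteq> ?I"
  proof
    fix z assume "z \<in> (\<Union>n\<in>{1..}. gcomp A n)"
    then obtain n u where "n \<ge> 1" "\<forall>k. A_rep z k (if k = n then u else \<zero>)"
      by (auto simp: A_gcomp_rep)
    then show "z \<in> ?I" by (auto dest: spec[of _ 0])
  qed
  ultimately have "irrelevant_ideal A \<subseteq> ?I"
    unfolding irrelevant_ideal_def by (rule A.genideal_minimal)
  then show ?thesis using assms by blast
qed

text \<open>All coordinates are read in the same degree, that is, without twists. The twists of a
  pure resolution amount to one shift per stage and enter through the parameter \<open>a\<close> of
  \<open>lifts\<close>.\<close>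

definition free_rep where
  "free_rep r v n x \<longleftrightarrow> v \<in> carrier (free_module A r) \<and> x \<in> Mp (free_module R r) n \<and>
    (\<forall>t<r. A_rep (v t) n (x t))"

lemma Mp_free_carr: "x \<in> Mp (free_module R r) n \<Longrightarrow> x \<in> carrier (free_module R r)"
  by (rule Mp_carr[OF free_module_is_module])

lemma free_repI:
  assumes v: "v \<in> carrier (free_module A r)" and x: "x \<in> carrier (free_module R r)"
    and "\<And>t. t < r \<Longrightarrow> A_rep (v t) n (x t)"
  shows "free_rep r v n x"
proof -
  have "x \<in> Mp (free_module R r) n"
    using x assms(3) A_rep_carr(1) unfolding Mp_free free_module_simps by (auto simp: PiE_iff)
  then show ?thesis using assms by (simp add: free_rep_def)
qed

end

text \<open>
  A module \<open>N\<close> together with a graded module \<open>L\<close> that is its associated graded module: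
  \<open>C g n x\<close> means that \<open>x \<in> m\<^sup>n N\<close> represents the component of degree \<open>n\<close> of \<open>g\<close>.
\<close>

locale graded_pair = noetherian_local_adic R m for R (structure) and m +
  fixes N :: "('a, 'c, 'd) module_scheme" and L :: "(nat \<Rightarrow> 'a set, 'e, 'f) module_scheme"
    and C :: "'e \<Rightarrow> nat \<Rightarrow> 'c \<Rightarrow> bool"
  assumes N_noetherian: "noetherian_module R N" and L_module: "module A L"
    and C_exists: "g \<in> carrier L \<Longrightarrow> \<exists>x. C g n x"
    and C_carr: "C g n x \<Longrightarrow> x \<in> Mp N n"
    and C_add: "C g n x \<Longrightarrow> C h n y \<Longrightarrow> C (g \<oplus>\<^bsub>L\<^esub> h) n (x \<oplus>\<^bsub>N\<^esub> y)"
    and C_zero: "C \<zero>\<^bsub>L\<^esub> n \<zero>\<^bsub>N\<^esub>"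
    and C_eq: "C g n x \<Longrightarrow> y \<in> carrier N \<Longrightarrow> C g n y \<longleftrightarrow> x \<ominus>\<^bsub>N\<^esub> y \<in> Mp N (Suc n)"
    and C_ext: "g \<in> carrier L \<Longrightarrow> h \<in> carrier L \<Longrightarrow> (\<And>n. \<exists>x. C g n x \<and> C h n x) \<Longrightarrow> g = h"
    and C_homog: "y \<in> Mp N a \<Longrightarrow> \<exists>g\<in>carrier L. \<forall>k. C g k (if k = a then y else \<zero>\<^bsub>N\<^esub>)"
    and C_smult: "A_rep z n b \<Longrightarrow> g \<in> carrier L \<Longrightarrow> (\<And>k. C g k (if k = a then u else \<zero>\<^bsub>N\<^esub>)) \<Longrightarrow>
      C (z \<odot>\<^bsub>L\<^esub> g) (n + a) (b \<odot>\<^bsub>N\<^esub> u)"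
    and C_smult_0: "z \<in> carrier A \<Longrightarrow> g \<in> carrier L \<Longrightarrow> (\<And>k. C g k (if k = a then u else \<zero>\<^bsub>N\<^esub>)) \<Longrightarrow>
      c < a \<Longrightarrow> C (z \<odot>\<^bsub>L\<^esub> g) c \<zero>\<^bsub>N\<^esub>"

context noetherian_local_adic
begin

text \<open>The degree zero component of \<open>1\<close> is its residue class modulo
  \<open>m\<close>, which is not zero. It is due to this that a basis vector in a minimal resolution
  over \<open>A\<close> is never a boundary.\<close>

lemma one_notin_irrelevant: "\<one>\<^bsub>A\<^esub> \<notin> irrelevant_ideal A"
proof
  assume "\<one>\<^bsub>A\<^esub> \<in> irrelevant_ideal A"
  then have 1: "A_rep \<one>\<^bsub>A\<^esub> 0 \<zero>" by (rule irrelevant_rep)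
  have "\<forall>k. A_rep \<one>\<^bsub>A\<^esub> k (if k = 0 then \<one> else \<zero>)"
    using gr_rep_homog[OF selfm, of \<one> 0 "\<one>\<^bsub>A\<^esub>"] by (simp add: A_one self_module_simps cong: if_cong)
  from spec[OF this, of 0] have "A_rep \<one>\<^bsub>A\<^esub> 0 \<one>" by simp
  then have "\<one> \<ominus> \<zero> \<in> m" using gr_rep_eq_self[of "\<one>\<^bsub>A\<^esub>" 0 \<one> \<zero>] 1 by simp
  then show False using one_notin by (simp add: a_minus_def)
qed

lemma gr_graded_pair:
  assumes N: "noetherian_module R N" and L: "module A (gr N)"
  shows "graded_pair R m N (gr N) (gr_rep N)"
proof -
  have Nm: "module R N" using N by (simp add: noetherian_module_def)
  show ?thesis
  proof (rule graded_pair.intro[OF noetherian_local_adic_axioms graded_pair_axioms.intro[OF N L]])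
    show "g \<in> carrier (gr N) \<Longrightarrow> \<exists>x. gr_rep N g n x" for g n by (rule gr_rep_exists[OF Nm])
    show "gr_rep N g n x \<Longrightarrow> x \<in> Mp N n" for g n x by (rule gr_rep_carr[OF Nm])
    show "gr_rep N g n x \<Longrightarrow> gr_rep N h n y \<Longrightarrow> gr_rep N (g \<oplus>\<^bsub>gr N\<^esub> h) n (x \<oplus>\<^bsub>N\<^esub> y)" for g h n x y
      by (rule gr_rep_add[OF Nm])
    show "gr_rep N \<zero>\<^bsub>gr N\<^esub> n \<zero>\<^bsub>N\<^esub>" for n by (rule gr_rep_zero[OF Nm])
    show "gr_rep N g n x \<Longrightarrow> y \<in> carrier N \<Longrightarrow> gr_rep N g n y = (x \<ominus>\<^bsub>N\<^esub> y \<in> Mp N (Suc n))" for g n x y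
      by (rule gr_rep_eq[OF Nm])
    show "(\<And>n. \<exists>x. gr_rep N g n x \<and> gr_rep N h n x) \<Longrightarrow> g = h" for g h by (rule gr_rep_ext[OF Nm])
    show "y \<in> Mp N a \<Longrightarrow> \<exists>g\<in>carrier (gr N). \<forall>k. gr_rep N g k (if k = a then y else \<zero>\<^bsub>N\<^esub>)" for y a
    proof -
      assume y: "y \<in> Mp N a"
      then have *: "\<forall>k. gr_rep N (gr_of N (\<lambda>k. if k = a then y else \<zero>\<^bsub>N\<^esub>)) k (if k = a then y else \<zero>\<^bsub>N\<^esub>)"
        using gr_rep_homog[OF Nm, of y a] by blast
      moreover have "gr_of N (\<lambda>k. if k = a then y else \<zero>\<^bsub>N\<^esub>) \<in> carrier (gr N)"
        using *[rule_format, of a] unfolding gr_rep_def by (rule conjunct1)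
      ultimately show ?thesis by (rule bexI)
    qed
    show "A_rep z n x \<Longrightarrow> (\<And>k. gr_rep N g k (if k = a then u else \<zero>\<^bsub>N\<^esub>)) \<Longrightarrow>
      gr_rep N (z \<odot>\<^bsub>gr N\<^esub> g) (n + a) (x \<odot>\<^bsub>N\<^esub> u)" for z n x g a u by (rule gr_rep_smult(1)[OF Nm])
    show "z \<in> carrier A \<Longrightarrow> (\<And>k. gr_rep N g k (if k = a then u else \<zero>\<^bsub>N\<^esub>)) \<Longrightarrow>
      c < a \<Longrightarrow> gr_rep N (z \<odot>\<^bsub>gr N\<^esub> g) c \<zero>\<^bsub>N\<^esub>" for z g a u c
    proof -
      assume z: "z \<in> carrier A" and *: "\<And>k. gr_rep N g k (if k = a then u else \<zero>\<^bsub>N\<^esub>)" "c < a"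
      obtain x where "A_rep z 0 x" using A_rep_exists[OF z] by (rule exE)
      then show ?thesis by (rule gr_rep_smult(2)[OF Nm _ *])
    qed
  qed
qed

text \<open>This instance covers the stages of the resolution, as \<open>gr_graded_pair\<close>
  covers the module resolved; one and the same lifting step then serves every differential.
  Everything is checked coordinatewise.\<close>

lemma free_graded_pair: "graded_pair R m (free_module R r) (free_module A r) (free_rep r)"
proof -
  let ?F = "free_module R r" and ?G = "free_module A r"
  interpret A: cring A by (rule A_cring)
  interpret F: module R ?F by (rule free_module_is_module)
  interpret G: module A ?G by (rule A.free_module_is_module)
  have rc: "free_rep r g n x \<Longrightarrow> g \<in> carrier ?G" "free_rep r g n x \<Longrightarrow> x \<in> carrier ?F" for g n x
    using Mp_free_carr by (auto simp: free_rep_def)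
  have rt: "free_rep r g n x \<Longrightarrow> t < r \<Longrightarrow> A_rep (g t) n (x t)" for g n x t
    by (simp add: free_rep_def)
  have rt': "A_rep (g t) k (if k = a then u t else \<zero>)"
    if "\<And>k. free_rep r g k (if k = a then u else \<zero>\<^bsub>?F\<^esub>)" "t < r" for g k a u t
    using rt[OF that(1)[of k] that(2)] that(2) by (auto split: if_splits)
  show ?thesis
  proof (rule graded_pair.intro[OF noetherian_local_adic_axioms graded_pair_axioms.intro[OF noetherian_free_module[OF is_cring noetherian_ring_axioms] G.module_axioms]])
    fix g n assume g: "g \<in> carrier ?G"
    have "\<exists>x. A_rep (g t) n x" if "t < r" for t
      using A_rep_exists[OF free_module_coord_closed[OF g that]] .
    then obtain x where x: "\<And>t. t < r \<Longrightarrow> A_rep (g t) n (x t)" by metis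
    have "(\<lambda>t\<in>{..<r}. x t) \<in> carrier ?F" using x A_rep_carr(2) by (auto simp: free_module_simps)
    then have "free_rep r g n (\<lambda>t\<in>{..<r}. x t)" using g x by (intro free_repI) auto
    then show "\<exists>x. free_rep r g n x" by blast
  next
    show "free_rep r g n x \<Longrightarrow> x \<in> Mp ?F n" for g n x by (simp add: free_rep_def)
  next
    fix g h n x y assume gh: "free_rep r g n x" "free_rep r h n y"
    show "free_rep r (g \<oplus>\<^bsub>?G\<^esub> h) n (x \<oplus>\<^bsub>?F\<^esub> y)"
      by (rule free_repI) (use gh rc rt A_rep_add in auto)
  next
    show "free_rep r \<zero>\<^bsub>?G\<^esub> n \<zero>\<^bsub>?F\<^esub>" for n
      by (rule free_repI) (use A_rep_zero in auto)
  next
    fix g n x y assume gx: "free_rep r g n x" and y: "y \<in> carrier ?F"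
    have "free_rep r g n y \<longleftrightarrow> (\<forall>t<r. A_rep (g t) n (y t))"
      using free_repI[OF rc(1)[OF gx] y] rt by blast
    also have "\<dots> \<longleftrightarrow> (\<forall>t<r. x t \<ominus> y t \<in> mpow (Suc n))"
      using gr_rep_eq_self[OF rt[OF gx]] free_module_coord_closed[OF y] by blast
    also have "\<dots> \<longleftrightarrow> x \<ominus>\<^bsub>?F\<^esub> y \<in> Mp ?F (Suc n)"
    proof -
      have d: "x \<ominus>\<^bsub>?F\<^esub> y \<in> carrier ?F" using rc(2)[OF gx] y by simp
      have "x \<ominus>\<^bsub>?F\<^esub> y \<in> Mp ?F (Suc n) \<longleftrightarrow> (\<forall>t<r. (x \<ominus>\<^bsub>?F\<^esub> y) t \<in> mpow (Suc n))"
        using d unfolding Mp_free free_module_simps by (auto simp: PiE_iff)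
      then show ?thesis using rc(2)[OF gx] y by simp
    qed
    finally show "free_rep r g n y = (x \<ominus>\<^bsub>?F\<^esub> y \<in> Mp ?F (Suc n))" .
  next
    fix g h assume gh: "g \<in> carrier ?G" "h \<in> carrier ?G" "\<And>n. \<exists>x. free_rep r g n x \<and> free_rep r h n x"
    show "g = h"
    proof (rule free_module_eqI[OF gh(1,2)])
      fix t assume "t < r"
      then have "\<exists>x. A_rep (g t) n x \<and> A_rep (h t) n x" for n using gh(3)[of n] rt by blast
      then show "g t = h t" by (rule gr_rep_ext[OF selfm])
    qed
  next
    fix y a assume y: "y \<in> Mp ?F a"
    have "\<exists>z\<in>carrier A. \<forall>k. A_rep z k (if k = a then y t else \<zero>)" if "t < r" for t
      by (rule A_rep_homog_exists[OF Mp_free_coord[OF y that]])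
    then obtain z where z: "\<And>t. t < r \<Longrightarrow> z t \<in> carrier A"
      "\<And>t k. t < r \<Longrightarrow> A_rep (z t) k (if k = a then y t else \<zero>)" by metis
    have zc: "(\<lambda>t\<in>{..<r}. z t) \<in> carrier ?G" using z(1) by (auto simp: free_module_simps)
    have "free_rep r (\<lambda>t\<in>{..<r}. z t) k (if k = a then y else \<zero>\<^bsub>?F\<^esub>)" for k
      using z(2)[of _ k] Mp_free_carr[OF y] by (intro free_repI zc) (auto split: if_splits)
    then show "\<exists>g\<in>carrier ?G. \<forall>k. free_rep r g k (if k = a then y else \<zero>\<^bsub>?F\<^esub>)" using zc by blast
  next
    fix z n x g a u
    assume z: "A_rep z n x" and g: "g \<in> carrier ?G" "\<And>k. free_rep r g k (if k = a then u else \<zero>\<^bsub>?F\<^esub>)"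
    have u: "u \<in> carrier ?F" using rc(2)[OF g(2)[of a]] by simp
    show "free_rep r (z \<odot>\<^bsub>?G\<^esub> g) (n + a) (x \<odot>\<^bsub>?F\<^esub> u)"
      by (rule free_repI) (use A_rep_mult(1)[OF z rt'[OF g(2)]] A_rep_carr[OF z] g(1) u in auto)
  next
    fix z g a u c
    assume z: "z \<in> carrier A" and g: "g \<in> carrier ?G" "\<And>k. free_rep r g k (if k = a then u else \<zero>\<^bsub>?F\<^esub>)" "c < a"
    obtain x where x: "A_rep z 0 x" using A_rep_exists[OF z] by blast
    show "free_rep r (z \<odot>\<^bsub>?G\<^esub> g) c \<zero>\<^bsub>?F\<^esub>"
      by (rule free_repI) (use A_rep_mult(2)[OF x rt'[OF g(2)] g(3)] z g(1) in auto)
  qed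
qed

end

section \<open>Lifting graded presentations\<close>

context graded_pair
begin

lemma N_module: "module R N"
  using N_noetherian by (simp add: noetherian_module_def)

lemma C_closed: "C g n x \<Longrightarrow> x \<in> carrier N"
  using C_carr Mp_carr[OF N_module] by blast

lemma C_finsum:
  assumes "finite T" "\<And>t. t \<in> T \<Longrightarrow> C (g t) n (x t)" "\<And>t. t \<in> T \<Longrightarrow> g t \<in> carrier L"
  shows "C (finsum L g T) n (finsum N x T)"
  using assms
proof (induct T)
  case empty
  interpret N: module R N by (rule N_module)
  interpret L: module A L by (rule L_module)
  show ?case using C_zero by simp
next
  case (insert t T)
  interpret N: module R N by (rule N_module)
  interpret L: module A L by (rule L_module)
  have "x t \<in> carrier N" "x \<in> T \<rightarrow> carrier N" using insert C_closed by blast+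
  moreover have "g t \<in> carrier L" "g \<in> T \<rightarrow> carrier L" using insert by blast+
  ultimately show ?case using insert C_add by simp
qed

text \<open>\<open>\<psi>\<close> is homogeneous of degree \<open>a\<close> for the untwisted
  grading of its source, and its columns are the leading forms of the columns of
  \<open>\<Phi>\<close>.\<close>

definition lifts where
  "lifts s \<psi> \<Phi> a \<longleftrightarrow> \<psi> \<in> module_hom A (free_module A s) L \<and> \<Phi> \<in> module_hom R (free_module R s) N \<and>
    (\<forall>t<s. \<Phi> (basis_vec R s t) \<in> Mp N a \<and>
      (\<forall>k. C (\<psi> (basis_vec A s t)) k (if k = a then \<Phi> (basis_vec R s t) else \<zero>\<^bsub>N\<^esub>)))"

lemma liftsD:
  assumes "lifts s \<psi> \<Phi> a"
  shows "\<psi> \<in> module_hom A (free_module A s) L" "\<Phi> \<in> module_hom R (free_module R s) N"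
    and "t < s \<Longrightarrow> \<Phi> (basis_vec R s t) \<in> Mp N a"
    and "t < s \<Longrightarrow> C (\<psi> (basis_vec A s t)) k (if k = a then \<Phi> (basis_vec R s t) else \<zero>\<^bsub>N\<^esub>)"
  using assms unfolding lifts_def by auto

text \<open>Taking representatives commutes with the two maps up to the shift by \<open>a\<close>:
  both sides are expanded in the basis and compared term by term.\<close>

lemma lifts_rep:
  assumes l: "lifts s \<psi> \<Phi> a" and z: "free_rep s z n x"
  shows "C (\<psi> z) (n + a) (\<Phi> x)"
proof -
  interpret A: cring A by (rule A_cring)
  note b = module_homD(1)[OF liftsD(1)[OF l] A.basis_vec_closed]
  have zc: "z \<in> carrier (free_module A s)" "x \<in> carrier (free_module R s)"
    using z Mp_free_carr by (auto simp: free_rep_def)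
  show ?thesis
    unfolding module_hom_free_expand[OF L_module liftsD(1)[OF l] zc(1)]
      module_hom_free_expand[OF N_module liftsD(2)[OF l] zc(2)]
  proof (rule C_finsum)
    fix t assume "t \<in> {..<s}"
    then have t: "t < s" by simp
    have "A_rep (z t) n (x t)" using z t by (simp add: free_rep_def)
    then show "C (z t \<odot>\<^bsub>L\<^esub> \<psi> (basis_vec A s t)) (n + a) (x t \<odot>\<^bsub>N\<^esub> \<Phi> (basis_vec R s t))"
      by (rule C_smult[OF _ b liftsD(4)[OF l t]])
    show "z t \<odot>\<^bsub>L\<^esub> \<psi> (basis_vec A s t) \<in> carrier L"
      by (rule module.smult_closed[OF L_module free_module_coord_closed[OF zc(1) t] b])
  qed simp
qed

lemma lifts_rep_0:
  assumes l: "lifts s \<psi> \<Phi> a" and z: "z \<in> carrier (free_module A s)" and c: "c < a"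
  shows "C (\<psi> z) c \<zero>\<^bsub>N\<^esub>"
proof -
  interpret A: cring A by (rule A_cring)
  interpret N: module R N by (rule N_module)
  note b = module_homD(1)[OF liftsD(1)[OF l] A.basis_vec_closed]
  have "C (finsum L (\<lambda>t. z t \<odot>\<^bsub>L\<^esub> \<psi> (basis_vec A s t)) {..<s}) c (finsum N (\<lambda>t. \<zero>\<^bsub>N\<^esub>) {..<s})"
  proof (rule C_finsum)
    fix t assume "t \<in> {..<s}"
    then have t: "t < s" by simp
    note zt = free_module_coord_closed[OF z t]
    show "C (z t \<odot>\<^bsub>L\<^esub> \<psi> (basis_vec A s t)) c \<zero>\<^bsub>N\<^esub>"
      by (rule C_smult_0[OF zt b liftsD(4)[OF l t] c])
    show "z t \<odot>\<^bsub>L\<^esub> \<psi> (basis_vec A s t) \<in> carrier L"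
      by (rule module.smult_closed[OF L_module zt b])
  qed simp
  then show ?thesis unfolding module_hom_free_expand[OF L_module liftsD(1)[OF l] z] by simp
qed

lemma C_zero_iff: "C g n x \<Longrightarrow> C g n \<zero>\<^bsub>N\<^esub> \<longleftrightarrow> x \<in> Mp N (Suc n)"
proof -
  interpret N: module R N by (rule N_module)
  assume "C g n x"
  then show ?thesis using C_eq[of g n x "\<zero>\<^bsub>N\<^esub>"] C_closed by (simp add: a_minus_def)
qed

lemma lifts_homog:
  assumes l: "lifts s \<psi> \<Phi> a" and z: "\<And>k. free_rep s z k (if k = b then x else \<zero>\<^bsub>free_module R s\<^esub>)"
  shows "C (\<psi> z) k (if k = b + a then \<Phi> x else \<zero>\<^bsub>N\<^esub>)"
proof (cases "k < a")
  case True
  then show ?thesis using lifts_rep_0[OF l _ True, of z] z[of 0] by (auto simp: free_rep_def)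
next
  case False
  then have "k = (k - a) + a" by simp
  then have "C (\<psi> z) k (\<Phi> (if k - a = b then x else \<zero>\<^bsub>free_module R s\<^esub>))"
    using lifts_rep[OF l z, of "k - a"] by simp
  then show ?thesis
    using False module_hom_zero[OF free_module_is_module N_module liftsD(2)[OF l]]
    by (auto split: if_splits)
qed

text \<open>Hypothesis \<open>sym\<close> matches only the leading form of an element of
  \<open>K\<close>. Subtracting the corresponding image raises the order by one and stays in
  \<open>K\<close>, so the correction can be repeated. All corrections lie in the image of m^(c-a)
  F, and it is to this submodule that Krull's theorem is applied.\<close>

lemma lifts_strict:
  assumes l: "lifts s \<psi> \<Phi> a"
    and K: "submodule K R N" and im: "\<Phi> ` carrier (free_module R s) \<subseteq> K"
    and sym: "\<And>c y. y \<in> K \<Longrightarrow> y \<in> Mp N c \<Longrightarrow>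
      \<exists>z\<in>carrier (free_module A s). \<forall>k. C (\<psi> z) k (if k = c then y else \<zero>\<^bsub>N\<^esub>)"
    and y: "y \<in> K" "y \<in> Mp N c"
  shows "y \<in> \<Phi> ` Mp (free_module R s) (c - a)"
proof -
  let ?F = "free_module R s"
  interpret N: module R N by (rule N_module)
  interpret F: module R ?F by (rule free_module_is_module)
  interpret A: cring A by (rule A_cring)
  interpret FA: graded_pair R m ?F "free_module A s" "free_rep s" by (rule free_graded_pair)
  note Kr = submodule_rules[OF N_module K]
  note h = liftsD(2)[OF l]
  note Fm = free_module_is_module
  have one: "\<exists>x\<in>Mp ?F (c - a). y \<ominus>\<^bsub>N\<^esub> \<Phi> x \<in> K \<and> y \<ominus>\<^bsub>N\<^esub> \<Phi> x \<in> Mp N (Suc c)"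
    if y: "y \<in> K" "y \<in> Mp N c" for y c
  proof -
    have yc: "y \<in> carrier N" using y Kr(1) by blast
    obtain z where z: "z \<in> carrier (free_module A s)" "\<And>k. C (\<psi> z) k (if k = c then y else \<zero>\<^bsub>N\<^esub>)"
      using sym[OF y] by blast
    have zy: "C (\<psi> z) c y" using z(2)[of c] by simp
    show ?thesis
    proof (cases "c < a")
      case True
      \<comment> \<open>Below degree \<open>a\<close> the values of \<open>\<psi>\<close> have no
        components, so \<open>y\<close> already has order higher than \<open>c\<close> and the zero
        correction suffices.\<close>
      have "y \<in> Mp N (Suc c)"
        using C_zero_iff[OF zy] lifts_rep_0[OF l z(1) True] by simp
      then show ?thesis using y(1) yc Mp_rules(2)[OF Fm] module_hom_zero[OF Fm N_module h]
        by (intro bexI[of _ "\<zero>\<^bsub>?F\<^esub>"]) (auto simp: a_minus_def)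
    next
      case False
      obtain x where x: "free_rep s z (c - a) x" using FA.C_exists[OF z(1)] by blast
      then have "C (\<psi> z) c (\<Phi> x)" using lifts_rep[OF l x] False by simp
      then have d: "y \<ominus>\<^bsub>N\<^esub> \<Phi> x \<in> Mp N (Suc c)" using C_eq[OF zy] C_closed by blast
      have xm: "x \<in> Mp ?F (c - a)" using x by (simp add: free_rep_def)
      then have "\<Phi> x \<in> K" using im Mp_free_carr by blast
      then have "y \<ominus>\<^bsub>N\<^esub> \<Phi> x \<in> K" by (rule Kr(5)[OF y(1)])
      then show ?thesis using xm d by blast
    qed
  qed
  have many: "\<exists>x\<in>Mp ?F (c - a). y \<ominus>\<^bsub>N\<^esub> \<Phi> x \<in> K \<and> y \<ominus>\<^bsub>N\<^esub> \<Phi> x \<in> Mp N (c + n)" for n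
  proof (induct n)
    case 0
    have "y \<in> carrier N" using y Kr(1) by blast
    then show ?case using y Mp_rules(2)[OF Fm] module_hom_zero[OF Fm N_module h]
        by (intro bexI[of _ "\<zero>\<^bsub>?F\<^esub>"]) (auto simp: a_minus_def)
  next
    case (Suc n)
    then obtain x where x: "x \<in> Mp ?F (c - a)" "y \<ominus>\<^bsub>N\<^esub> \<Phi> x \<in> K" "y \<ominus>\<^bsub>N\<^esub> \<Phi> x \<in> Mp N (c + n)" by blast
    obtain w where w: "w \<in> Mp ?F (c + n - a)" "(y \<ominus>\<^bsub>N\<^esub> \<Phi> x) \<ominus>\<^bsub>N\<^esub> \<Phi> w \<in> K"
      "(y \<ominus>\<^bsub>N\<^esub> \<Phi> x) \<ominus>\<^bsub>N\<^esub> \<Phi> w \<in> Mp N (Suc (c + n))" using one[OF x(2,3)] by blast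
    have "w \<in> Mp ?F (c - a)" by (rule subsetD[OF Mp_antimono[OF Fm] w(1)]) simp
    then have xw: "x \<oplus>\<^bsub>?F\<^esub> w \<in> Mp ?F (c - a)" by (rule Mp_rules(3)[OF Fm x(1)])
    have xwc: "x \<in> carrier ?F" "w \<in> carrier ?F" using x(1) w(1) Mp_free_carr by auto
    have yc: "y \<in> carrier N" using y Kr(1) by blast
    have "y \<ominus>\<^bsub>N\<^esub> \<Phi> (x \<oplus>\<^bsub>?F\<^esub> w) = (y \<ominus>\<^bsub>N\<^esub> \<Phi> x) \<ominus>\<^bsub>N\<^esub> \<Phi> w"
      using xwc yc module_homD(1,2)[OF h] by (simp add: a_minus_def N.minus_add N.a_assoc)
    then show ?case using w(2,3) by (intro bexI[OF _ xw]) simp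
  qed
  define K' where "K' = \<Phi> ` Mp ?F (c - a)"
  have K': "submodule K' R N"
    unfolding K'_def by (rule submodule_image[OF Fm N_module h Mp_submodule[OF Fm]])
  have "\<exists>k\<in>K'. y \<ominus>\<^bsub>N\<^esub> k \<in> Mp N n" for n
  proof -
    obtain x where x: "x \<in> Mp ?F (c - a)" "y \<ominus>\<^bsub>N\<^esub> \<Phi> x \<in> Mp N (c + n)" using many[of n] by blast
    have "y \<ominus>\<^bsub>N\<^esub> \<Phi> x \<in> Mp N n" using x(2) Mp_antimono[OF N_module, of n "c + n"] by auto
    then show ?thesis using x(1) unfolding K'_def by blast
  qed
  then have "y \<in> K'"
    using Krull_intersection[OF N_noetherian K'] y(1) Kr(1) by blast
  then show ?thesis unfolding K'_def .
qed

text \<open>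
  Next stage of the lifting: a column of \<open>\<psi>2\<close> lifts to some \<open>x\<close> with \<open>\<Phi> x\<close> of too high order, hence
  \<open>\<Phi> x = \<Phi> w\<close> with \<open>w\<close> of higher order than \<open>x\<close>, and \<open>x - w\<close> is the lift we want.
\<close>

lemma lift_step:
  assumes l: "lifts s \<psi> \<Phi> a"
    and strict: "\<And>c y. y \<in> \<Phi> ` carrier (free_module R s) \<Longrightarrow> y \<in> Mp N c \<Longrightarrow> y \<in> \<Phi> ` Mp (free_module R s) (c - a)"
    and \<psi>2: "\<psi>2 \<in> module_hom A (free_module A s2) (free_module A s)"
    and ex: "\<psi>2 ` carrier (free_module A s2) = {z \<in> carrier (free_module A s). \<psi> z = \<zero>\<^bsub>L\<^esub>}"
    and col: "\<And>t. t < s2 \<Longrightarrow> \<exists>x\<in>Mp (free_module R s) b.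
      \<forall>k. free_rep s (\<psi>2 (basis_vec A s2 t)) k (if k = b then x else \<zero>\<^bsub>free_module R s\<^esub>)"
  shows "\<exists>\<Phi>2. graded_pair.lifts R m (free_module R s) (free_module A s) (free_rep s) s2 \<psi>2 \<Phi>2 b \<and>
    \<Phi>2 ` carrier (free_module R s2) = {x \<in> carrier (free_module R s). \<Phi> x = \<zero>\<^bsub>N\<^esub>} \<and>
    (\<forall>c y. y \<in> \<Phi>2 ` carrier (free_module R s2) \<longrightarrow> y \<in> Mp (free_module R s) c \<longrightarrow>
       y \<in> \<Phi>2 ` Mp (free_module R s2) (c - b))"
proof -
  let ?F = "free_module R s"
  interpret N: module R N by (rule N_module)
  interpret F: module R ?F by (rule free_module_is_module)
  interpret A: cring A by (rule A_cring)
  interpret FA: graded_pair R m ?F "free_module A s" "free_rep s" by (rule free_graded_pair)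
  note Fm = free_module_is_module
  note h = liftsD(2)[OF l]
  have im: "\<psi>2 z \<in> carrier (free_module A s)" "\<psi> (\<psi>2 z) = \<zero>\<^bsub>L\<^esub>" if "z \<in> carrier (free_module A s2)" for z
    using ex that by blast+
  have "\<exists>y. y \<in> Mp ?F b \<and> \<Phi> y = \<zero>\<^bsub>N\<^esub> \<and>
      (\<forall>k. free_rep s (\<psi>2 (basis_vec A s2 t)) k (if k = b then y else \<zero>\<^bsub>?F\<^esub>))" if t: "t < s2" for t
  proof -
    obtain x where x: "x \<in> Mp ?F b"
      "\<And>k. free_rep s (\<psi>2 (basis_vec A s2 t)) k (if k = b then x else \<zero>\<^bsub>?F\<^esub>)" using col[OF t] by blast
    have xc: "x \<in> carrier ?F" using x Mp_free_carr by blast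
    have xb: "free_rep s (\<psi>2 (basis_vec A s2 t)) b x" using x(2)[of b] by simp
    have "C \<zero>\<^bsub>L\<^esub> (b + a) (\<Phi> x)" using lifts_rep[OF l xb] im(2)[OF A.basis_vec_closed] by simp
    then have "\<Phi> x \<in> Mp N (Suc (b + a))" using C_zero_iff C_zero by blast
    then have "\<Phi> x \<in> \<Phi> ` Mp ?F (Suc (b + a) - a)" using xc by (intro strict) auto
    then obtain w where w: "w \<in> Mp ?F (Suc b)" "\<Phi> x = \<Phi> w" by auto
    have wc: "w \<in> carrier ?F" "w \<in> Mp ?F b"
      using w(1) Mp_free_carr subsetD[OF Mp_antimono[OF Fm] w(1), of b] by auto
    define y where "y = x \<ominus>\<^bsub>?F\<^esub> w"
    have yb: "y \<in> Mp ?F b" unfolding y_def by (rule Mp_rules(5)[OF Fm x(1) wc(2)])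
    then have yc: "y \<in> carrier ?F" using Mp_free_carr by blast
    have "\<Phi> y = \<zero>\<^bsub>N\<^esub>"
      unfolding y_def using module_hom_diff[OF Fm N_module h xc wc(1)] w(2)
        module_homD(1)[OF h wc(1)] by (simp add: a_minus_def N.r_neg)
    moreover have "x \<ominus>\<^bsub>?F\<^esub> y = w"
      unfolding y_def using xc wc by (simp add: a_minus_def F.minus_add F.r_neg1 F.r_neg2)
    then have "free_rep s (\<psi>2 (basis_vec A s2 t)) b y" using FA.C_eq[OF xb yc] w(1) by simp
    then have "free_rep s (\<psi>2 (basis_vec A s2 t)) k (if k = b then y else \<zero>\<^bsub>?F\<^esub>)" for k
      using x(2)[of k] by auto
    ultimately show ?thesis using yb by blast
  qed
  then obtain y where y: "\<And>t. t < s2 \<Longrightarrow> y t \<in> Mp ?F b" "\<And>t. t < s2 \<Longrightarrow> \<Phi> (y t) = \<zero>\<^bsub>N\<^esub>"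
    "\<And>t k. t < s2 \<Longrightarrow> free_rep s (\<psi>2 (basis_vec A s2 t)) k (if k = b then y t else \<zero>\<^bsub>?F\<^esub>)" by metis
  obtain \<Phi>2 where \<Phi>2: "\<Phi>2 \<in> module_hom R (free_module R s2) ?F" "\<And>t. t < s2 \<Longrightarrow> \<Phi>2 (basis_vec R s2 t) = y t"
    using module_hom_free_exists[OF Fm, of s2 y] y(1) Mp_free_carr by blast
  have l2: "FA.lifts s2 \<psi>2 \<Phi>2 b"
    unfolding FA.lifts_def using \<psi>2 \<Phi>2 y by (simp split del: if_split cong: if_cong)
  define K where "K = {x \<in> carrier ?F. \<Phi> x = \<zero>\<^bsub>N\<^esub>}"
  have K: "submodule K R ?F"
  proof -
    have "submodule {\<zero>\<^bsub>N\<^esub>} R N" by (intro N.submoduleI) auto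
    from submodule_preimage[OF Fm N_module h this] show ?thesis by (simp add: K_def)
  qed
  have imK: "\<Phi>2 ` carrier (free_module R s2) \<subseteq> K"
  proof
    fix x assume "x \<in> \<Phi>2 ` carrier (free_module R s2)"
    then obtain v where v: "v \<in> carrier (free_module R s2)" "x = \<Phi>2 v" by blast
    have "\<Phi>2 v \<in> K"
    proof (rule module_hom_free_closed[OF Fm \<Phi>2(1) v(1)])
      fix t assume t: "t < s2"
      have "\<Phi>2 (basis_vec R s2 t) \<in> K"
        using y(2)[OF t] \<Phi>2(2)[OF t] Mp_free_carr[OF y(1)[OF t]] by (simp add: K_def)
      then show "v t \<odot>\<^bsub>?F\<^esub> \<Phi>2 (basis_vec R s2 t) \<in> K"
        by (rule submodule_rules(6)[OF Fm K free_module_coord_closed[OF v(1) t]])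
    qed (use submodule_rules[OF Fm K] in blast)+
    then show "x \<in> K" using v(2) by simp
  qed
  have strict2: "x \<in> \<Phi>2 ` Mp (free_module R s2) (c - b)" if x: "x \<in> K" "x \<in> Mp ?F c" for x c
  proof (rule FA.lifts_strict[OF l2 K imK _ x])
    fix c y assume y: "y \<in> K" "y \<in> Mp ?F c"
    obtain z where z: "z \<in> carrier (free_module A s)"
      "\<And>k. free_rep s z k (if k = c then y else \<zero>\<^bsub>?F\<^esub>)" using FA.C_homog[OF y(2)] by blast
    \<comment> \<open>Exactness over \<open>A\<close> enters here: since \<open>\<Phi>\<close> kills
      \<open>y\<close>, every component of \<open>\<psi> z\<close> is zero, so \<open>z\<close> is a
      cycle and hence in the image of \<open>\<psi>2\<close>.\<close>
    have "C (\<psi> z) k \<zero>\<^bsub>N\<^esub>" for k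
      using lifts_homog[OF l z(2), of k] y(1) by (simp add: K_def split: if_splits)
    then have "\<exists>x. C (\<psi> z) k x \<and> C \<zero>\<^bsub>L\<^esub> k x" for k using C_zero by blast
    then have "\<psi> z = \<zero>\<^bsub>L\<^esub>"
      by (rule C_ext[OF module_homD(1)[OF liftsD(1)[OF l] z(1)]
        submodule_rules(2)[OF L_module module.carrier_is_submodule[OF L_module]]])
    then have "z \<in> \<psi>2 ` carrier (free_module A s2)" unfolding ex using z(1) by simp
    then obtain v where "v \<in> carrier (free_module A s2)" "z = \<psi>2 v" by blast
    then show "\<exists>v\<in>carrier (free_module A s2). \<forall>k. free_rep s (\<psi>2 v) k (if k = c then y else \<zero>\<^bsub>?F\<^esub>)"
      using z(2) by blast
  qed
  \<comment> \<open>For \<open>c = 0\<close> strictness says that every cycle is a boundary.\<close>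
  have "K \<subseteq> \<Phi>2 ` carrier (free_module R s2)"
    using strict2[of _ 0] by (auto simp: Mp_0[OF Fm] K_def)
  then have "\<Phi>2 ` carrier (free_module R s2) = K" using imK by blast
  then show ?thesis
    using l2 strict2 unfolding K_def by (intro exI[of _ \<Phi>2]) simp
qed

text \<open>Here the submodule \<open>K\<close> of \<open>lifts_strict\<close> is the whole of
  \<open>N\<close>, and surjectivity of the augmentation over \<open>A\<close> supplies a preimage
  of every leading form.\<close>

lemma lift_start:
  assumes \<psi>: "\<psi> \<in> module_hom A (free_module A s) L" and surj: "\<psi> ` carrier (free_module A s) = carrier L"
    and col: "\<And>t. t < s \<Longrightarrow> \<exists>x\<in>Mp N b. \<forall>k. C (\<psi> (basis_vec A s t)) k (if k = b then x else \<zero>\<^bsub>N\<^esub>)"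
  shows "\<exists>\<Phi>. lifts s \<psi> \<Phi> b \<and> \<Phi> ` carrier (free_module R s) = carrier N \<and>
    (\<forall>c y. y \<in> Mp N c \<longrightarrow> y \<in> \<Phi> ` Mp (free_module R s) (c - b))"
proof -
  interpret N: module R N by (rule N_module)
  obtain y where y: "\<And>t. t < s \<Longrightarrow> y t \<in> Mp N b"
    "\<And>t k. t < s \<Longrightarrow> C (\<psi> (basis_vec A s t)) k (if k = b then y t else \<zero>\<^bsub>N\<^esub>)"
    using col by metis
  obtain \<Phi> where \<Phi>: "\<Phi> \<in> module_hom R (free_module R s) N" "\<And>t. t < s \<Longrightarrow> \<Phi> (basis_vec R s t) = y t"
    using module_hom_free_exists[OF N_module, of s y] y(1) Mp_carr[OF N_module] by blast
  have l: "lifts s \<psi> \<Phi> b"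
    unfolding lifts_def using \<psi> \<Phi> y by (simp split del: if_split cong: if_cong)
  have strict: "x \<in> \<Phi> ` Mp (free_module R s) (c - b)" if x: "x \<in> Mp N c" for x c
  proof (rule lifts_strict[OF l N.carrier_is_submodule _ _ Mp_carr[OF N_module x] x])
    show "\<Phi> ` carrier (free_module R s) \<subseteq> carrier N" using module_homD(1)[OF \<Phi>(1)] by blast
    fix c y assume y: "y \<in> Mp N c"
    obtain g where g: "g \<in> carrier L" "\<And>k. C g k (if k = c then y else \<zero>\<^bsub>N\<^esub>)"
      using C_homog[OF y] by blast
    then obtain z where "z \<in> carrier (free_module A s)" "g = \<psi> z" using surj by blast
    then show "\<exists>z\<in>carrier (free_module A s). \<forall>k. C (\<psi> z) k (if k = c then y else \<zero>\<^bsub>N\<^esub>)"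
      using g(2) by blast
  qed
  have "carrier N \<subseteq> \<Phi> ` carrier (free_module R s)"
    using strict[of _ 0] by (auto simp: Mp_0[OF N_module] Mp_0[OF free_module_is_module])
  then have "\<Phi> ` carrier (free_module R s) = carrier N" using module_homD(1)[OF \<Phi>(1)] by blast
  then show ?thesis using l strict by blast
qed

text \<open>A preimage of a homogeneous element may be replaced by its component in degree
  \<open>j - a\<close>; for \<open>j < a\<close> the element is zero. This is what makes comparison
  maps over \<open>A\<close> homogeneous, and the case distinction is that of
  \<open>mcomp_free_rep\<close>.\<close>

lemma lifts_homog_preimage:
  assumes l: "lifts s \<psi> \<Phi> a" and z: "z \<in> carrier (free_module A s)"
    and g: "\<And>k. C (\<psi> z) k (if k = j then u else \<zero>\<^bsub>N\<^esub>)"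
  shows "\<exists>z'\<in>carrier (free_module A s). \<psi> z' = \<psi> z \<and>
    (if a \<le> j then \<exists>x\<in>Mp (free_module R s) (j - a).
       \<forall>k. free_rep s z' k (if k = j - a then x else \<zero>\<^bsub>free_module R s\<^esub>)
     else z' = \<zero>\<^bsub>free_module A s\<^esub>)"
proof -
  let ?F = "free_module R s"
  interpret N: module R N by (rule N_module)
  interpret A: cring A by (rule A_cring)
  interpret FA: graded_pair R m ?F "free_module A s" "free_rep s" by (rule free_graded_pair)
  interpret GA: module A "free_module A s" by (rule A.free_module_is_module)
  note h = liftsD(1)[OF l]
  note pc = module_homD(1)[OF h]
  show ?thesis
  proof (cases "a \<le> j")
    case True
    obtain x where x: "free_rep s z (j - a) x" using FA.C_exists[OF z] by blast
    then have xm: "x \<in> Mp ?F (j - a)" by (rule FA.C_carr)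
    obtain z' where z': "z' \<in> carrier (free_module A s)"
      "\<And>k. free_rep s z' k (if k = j - a then x else \<zero>\<^bsub>?F\<^esub>)" using FA.C_homog[OF xm] by blast
    have "\<psi> z' = \<psi> z"
    proof (rule C_ext[OF pc[OF z'(1)] pc[OF z]])
      fix n
      have 1: "C (\<psi> z') n (if n = j then \<Phi> x else \<zero>\<^bsub>N\<^esub>)"
        using lifts_homog[OF l z'(2), of n] True by simp
      show "\<exists>y. C (\<psi> z') n y \<and> C (\<psi> z) n y"
      proof (cases "n = j")
        case True
        then show ?thesis using 1 lifts_rep[OF l x] \<open>a \<le> j\<close> by auto
      next
        case False
        then show ?thesis using 1 g[of n] by auto
      qed
    qed
    then show ?thesis
      unfolding if_P[OF True] using z' xm by blast
  next
    case False
    have "\<psi> z = \<zero>\<^bsub>L\<^esub>"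
    proof (rule C_ext[OF pc[OF z] submodule_rules(2)[OF L_module module.carrier_is_submodule[OF L_module]]])
      fix n
      have "C (\<psi> z) n \<zero>\<^bsub>N\<^esub>"
        using g[of n] lifts_rep_0[OF l z, of j] False by (cases "n = j") auto
      then show "\<exists>y. C (\<psi> z) n y \<and> C \<zero>\<^bsub>L\<^esub> n y" using C_zero by blast
    qed
    then show ?thesis
      using False module_hom_zero[OF A.free_module_is_module L_module h] by auto
  qed
qed

end

section \<open>Lifting a pure resolution\<close>

lemma graded_free_module_simps:
  "carrier (graded_free_module A n d) = carrier (free_module A n)"
  "add (graded_free_module A n d) = add (free_module A n)"
  "ring.zero (graded_free_module A n d) = ring.zero (free_module A n)"
  "smult (graded_free_module A n d) = smult (free_module A n)"
  "mcomp (graded_free_module A n d) j = {v \<in> carrier (free_module A n).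
     \<forall>t<n. v t \<in> (if d t \<le> j then gcomp A (j - d t) else {\<zero>\<^bsub>A\<^esub>})}"
  by (auto simp: graded_free_module_def module.defs free_module_simps)

context noetherian_local_adic
begin

lemma basis_vec_mcomp:
  assumes "t < n" shows "basis_vec A n t \<in> mcomp (graded_free_module A n d) (d t)"
proof -
  interpret A: cring A by (rule A_cring)
  show ?thesis
    using assms A_one_gcomp A_zero_gcomp by (auto simp: graded_free_module_simps basis_vec_def free_module_simps)
qed

text \<open>With all twists equal to \<open>e\<close>, twisted degree \<open>j\<close> is untwisted
  degree \<open>j - e\<close>. The guard is essential: for \<open>j < e\<close> truncated
  subtraction would give degree zero in place of the zero component.\<close>

lemma mcomp_free_rep:
  assumes d: "\<And>t. t < n \<Longrightarrow> d t = e"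
  shows "v \<in> mcomp (graded_free_module A n d) j \<longleftrightarrow>
    (if e \<le> j then \<exists>x\<in>Mp (free_module R n) (j - e).
      \<forall>k. free_rep n v k (if k = j - e then x else \<zero>\<^bsub>free_module R n\<^esub>)
     else v = \<zero>\<^bsub>free_module A n\<^esub>)"
proof (cases "e \<le> j")
  case True
  have "(\<exists>x\<in>Mp (free_module R n) (j - e).
      \<forall>k. free_rep n v k (if k = j - e then x else \<zero>\<^bsub>free_module R n\<^esub>)) \<longleftrightarrow>
    v \<in> carrier (free_module A n) \<and> (\<forall>t<n. v t \<in> gcomp A (j - e))"
  proof safe
    fix x assume x: "x \<in> Mp (free_module R n) (j - e)"
      "\<forall>k. free_rep n v k (if k = j - e then x else \<zero>\<^bsub>free_module R n\<^esub>)"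
    show "v \<in> carrier (free_module A n)" using spec[OF x(2), of 0] by (simp add: free_rep_def)
    fix t assume t: "t < n"
    have "A_rep (v t) k (if k = j - e then x t else \<zero>)" for k
      using spec[OF x(2), of k] t by (auto simp: free_rep_def split: if_splits)
    then show "v t \<in> gcomp A (j - e)"
      unfolding A_gcomp_rep using Mp_free_coord[OF x(1) t] by blast
  next
    assume v: "v \<in> carrier (free_module A n)" "\<forall>t<n. v t \<in> gcomp A (j - e)"
    then have "\<forall>t. \<exists>u. t < n \<longrightarrow> u \<in> mpow (j - e) \<and> (\<forall>k. A_rep (v t) k (if k = j - e then u else \<zero>))"
      unfolding A_gcomp_rep by blast
    from choice[OF this] obtain u where u: "\<And>t. t < n \<Longrightarrow> u t \<in> mpow (j - e)"
      "\<And>t k. t < n \<Longrightarrow> A_rep (v t) k (if k = j - e then u t else \<zero>)" by blast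
    define x where "x = (\<lambda>t\<in>{..<n}. u t)"
    have xm: "x \<in> Mp (free_module R n) (j - e)" unfolding Mp_free x_def using u(1) by auto
    have "free_rep n v k (if k = j - e then x else \<zero>\<^bsub>free_module R n\<^esub>)" for k
    proof (rule free_repI[OF v(1)])
      show "(if k = j - e then x else \<zero>\<^bsub>free_module R n\<^esub>) \<in> carrier (free_module R n)"
        using Mp_free_carr[OF xm] by (auto simp: free_module_simps)
      show "t < n \<Longrightarrow> A_rep (v t) k ((if k = j - e then x else \<zero>\<^bsub>free_module R n\<^esub>) t)" for t
        using u(2)[of t k] by (auto simp: x_def)
    qed
    then show "\<exists>x\<in>Mp (free_module R n) (j - e).
      \<forall>k. free_rep n v k (if k = j - e then x else \<zero>\<^bsub>free_module R n\<^esub>)" using xm by blast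
  qed
  then show ?thesis using True d by (auto simp: graded_free_module_simps)
next
  case False
  interpret A: cring A by (rule A_cring)
  interpret G: module A "free_module A n" by (rule A.free_module_is_module)
  have "v \<in> carrier (free_module A n) \<and> (\<forall>t<n. v t = \<zero>\<^bsub>A\<^esub>) \<longleftrightarrow> v = \<zero>\<^bsub>free_module A n\<^esub>"
    using free_module_eqI[of v A n "\<zero>\<^bsub>free_module A n\<^esub>"] by auto
  then show ?thesis using False d by (auto simp: graded_free_module_simps)
qed

text \<open>Homogeneity is decided on the columns. The twists \<open>d\<close> and \<open>d'\<close>
  are unrestricted, since a resolution to be compared with the pure one is not known to be
  pure.\<close>

lemma mcomp_hom:
  assumes f: "f \<in> module_hom A (free_module A n) (free_module A n')"
    and t: "\<And>t. t < n \<Longrightarrow> f (basis_vec A n t) \<in> mcomp (graded_free_module A n' d') (d t)"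
    and v: "v \<in> mcomp (graded_free_module A n d) j"
  shows "f v \<in> mcomp (graded_free_module A n' d') j"
proof (rule module_hom_free_closed[OF _ f])
  interpret A: cring A by (rule A_cring)
  let ?G = "free_module A n'" and ?S = "mcomp (graded_free_module A n' d') j"
  interpret G: module A ?G by (rule A.free_module_is_module)
  show "module A ?G" by (rule A.free_module_is_module)
  show vc: "v \<in> carrier (free_module A n)" using v by (simp add: graded_free_module_simps)
  show "\<zero>\<^bsub>?G\<^esub> \<in> ?S" using A_zero_gcomp by (auto simp: graded_free_module_simps)
  show "?S \<subseteq> carrier ?G" by (auto simp: graded_free_module_simps)
  show "x \<oplus>\<^bsub>?G\<^esub> y \<in> ?S" if "x \<in> ?S" "y \<in> ?S" for x y
  proof -
    have "(x \<oplus>\<^bsub>?G\<^esub> y) t \<in> (if d' t \<le> j then gcomp A (j - d' t) else {\<zero>\<^bsub>A\<^esub>})" if t: "t < n'" for t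
    proof -
      have "x t \<in> (if d' t \<le> j then gcomp A (j - d' t) else {\<zero>\<^bsub>A\<^esub>})"
        "y t \<in> (if d' t \<le> j then gcomp A (j - d' t) else {\<zero>\<^bsub>A\<^esub>})"
        using \<open>x \<in> ?S\<close> \<open>y \<in> ?S\<close> t by (auto simp: graded_free_module_simps split del: if_split)
      then show ?thesis using t A_gcomp_add by (cases "d' t \<le> j") simp_all
    qed
    then show ?thesis using that by (auto simp: graded_free_module_simps)
  qed
  fix t assume tn: "t < n"
  let ?w = "f (basis_vec A n t)"
  have w: "?w \<in> carrier ?G" "\<And>u. u < n' \<Longrightarrow> ?w u \<in> (if d' u \<le> d t then gcomp A (d t - d' u) else {\<zero>\<^bsub>A\<^esub>})"
    using t[OF tn] by (auto simp: graded_free_module_simps)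
  have vt: "v t \<in> (if d t \<le> j then gcomp A (j - d t) else {\<zero>\<^bsub>A\<^esub>})" "v t \<in> carrier A"
    using v tn free_module_coord_closed[OF vc tn] by (auto simp: graded_free_module_simps)
  have "v t \<otimes>\<^bsub>A\<^esub> ?w u \<in> (if d' u \<le> j then gcomp A (j - d' u) else {\<zero>\<^bsub>A\<^esub>})" if u: "u < n'" for u
  proof (cases "d t \<le> j \<and> d' u \<le> d t")
    case True
    then have "v t \<otimes>\<^bsub>A\<^esub> ?w u \<in> gcomp A ((j - d t) + (d t - d' u))"
      using vt w(2)[OF u] by (intro A_gcomp_mult) auto
    then show ?thesis using True by auto
  next
    case False
    then have "v t \<otimes>\<^bsub>A\<^esub> ?w u = \<zero>\<^bsub>A\<^esub>"
      using vt w(2)[OF u] free_module_coord_closed[OF w(1) u] by (auto split: if_splits)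
    then show ?thesis using A_zero_gcomp by auto
  qed
  then show "v t \<odot>\<^bsub>?G\<^esub> ?w \<in> ?S" using vt(2) w(1) by (auto simp: graded_free_module_simps)
qed

end

text \<open>A basis vector in the kernel would be a boundary, so by minimality its coordinates would
  lie in \<open>I\<close>, but one of them is \<open>1\<close>.\<close>

lemma minimal_basis_not_in_kernel:
  assumes cr: "cring R" and res: "minimal_free_resolution R I L r \<phi> \<epsilon>" and I: "ideal I R" "\<one>\<^bsub>R\<^esub> \<notin> I"
    and t: "t < r (Suc i)"
  shows "\<phi> (Suc i) (basis_vec R (r (Suc i)) t) \<noteq> \<zero>\<^bsub>free_module R (r i)\<^esub>"
proof
  interpret cring R by fact
  have res0: "free_resolution R L r \<phi> \<epsilon>" and
    min: "\<phi> (Suc (Suc i)) ` carrier (free_module R (r (Suc (Suc i)))) \<subseteq> ideal_smult I (free_module R (r (Suc i)))"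
    using res by (auto simp: minimal_free_resolution_def)
  assume "\<phi> (Suc i) (basis_vec R (r (Suc i)) t) = \<zero>\<^bsub>free_module R (r i)\<^esub>"
  then have "basis_vec R (r (Suc i)) t \<in> \<phi> (Suc (Suc i)) ` carrier (free_module R (r (Suc (Suc i))))"
    unfolding free_resolutionD(5)[OF res0] by simp
  then have "basis_vec R (r (Suc i)) t \<in> ({..<r (Suc i)} \<rightarrow>\<^sub>E I)"
    using min ideal_smult_free_module[OF I(1)] by blast
  then have "basis_vec R (r (Suc i)) t t \<in> I" using t by auto
  then show False using I(2) t by (simp add: basis_vec_def)
qed

lemma free_module_0_eq:
  "v \<in> carrier (free_module R 0) \<Longrightarrow> w \<in> carrier (free_module R 0) \<Longrightarrow> v = w"
  by (rule free_module_eqI) auto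

text \<open>With zero target every basis vector would lie in the kernel. The contrapositive is what
  gets used: a nonzero rank forces the preceding rank to be nonzero.\<close>

lemma minimal_rank_zero:
  assumes cr: "cring R" and res: "minimal_free_resolution R I L r \<phi> \<epsilon>" and I: "ideal I R" "\<one>\<^bsub>R\<^esub> \<notin> I"
    and z: "r i = 0"
  shows "r (Suc i) = 0"
proof (rule ccontr)
  interpret cring R by fact
  interpret F: module R "free_module R (r i)" by (rule free_module_is_module)
  have res0: "free_resolution R L r \<phi> \<epsilon>" using res by (auto simp: minimal_free_resolution_def)
  assume "r (Suc i) \<noteq> 0"
  then have "\<phi> (Suc i) (basis_vec R (r (Suc i)) 0) \<noteq> \<zero>\<^bsub>free_module R (r i)\<^esub>"
    by (intro minimal_basis_not_in_kernel[OF assms(1-4)]) simp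
  moreover have "\<phi> (Suc i) (basis_vec R (r (Suc i)) 0) = \<zero>\<^bsub>free_module R (r i)\<^esub>"
    using module_homD(1)[OF free_resolutionD(2)[OF res0, of i] basis_vec_closed] F.zero_closed
    unfolding z by (rule free_module_0_eq)
  ultimately show False by simp
qed

text \<open>\<open>\<delta> i\<close> is meaningful only if stage \<open>i\<close> has a basis
  vector; this is why statements on degrees carry conditions on the ranks.\<close>

locale pure_resolution = noetherian_local_adic R m for R (structure) and m +
  fixes M :: "('a, 'c, 'd) module_scheme" and s d \<psi> \<eta> and \<delta> :: "nat \<Rightarrow> nat"
  assumes M_noetherian: "noetherian_module R M"
    and res: "minimal_graded_free_resolution A (gr M) s d \<psi> \<eta>"
    and pure: "\<And>i t. t < s i \<Longrightarrow> d i t = \<delta> i"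
begin

lemma res_min: "minimal_free_resolution A (irrelevant_ideal A) (gr M) s \<psi> \<eta>"
  and res_free: "free_resolution A (gr M) s \<psi> \<eta>"
  and res_aug: "\<eta> ` mcomp (graded_free_module A (s 0) (d 0)) j \<subseteq> mcomp (gr M) j"
  and res_diff: "\<psi> (Suc i) ` mcomp (graded_free_module A (s (Suc i)) (d (Suc i))) j
         \<subseteq> mcomp (graded_free_module A (s i) (d i)) j"
  using res by (auto simp: minimal_graded_free_resolution_def minimal_free_resolution_def)

lemma M_module: "module R M"
  using M_noetherian by (simp add: noetherian_module_def)

lemma gr_module: "module A (gr M)"
  by (rule free_resolution_module[OF A_cring res_free])

sublocale GM: graded_pair R m M "gr M" "gr_rep M"
  by (rule gr_graded_pair[OF M_noetherian gr_module])

lemma mcomp_rep: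
  "v \<in> mcomp (graded_free_module A (s i) (d i)) j \<longleftrightarrow>
    (if \<delta> i \<le> j then \<exists>x\<in>Mp (free_module R (s i)) (j - \<delta> i).
      \<forall>k. free_rep (s i) v k (if k = j - \<delta> i then x else \<zero>\<^bsub>free_module R (s i)\<^esub>)
     else v = \<zero>\<^bsub>free_module A (s i)\<^esub>)"
  by (rule mcomp_free_rep) (rule pure)

lemma column_mcomp:
  assumes t: "t < s (Suc i)"
  shows "\<psi> (Suc i) (basis_vec A (s (Suc i)) t) \<in> mcomp (graded_free_module A (s i) (d i)) (\<delta> (Suc i))"
proof -
  have "basis_vec A (s (Suc i)) t \<in> mcomp (graded_free_module A (s (Suc i)) (d (Suc i))) (d (Suc i) t)"
    by (rule basis_vec_mcomp[OF t])
  then show ?thesis using res_diff[of i "\<delta> (Suc i)"] pure[OF t] by auto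
qed

text \<open>If the degree did not increase, the coordinates of a column would be zero or of degree
  zero; by minimality the latter lie in the irrelevant ideal and vanish too, and a zero column
  contradicts minimality. Consequently the natural subtraction in \<open>gap\<close> is a true
  difference at nonzero ranks.\<close>

lemma degree_less:
  assumes ne: "s (Suc i) \<noteq> 0"
  shows "\<delta> i < \<delta> (Suc i)"
proof (rule ccontr)
  assume neg: "\<not> \<delta> i < \<delta> (Suc i)"
  interpret A: cring A by (rule A_cring)
  interpret G: module A "free_module A (s i)" by (rule A.free_module_is_module)
  have t: "0 < s (Suc i)" using ne by simp
  let ?v = "\<psi> (Suc i) (basis_vec A (s (Suc i)) 0)"
  have vI: "?v \<in> ({..<s i} \<rightarrow>\<^sub>E irrelevant_ideal A)"
    using res_min A.basis_vec_closed A.ideal_smult_free_module[OF irrelevant_ideal_ideal]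
    unfolding minimal_free_resolution_def by blast
  note mem = iffD1[OF mcomp_rep column_mcomp[OF t]]
  have "?v = \<zero>\<^bsub>free_module A (s i)\<^esub>"
  proof (cases "\<delta> i = \<delta> (Suc i)")
    case False
    then show ?thesis using neg mem by simp
  next
    case True
    then obtain x where x: "\<And>k. free_rep (s i) ?v k (if k = 0 then x else \<zero>\<^bsub>free_module R (s i)\<^esub>)"
      using mem by auto
    show ?thesis
    proof (rule free_module_eqI[OF _ G.zero_closed])
      show "?v \<in> carrier (free_module A (s i))" using x[of 0] by (simp add: free_rep_def)
      fix u assume u: "u < s i"
      have "A_rep (?v u) 0 \<zero>" using vI u by (intro irrelevant_rep) auto
      moreover have "A_rep (?v u) n \<zero>" if "n \<noteq> 0" for n
        using x[of n] that u by (auto simp: free_rep_def)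
      ultimately have "A_rep (?v u) n \<zero>" for n by (cases "n = 0") auto
      then have "?v u = \<zero>\<^bsub>A\<^esub>" using A_rep_zero by (intro gr_rep_ext[OF selfm]) blast
      then show "?v u = \<zero>\<^bsub>free_module A (s i)\<^esub> u" using u by simp
    qed
  qed
  then show False
    using minimal_basis_not_in_kernel[OF A_cring res_min irrelevant_ideal_ideal one_notin_irrelevant t] by simp
qed

abbreviation FR where "FR i \<equiv> free_module R (s i)"
abbreviation FA where "FA i \<equiv> free_module A (s i)"
abbreviation gap where "gap i \<equiv> \<delta> (Suc i) - \<delta> i"
abbreviation flifts where
  "flifts i \<Phi> \<equiv> graded_pair.lifts R m (FR i) (FA i) (free_rep (s i)) (s (Suc i)) (\<psi> (Suc i)) \<Phi> (gap i)"

lemma column_rep: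
  assumes t: "t < s (Suc i)"
  shows "\<exists>x\<in>Mp (FR i) (gap i). \<forall>k.
    free_rep (s i) (\<psi> (Suc i) (basis_vec A (s (Suc i)) t)) k (if k = gap i then x else \<zero>\<^bsub>FR i\<^esub>)"
  using iffD1[OF mcomp_rep column_mcomp[OF t]] degree_less[of i] t
  by (simp split: if_split_asm split del: if_split)

lemma lift_exists:
  "\<exists>\<Phi>0 \<Phi>. GM.lifts (s 0) \<eta> \<Phi>0 (\<delta> 0) \<and> \<Phi>0 ` carrier (FR 0) = carrier M \<and>
    \<Phi> 0 ` carrier (FR (Suc 0)) = {v \<in> carrier (FR 0). \<Phi>0 v = \<zero>\<^bsub>M\<^esub>} \<and>
    (\<forall>i. flifts i (\<Phi> i) \<and>
      \<Phi> (Suc i) ` carrier (FR (Suc (Suc i))) = {v \<in> carrier (FR (Suc i)). \<Phi> i v = \<zero>\<^bsub>FR i\<^esub>} \<and>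
      (\<forall>c y. y \<in> \<Phi> i ` carrier (FR (Suc i)) \<longrightarrow> y \<in> Mp (FR i) c \<longrightarrow> y \<in> \<Phi> i ` Mp (FR (Suc i)) (c - gap i)))"
proof -
  have "\<exists>x\<in>Mp M (\<delta> 0). \<forall>k. gr_rep M (\<eta> (basis_vec A (s 0) t)) k (if k = \<delta> 0 then x else \<zero>\<^bsub>M\<^esub>)"
    if t: "t < s 0" for t
  proof -
    have "\<eta> (basis_vec A (s 0) t) \<in> mcomp (gr M) (d 0 t)"
      using res_aug basis_vec_mcomp[OF t] by blast
    then show ?thesis unfolding gr_rep_mcomp[OF M_module] pure[OF t] .
  qed
  from GM.lift_start[OF free_resolutionD(1)[OF res_free] free_resolutionD(3)[OF res_free] this]
  obtain \<Phi>0 where \<Phi>0: "GM.lifts (s 0) \<eta> \<Phi>0 (\<delta> 0)" "\<Phi>0 ` carrier (FR 0) = carrier M"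
    "\<And>c y. y \<in> Mp M c \<Longrightarrow> y \<in> \<Phi>0 ` Mp (FR 0) (c - \<delta> 0)" by blast
  \<comment> \<open>Exactness at the lowest stage refers to \<open>\<Phi>0\<close> and not to a
    preceding differential, so it is stored in \<open>P\<close> for \<open>i = 0\<close>; exactness
    elsewhere relates consecutive choices and is stored in \<open>Q\<close>.\<close>
  define P where "P i \<Phi> \<longleftrightarrow> flifts i \<Phi> \<and>
      (\<forall>c y. y \<in> \<Phi> ` carrier (FR (Suc i)) \<longrightarrow> y \<in> Mp (FR i) c \<longrightarrow> y \<in> \<Phi> ` Mp (FR (Suc i)) (c - gap i)) \<and>
      (i = 0 \<longrightarrow> \<Phi> ` carrier (FR (Suc 0)) = {v \<in> carrier (FR 0). \<Phi>0 v = \<zero>\<^bsub>M\<^esub>})" for i \<Phi>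
  define Q where "Q i \<Phi> \<Phi>2 \<longleftrightarrow>
    \<Phi>2 ` carrier (FR (Suc (Suc i))) = {v \<in> carrier (FR (Suc i)). \<Phi> v = \<zero>\<^bsub>FR i\<^esub>}" for i \<Phi> \<Phi>2
  have "\<exists>\<Phi>. P 0 \<Phi>"
  proof -
    have "y \<in> \<Phi>0 ` Mp (FR 0) (c - \<delta> 0)" if "y \<in> \<Phi>0 ` carrier (FR 0)" "y \<in> Mp M c" for c y
      by (rule \<Phi>0(3)[OF that(2)])
    from GM.lift_step[OF \<Phi>0(1) _ free_resolutionD(2)[OF res_free] free_resolutionD(4)[OF res_free], OF this column_rep]
    obtain \<Phi> where "flifts 0 \<Phi>"
      "\<Phi> ` carrier (FR (Suc 0)) = {v \<in> carrier (FR 0). \<Phi>0 v = \<zero>\<^bsub>M\<^esub>}"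
      "\<forall>c y. y \<in> \<Phi> ` carrier (FR (Suc 0)) \<longrightarrow> y \<in> Mp (FR 0) c \<longrightarrow> y \<in> \<Phi> ` Mp (FR (Suc 0)) (c - gap 0)"
      by auto
    then have "P 0 \<Phi>" unfolding P_def by (intro conjI impI)
    then show ?thesis by blast
  qed
  moreover have "\<exists>\<Phi>2. P (Suc i) \<Phi>2 \<and> Q i \<Phi> \<Phi>2" if P: "P i \<Phi>" for i \<Phi>
  proof -
    interpret G: graded_pair R m "FR i" "FA i" "free_rep (s i)" by (rule free_graded_pair)
    note l = conjunct1[OF P[unfolded P_def]] and st = conjunct1[OF conjunct2[OF P[unfolded P_def]]]
    from G.lift_step[OF l st[rule_format] free_resolutionD(2)[OF res_free] free_resolutionD(5)[OF res_free] column_rep]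
    obtain \<Phi>2 where "flifts (Suc i) \<Phi>2"
      "\<Phi>2 ` carrier (FR (Suc (Suc i))) = {v \<in> carrier (FR (Suc i)). \<Phi> v = \<zero>\<^bsub>FR i\<^esub>}"
      "\<forall>c y. y \<in> \<Phi>2 ` carrier (FR (Suc (Suc i))) \<longrightarrow> y \<in> Mp (FR (Suc i)) c \<longrightarrow>
        y \<in> \<Phi>2 ` Mp (FR (Suc (Suc i))) (c - gap (Suc i))"
      by auto
    then have "P (Suc i) \<Phi>2 \<and> Q i \<Phi> \<Phi>2" unfolding P_def Q_def by (intro conjI impI) simp_all
    then show ?thesis by blast
  qed
  ultimately have "\<exists>\<Phi>. \<forall>i. P i (\<Phi> i) \<and> Q i (\<Phi> i) (\<Phi> (Suc i))" by (rule dependent_nat_choice)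
  then obtain \<Phi> where \<Phi>: "\<And>i. P i (\<Phi> i)" "\<And>i. Q i (\<Phi> i) (\<Phi> (Suc i))" by auto
  show ?thesis
  proof (intro exI[of _ \<Phi>0] exI[of _ \<Phi>] conjI allI)
    show "\<Phi> 0 ` carrier (FR (Suc 0)) = {v \<in> carrier (FR 0). \<Phi>0 v = \<zero>\<^bsub>M\<^esub>}"
      using \<Phi>(1)[of 0] unfolding P_def by (elim conjE) simp
    fix i
    show "flifts i (\<Phi> i)" using \<Phi>(1)[of i] unfolding P_def by (elim conjE)
    show "\<Phi> (Suc i) ` carrier (FR (Suc (Suc i))) = {v \<in> carrier (FR (Suc i)). \<Phi> i v = \<zero>\<^bsub>FR i\<^esub>}"
      using \<Phi>(2)[of i] unfolding Q_def .
    fix c y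
    show "y \<in> \<Phi> i ` carrier (FR (Suc i)) \<longrightarrow> y \<in> Mp (FR i) c \<longrightarrow> y \<in> \<Phi> i ` Mp (FR (Suc i)) (c - gap i)"
      using \<Phi>(1)[of i] unfolding P_def by (elim conjE) simp
  qed (rule \<Phi>0)+
qed

end

section \<open>Degrees in a lifted pure resolution\<close>

text \<open>Modulo \<open>I\<close>, the map \<open>f\<close> has the left inverse
  \<open>g\<close>.\<close>

lemma (in two_resolutions) comparison_reflects:
  assumes c: "comparison i f g h" and v: "v \<in> carrier (F i)" and fv: "f v \<in> ideal_smult I (F' i)"
  shows "v \<in> ideal_smult I (F i)"
proof -
  interpret Fi: module R "F i" by (rule Fm)
  have fg: "f \<in> module_hom R (F i) (F' i)" "g \<in> module_hom R (F' i) (F i)"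
    "g (f v) \<ominus>\<^bsub>F i\<^esub> v \<in> ideal_smult I (F i)"
    using c v unfolding comparison_def by auto
  note S = submodule_rules[OF Fm ideal_smult_submodule[OF Fm I]]
  have gf: "g (f v) \<in> ideal_smult I (F i)" by (rule ideal_smult_hom[OF Fm' Fm fg(2) I fv])
  have c: "g (f v) \<in> carrier (F i)" using module_homD(1)[OF fg(2)] module_homD(1)[OF fg(1)] v by blast
  have "g (f v) \<ominus>\<^bsub>F i\<^esub> (g (f v) \<ominus>\<^bsub>F i\<^esub> v) = v"
    using c v by (simp add: a_minus_def Fi.minus_add Fi.r_neg1 Fi.r_neg2)
  then show ?thesis using S(5)[OF gf fg(3)] by simp
qed

lemma (in cring) basis_vec_notin:
  assumes I: "ideal I R" "\<one> \<notin> I" and t: "t < n"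
  shows "basis_vec R n t \<notin> ideal_smult I (free_module R n)"
proof
  assume "basis_vec R n t \<in> ideal_smult I (free_module R n)"
  then have "basis_vec R n t t \<in> I" using t unfolding ideal_smult_free_module[OF I(1)] by auto
  then show False using I(2) t by (simp add: basis_vec_def)
qed

lemma graded_syzygy_simps:
  "carrier (graded_syzygy A r d \<phi> i) = \<phi> i ` carrier (free_module A (r i))"
  "add (graded_syzygy A r d \<phi> i) = add (free_module A (r (i - 1)))"
  "ring.zero (graded_syzygy A r d \<phi> i) = ring.zero (free_module A (r (i - 1)))"
  "smult (graded_syzygy A r d \<phi> i) = smult (free_module A (r (i - 1)))"
  "mcomp (graded_syzygy A r d \<phi> i) j
    = mcomp (graded_free_module A (r (i - 1)) (d (i - 1))) j \<inter> \<phi> i ` carrier (free_module A (r i))"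
  by (simp_all add: graded_syzygy_def graded_submodule_def graded_free_module_simps)

text \<open>Truncation: when the two lowest stages are dropped, \<open>\<phi> 2\<close> becomes the
  augmentation onto its image, and the degrees of the basis vectors are kept.\<close>

lemma second_syzygy_resolution:
  assumes "minimal_graded_free_resolution A L r d \<phi> \<epsilon>"
  shows "minimal_graded_free_resolution A (graded_syzygy A r d \<phi> 2)
    (\<lambda>i. r (Suc (Suc i))) (\<lambda>i. d (Suc (Suc i))) (\<lambda>i. \<phi> (Suc (Suc i))) (\<phi> 2)"
proof -
  let ?N = "graded_syzygy A r d \<phi> 2"
  have min: "minimal_free_resolution A (irrelevant_ideal A) L r \<phi> \<epsilon>"
    and diff: "\<And>i j. \<phi> (Suc i) ` mcomp (graded_free_module A (r (Suc i)) (d (Suc i))) j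
         \<subseteq> mcomp (graded_free_module A (r i) (d i)) j"
    using assms by (auto simp: minimal_graded_free_resolution_def)
  have res: "free_resolution A L r \<phi> \<epsilon>"
    and im: "\<And>i. \<phi> (Suc i) ` carrier (free_module A (r (Suc i))) \<subseteq> ideal_smult (irrelevant_ideal A) (free_module A (r i))"
    using min by (auto simp: minimal_free_resolution_def)
  note D = free_resolutionD[OF res]
  have two: "2 = Suc (Suc 0)" "Suc (Suc 0) - 1 = Suc 0" by auto
  have hom: "\<phi> 2 \<in> module_hom A (free_module A (r 2)) ?N"
    using D(2)[of "Suc 0"] by (auto simp: module_hom_def graded_syzygy_simps two)
  have ker: "a_kernel (free_module A (r (Suc (Suc 0)))) ?N (\<phi> 2)
    = {v \<in> carrier (free_module A (r (Suc (Suc 0)))). \<phi> (Suc (Suc 0)) v = \<zero>\<^bsub>free_module A (r (Suc 0))\<^esub>}"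
    by (auto simp: a_kernel_iff graded_syzygy_simps two)
  have kers: "a_kernel (free_module A (r (Suc i))) (free_module A (r i)) (\<phi> (Suc i))
    = {v \<in> carrier (free_module A (r (Suc i))). \<phi> (Suc i) v = \<zero>\<^bsub>free_module A (r i)\<^esub>}" for i
    by (auto simp: a_kernel_iff)
  have "free_resolution A ?N (\<lambda>i. r (Suc (Suc i))) (\<lambda>i. \<phi> (Suc (Suc i))) (\<phi> 2)"
    unfolding free_resolution_def Let_def using hom D(2) D(5)
    by (simp add: ker[unfolded two] kers graded_syzygy_simps two)
  moreover have "\<phi> 2 ` mcomp (graded_free_module A (r 2) (d 2)) j \<subseteq> mcomp ?N j" for j
    using diff[of "Suc 0" j] by (auto simp: graded_syzygy_simps two graded_free_module_simps)
  ultimately show ?thesis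
    using im diff unfolding minimal_graded_free_resolution_def minimal_free_resolution_def
    by (simp add: two)
qed

text \<open>\<open>\<Phi> i\<close> goes from stage \<open>i + 1\<close> to stage \<open>i\<close>,
  so it is the differential of index \<open>i + 1\<close>; hence the index \<open>j - 1\<close> when
  the family is viewed as a free resolution.\<close>

locale lifted_resolution = pure_resolution R m M s d \<psi> \<eta> \<delta>
  for R (structure) and m and M :: "('a, 'c, 'd) module_scheme" and s d \<psi> \<eta> \<delta> +
  fixes \<Phi>0 :: "(nat \<Rightarrow> 'a) \<Rightarrow> 'c" and \<Phi> :: "nat \<Rightarrow> (nat \<Rightarrow> 'a) \<Rightarrow> (nat \<Rightarrow> 'a)"
  assumes aug_lifts: "GM.lifts (s 0) \<eta> \<Phi>0 (\<delta> 0)"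
    and aug_surj: "\<Phi>0 ` carrier (FR 0) = carrier M"
    and aug_exact: "\<Phi> 0 ` carrier (FR (Suc 0)) = {v \<in> carrier (FR 0). \<Phi>0 v = \<zero>\<^bsub>M\<^esub>}"
    and diff_lifts: "flifts i (\<Phi> i)"
    and exact: "\<Phi> (Suc i) ` carrier (FR (Suc (Suc i))) = {v \<in> carrier (FR (Suc i)). \<Phi> i v = \<zero>\<^bsub>FR i\<^esub>}"
    and strict: "y \<in> \<Phi> i ` carrier (FR (Suc i)) \<Longrightarrow> y \<in> Mp (FR i) c \<Longrightarrow>
      y \<in> \<Phi> i ` Mp (FR (Suc i)) (c - gap i)"
begin

lemmas Fm = free_module_is_module

lemma Mp_1: "Mp N (Suc 0) = ideal_smult m N"
  by (simp add: Mp_alt)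

lemma \<Phi>_hom: "\<Phi> i \<in> module_hom R (FR (Suc i)) (FR i)"
  and \<Phi>_col: "t < s (Suc i) \<Longrightarrow> \<Phi> i (basis_vec R (s (Suc i)) t) \<in> Mp (FR i) (gap i)"
proof -
  interpret G: graded_pair R m "FR i" "FA i" "free_rep (s i)" by (rule free_graded_pair)
  show "\<Phi> i \<in> module_hom R (FR (Suc i)) (FR i)" by (rule G.liftsD(2)[OF diff_lifts])
  show "t < s (Suc i) \<Longrightarrow> \<Phi> i (basis_vec R (s (Suc i)) t) \<in> Mp (FR i) (gap i)"
    by (rule G.liftsD(3)[OF diff_lifts])
qed

lemma \<Phi>_Mp: "v \<in> Mp (FR (Suc i)) b \<Longrightarrow> \<Phi> i v \<in> Mp (FR i) (b + gap i)"
  by (rule Mp_free_hom[OF Fm \<Phi>_hom \<Phi>_col])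

lemma \<Phi>_minimal:
  assumes v: "v \<in> carrier (FR (Suc i))" shows "\<Phi> i v \<in> Mp (FR i) (Suc 0)"
proof (rule module_hom_free_closed[OF Fm \<Phi>_hom v])
  fix t assume t: "t < s (Suc i)"
  then have "Suc 0 \<le> gap i" using degree_less[of i] by simp
  then have "\<Phi> i (basis_vec R (s (Suc i)) t) \<in> Mp (FR i) (Suc 0)"
    by (rule subsetD[OF Mp_antimono[OF Fm] \<Phi>_col[OF t]])
  then show "v t \<odot>\<^bsub>FR i\<^esub> \<Phi> i (basis_vec R (s (Suc i)) t) \<in> Mp (FR i) (Suc 0)"
    by (rule Mp_rules(6)[OF Fm free_module_coord_closed[OF v t]])
qed (rule Mp_rules[OF Fm]; assumption)+

lemma lifted_free_resolution: "minimal_free_resolution R m M s (\<lambda>j. \<Phi> (j - 1)) \<Phi>0"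
proof -
  have k: "a_kernel (FR 0) M \<Phi>0 = {v \<in> carrier (FR 0). \<Phi>0 v = \<zero>\<^bsub>M\<^esub>}"
    "a_kernel (FR (Suc i)) (FR i) (\<Phi> i) = {v \<in> carrier (FR (Suc i)). \<Phi> i v = \<zero>\<^bsub>FR i\<^esub>}" for i
    by (auto simp: a_kernel_iff)
  have "free_resolution R M s (\<lambda>j. \<Phi> (j - 1)) \<Phi>0"
    unfolding free_resolution_def Let_def
    using GM.liftsD(2)[OF aug_lifts] \<Phi>_hom aug_surj aug_exact exact by (simp add: k)
  then show ?thesis
    using \<Phi>_minimal unfolding minimal_free_resolution_def Mp_1[symmetric] by auto
qed

text \<open>Strictness provides some \<open>w\<close> in \<open>m F\<close> with the same image as
  \<open>v\<close>; the difference of \<open>v\<close> and \<open>w\<close> is a cycle, hence a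
  boundary, hence in \<open>m F\<close>. In other words, a vector outside \<open>m F\<close> has an
  image of order exactly \<open>gap i\<close>.\<close>

lemma order_reflect:
  assumes v: "v \<in> carrier (FR (Suc i))" and o: "\<Phi> i v \<in> Mp (FR i) (Suc (gap i))"
  shows "v \<in> Mp (FR (Suc i)) (Suc 0)"
proof -
  interpret F: module R "FR (Suc i)" by (rule Fm)
  interpret F0: module R "FR i" by (rule Fm)
  have "\<Phi> i v \<in> \<Phi> i ` Mp (FR (Suc i)) (Suc (gap i) - gap i)"
    by (rule strict[OF imageI[OF v] o])
  then obtain w where w: "w \<in> Mp (FR (Suc i)) (Suc 0)" "\<Phi> i v = \<Phi> i w" by auto
  have wc: "w \<in> carrier (FR (Suc i))" using w(1) Mp_free_carr by blast
  have "\<Phi> i (v \<ominus>\<^bsub>FR (Suc i)\<^esub> w) = \<zero>\<^bsub>FR i\<^esub>"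
    using module_hom_diff[OF Fm Fm \<Phi>_hom v wc] w(2) module_homD(1)[OF \<Phi>_hom wc]
    by (simp add: a_minus_def F0.r_neg)
  then have "v \<ominus>\<^bsub>FR (Suc i)\<^esub> w \<in> \<Phi> (Suc i) ` carrier (FR (Suc (Suc i)))"
    unfolding exact using v wc by simp
  then obtain u where u: "v \<ominus>\<^bsub>FR (Suc i)\<^esub> w = \<Phi> (Suc i) u" "u \<in> carrier (FR (Suc (Suc i)))" by (rule imageE)
  have "v \<ominus>\<^bsub>FR (Suc i)\<^esub> w \<in> Mp (FR (Suc i)) (Suc 0)" unfolding u(1) by (rule \<Phi>_minimal[OF u(2)])
  from Mp_rules(3)[OF Fm this w(1)]
  show ?thesis using v wc by (simp add: a_minus_def F.a_assoc F.l_neg)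
qed

lemma zero_mcomp: "\<zero>\<^bsub>FA i\<^esub> \<in> mcomp (graded_free_module A (s i) (d i)) j"
proof -
  interpret A: cring A by (rule A_cring)
  interpret G: module A "FA i" by (rule A.free_module_is_module)
  show ?thesis using A_zero_gcomp by (auto simp: graded_free_module_simps)
qed

lemma homogeneous_lift_aug:
  assumes "y \<in> carrier (gr M)" "y \<in> mcomp (gr M) j"
  shows "\<exists>x\<in>carrier (FA 0). x \<in> mcomp (graded_free_module A (s 0) (d 0)) j \<and> \<eta> x = y"
proof -
  obtain z where z: "z \<in> carrier (FA 0)" "y = \<eta> z" using free_resolutionD(3)[OF res_free] assms(1) by blast
  obtain u where "\<And>k. gr_rep M (\<eta> z) k (if k = j then u else \<zero>\<^bsub>M\<^esub>)"
    using assms(2) unfolding z(2) gr_rep_mcomp[OF M_module] by blast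
  from GM.lifts_homog_preimage[OF aug_lifts z(1) this]
  show ?thesis unfolding z(2) mcomp_rep by blast
qed

lemma homogeneous_lift_diff:
  assumes y: "y \<in> \<psi> (Suc i) ` carrier (FA (Suc i))" "y \<in> mcomp (graded_free_module A (s i) (d i)) j"
  shows "\<exists>x\<in>carrier (FA (Suc i)). x \<in> mcomp (graded_free_module A (s (Suc i)) (d (Suc i))) j \<and> \<psi> (Suc i) x = y"
proof -
  interpret A: cring A by (rule A_cring)
  interpret GS: module A "FA (Suc i)" by (rule A.free_module_is_module)
  interpret G: graded_pair R m "FR i" "FA i" "free_rep (s i)" by (rule free_graded_pair)
  obtain z where z: "z \<in> carrier (FA (Suc i))" "y = \<psi> (Suc i) z" using y(1) by blast
  have zero: ?thesis if "y = \<zero>\<^bsub>FA i\<^esub>"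
    using that zero_mcomp module_hom_zero[OF A.free_module_is_module A.free_module_is_module
      free_resolutionD(2)[OF res_free]] by (intro bexI[of _ "\<zero>\<^bsub>FA (Suc i)\<^esub>"]) auto
  show ?thesis
  \<comment> \<open>In the degenerate cases the zero vector serves as preimage. Otherwise
    \<open>\<delta> i \<le> j\<close> and \<open>\<delta> i < \<delta> (Suc i)\<close>, and the
    guard and the degree expressed through \<open>gap i\<close> translate into those expressed
    through \<open>\<delta> (Suc i)\<close>.\<close>
  proof (cases "s (Suc i) = 0 \<or> \<not> \<delta> i \<le> j")
    case True
    then show ?thesis
    proof
      assume s0: "s (Suc i) = 0"
      have "z = \<zero>\<^bsub>FA (Suc i)\<^esub>" using z(1) GS.zero_closed unfolding s0 by (rule free_module_0_eq)
      then show ?thesis using zero_mcomp[of "Suc i"] z by blast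
    next
      assume "\<not> \<delta> i \<le> j"
      then show ?thesis using y(2) zero unfolding mcomp_rep by simp
    qed
  next
    case False
    then obtain u where u: "\<And>k. free_rep (s i) (\<psi> (Suc i) z) k (if k = j - \<delta> i then u else \<zero>\<^bsub>FR i\<^esub>)"
      using y(2) unfolding mcomp_rep z(2) by auto
    have lt: "\<delta> i < \<delta> (Suc i)" using False degree_less by blast
    from G.lifts_homog_preimage[OF diff_lifts z(1) u]
    obtain z' where z': "z' \<in> carrier (FA (Suc i))" "\<psi> (Suc i) z' = \<psi> (Suc i) z"
      "if gap i \<le> j - \<delta> i then \<exists>x\<in>Mp (FR (Suc i)) (j - \<delta> i - gap i).
       \<forall>k. free_rep (s (Suc i)) z' k (if k = j - \<delta> i - gap i then x else \<zero>\<^bsub>FR (Suc i)\<^esub>)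
     else z' = \<zero>\<^bsub>FA (Suc i)\<^esub>" by blast
    have "(gap i \<le> j - \<delta> i) = (\<delta> (Suc i) \<le> j)" "j - \<delta> i - gap i = j - \<delta> (Suc i)"
      using lt False by auto
    then have "z' \<in> mcomp (graded_free_module A (s (Suc i)) (d (Suc i))) j"
      using z'(3) unfolding mcomp_rep by (simp only:)
    then show ?thesis using z' z(2) by blast
  qed
qed

lemma graded_two_resolutions:
  assumes res': "minimal_graded_free_resolution A (gr M) s' d' \<psi>' \<eta>'"
  shows "two_resolutions A (irrelevant_ideal A) (gr M) s' \<psi>' \<eta>' s \<psi> \<eta> d'
    (\<lambda>i j. mcomp (graded_free_module A (s' i) (d' i)) j) (\<lambda>i j. mcomp (graded_free_module A (s i) (d i)) j)
    (\<lambda>j. mcomp (gr M) j)"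
proof (rule two_resolutions.intro[OF A_cring two_resolutions_axioms.intro[OF irrelevant_ideal_ideal _ res_free]])
  show "minimal_free_resolution A (irrelevant_ideal A) (gr M) s' \<psi>' \<eta>'"
    using res' by (simp add: minimal_graded_free_resolution_def)
  show "t < s' 0 \<Longrightarrow> \<eta>' (basis_vec A (s' 0) t) \<in> mcomp (gr M) (d' 0 t)" for t
    using res' basis_vec_mcomp[of t "s' 0" "d' 0"] by (auto simp: minimal_graded_free_resolution_def)
  show "t < s' (Suc i) \<Longrightarrow> \<psi>' (Suc i) (basis_vec A (s' (Suc i)) t)
      \<in> mcomp (graded_free_module A (s' i) (d' i)) (d' (Suc i) t)" for i t
  proof -
    assume "t < s' (Suc i)"
    from imageI[OF basis_vec_mcomp[OF this, of "d' (Suc i)"], of "\<psi>' (Suc i)"] show ?thesis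
      using res' unfolding minimal_graded_free_resolution_def by blast
  qed
  show "y \<in> carrier (gr M) \<Longrightarrow> y \<in> mcomp (gr M) j \<Longrightarrow>
      \<exists>x\<in>carrier (FA 0). x \<in> mcomp (graded_free_module A (s 0) (d 0)) j \<and> \<eta> x = y" for y j
    by (rule homogeneous_lift_aug)
  show "y \<in> \<psi> (Suc i) ` carrier (FA (Suc i)) \<Longrightarrow> y \<in> mcomp (graded_free_module A (s i) (d i)) j \<Longrightarrow>
    \<exists>x\<in>carrier (FA (Suc i)). x \<in> mcomp (graded_free_module A (s (Suc i)) (d (Suc i))) j \<and> \<psi> (Suc i) x = y" for y i j
    by (rule homogeneous_lift_diff)
  show "f \<in> module_hom A (free_module A (s' i)) (FA i) \<Longrightarrow>
      (\<And>t. t < s' i \<Longrightarrow> f (basis_vec A (s' i) t) \<in> mcomp (graded_free_module A (s i) (d i)) (d' i t)) \<Longrightarrow>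
      v \<in> mcomp (graded_free_module A (s' i) (d' i)) j \<Longrightarrow>
      f v \<in> mcomp (graded_free_module A (s i) (d i)) j" for f i j v
    by (rule mcomp_hom)
qed

text \<open>If \<open>d' i t\<close> differed from \<open>\<delta> i\<close>, the homogeneous image
  of the basis vector under the comparison map would have all coordinates in the irrelevant ideal,
  and so would the basis vector itself, since comparison maps reflect this. The same contradiction
  arises if the pure resolution is zero in stage \<open>i\<close>.\<close>

lemma degrees_unique:
  assumes res': "minimal_graded_free_resolution A (gr M) s' d' \<psi>' \<eta>'" and t: "t < s' i"
  shows "s i \<noteq> 0" "d' i t = \<delta> i"
proof -
  interpret A: cring A by (rule A_cring)
  interpret T: two_resolutions A "irrelevant_ideal A" "gr M" s' \<psi>' \<eta>' s \<psi> \<eta> d'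
    "\<lambda>i j. mcomp (graded_free_module A (s' i) (d' i)) j" "\<lambda>i j. mcomp (graded_free_module A (s i) (d i)) j"
    "\<lambda>j. mcomp (gr M) j" by (rule graded_two_resolutions[OF res'])
  let ?e = "basis_vec A (s' i) t"
  have "s i \<noteq> 0 \<and> d' i t = \<delta> i"
  proof (rule ccontr)
    assume neg: "\<not> ?thesis"
    obtain f g h where c: "T.comparison i f g h" using T.comparison_exists by blast
    then have fm: "f ?e \<in> mcomp (graded_free_module A (s i) (d i)) (d' i t)"
      using t unfolding T.comparison_def by blast
    interpret I: ideal "irrelevant_ideal A" A by (rule irrelevant_ideal_ideal)
    have "f ?e u \<in> irrelevant_ideal A" if u: "u < s i" for u
    proof -
      have ne: "d' i t \<noteq> \<delta> i" using neg u by auto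
      have "f ?e u \<in> (if \<delta> i \<le> d' i t then gcomp A (d' i t - \<delta> i) else {\<zero>\<^bsub>A\<^esub>})"
        using fm u pure[OF u] by (auto simp: graded_free_module_simps)
      then show ?thesis using ne subsetD[OF gcomp_irrelevant[of "d' i t - \<delta> i"]] I.zero_closed
        by (cases "\<delta> i \<le> d' i t") auto
    qed
    moreover have "f ?e \<in> carrier (FA i)" using fm by (simp add: graded_free_module_simps)
    ultimately have "f ?e \<in> ideal_smult (irrelevant_ideal A) (FA i)"
      unfolding A.ideal_smult_free_module[OF irrelevant_ideal_ideal] free_module_simps by (auto simp: PiE_iff)
    then have "?e \<in> ideal_smult (irrelevant_ideal A) (free_module A (s' i))"
      by (rule T.comparison_reflects[OF c A.basis_vec_closed])
    then show False
      using A.basis_vec_notin[OF irrelevant_ideal_ideal one_notin_irrelevant t] by contradiction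
  qed
  then show "s i \<noteq> 0" "d' i t = \<delta> i" by auto
qed

text \<open>
  The column is transported to the lifted resolution by comparison maps \<open>f\<close>, \<open>g\<close>; as \<open>g f\<close> is the identity
  modulo \<open>m\<close>, the image of a basis vector stays outside \<open>m F\<close>.
\<close>

lemma column_order:
  assumes res': "minimal_free_resolution R m M r \<phi> \<epsilon>" and t: "t < r (Suc i)"
    and gap: "s (Suc i) \<noteq> 0 \<Longrightarrow> gap i = 1"
  shows "has_order R m (free_module R (r i)) (\<phi> (Suc i) (basis_vec R (r (Suc i)) t)) 1"
proof -
  have lres: "free_resolution R M s (\<lambda>j. \<Phi> (j - 1)) \<Phi>0"
    using lifted_free_resolution by (simp add: minimal_free_resolution_def)
  interpret T: two_resolutions R m M r \<phi> \<epsilon> s "\<lambda>j. \<Phi> (j - 1)" \<Phi>0 "\<lambda>_ _. 0"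
    "\<lambda>_ _. UNIV" "\<lambda>_ _. UNIV" "\<lambda>_. UNIV"
  proof (rule two_resolutions.intro[OF is_cring two_resolutions_axioms.intro[OF m_ideal res' lres]])
    show "y \<in> carrier M \<Longrightarrow> \<exists>x\<in>carrier (FR 0). x \<in> UNIV \<and> \<Phi>0 x = y" for y
      unfolding aug_surj[symmetric] by blast
    show "y \<in> \<Phi> (Suc i - 1) ` carrier (FR (Suc i)) \<Longrightarrow>
      \<exists>x\<in>carrier (FR (Suc i)). x \<in> UNIV \<and> \<Phi> (Suc i - 1) x = y" for y i by blast
  qed auto
  let ?e = "basis_vec R (r (Suc i)) t"
  obtain f g h where c: "T.comparison i f g h" using T.comparison_exists by blast
  from T.comparison_Suc[OF c] obtain f' g' h' where c': "T.comparison (Suc i) f' g' h'"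
    and com: "\<And>v. v \<in> carrier (free_module R (r (Suc i))) \<Longrightarrow> \<Phi> i (f' v) = f (\<phi> (Suc i) v)" by auto
  have f: "f \<in> module_hom R (free_module R (r i)) (FR i)"
    and f': "f' \<in> module_hom R (free_module R (r (Suc i))) (FR (Suc i))"
    using c c' unfolding T.comparison_def by blast+
  have f'e: "f' ?e \<in> carrier (FR (Suc i))" by (rule module_homD(1)[OF f' basis_vec_closed])
  have "\<phi> (Suc i) ?e \<in> Mp (free_module R (r i)) (Suc 0)"
    using T.minimal[of i] basis_vec_closed unfolding Mp_1 by blast
  moreover have "\<phi> (Suc i) ?e \<notin> Mp (free_module R (r i)) (Suc (Suc 0))"
  proof
    assume "\<phi> (Suc i) ?e \<in> Mp (free_module R (r i)) (Suc (Suc 0))"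
    then have "f (\<phi> (Suc i) ?e) \<in> Mp (FR i) (Suc (Suc 0))" by (rule Mp_hom[OF Fm Fm f])
    then have o: "\<Phi> i (f' ?e) \<in> Mp (FR i) (Suc (Suc 0))" using com[OF basis_vec_closed] by simp
    have "f' ?e \<in> Mp (FR (Suc i)) (Suc 0)"
    proof (cases "s (Suc i) = 0")
      case True
      have "\<zero>\<^bsub>FR (Suc i)\<^esub> \<in> carrier (FR (Suc i))" using Mp_free_carr Mp_rules(2)[OF Fm] by blast
      with f'e have "f' ?e = \<zero>\<^bsub>FR (Suc i)\<^esub>" unfolding True by (rule free_module_0_eq)
      then show ?thesis using Mp_rules(2)[OF Fm] by simp
    next
      case False
      then show ?thesis using order_reflect[OF f'e] o gap by simp
    qed
    then have "?e \<in> ideal_smult m (free_module R (r (Suc i)))"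
      unfolding Mp_1 by (rule T.comparison_reflects[OF c' basis_vec_closed])
    then show False using basis_vec_notin[OF m_ideal one_notin t] by contradiction
  qed
  ultimately show ?thesis by (simp add: has_order_def)
qed

end

section \<open>Decomposable maximal ideals\<close>

text \<open>What is used of a fibre product. The decomposition is compatible with all positive
  powers of \<open>m\<close>, so that the order of a vector is attained by one of its two parts; the
  power zero is excluded because \<open>1\<close> does not split in a fibre product.\<close>

locale split_adic = noetherian_local_adic R m for R (structure) and m +
  fixes J1 J2
  assumes J1_ideal: "ideal J1 R" and J2_ideal: "ideal J2 R" and J_int: "J1 \<inter> J2 = {\<zero>}"
    and J_split: "n \<noteq> 0 \<Longrightarrow> x \<in> mpow n \<Longrightarrow> \<exists>x1\<in>J1 \<inter> mpow n. \<exists>x2\<in>J2 \<inter> mpow n. x = x1 \<oplus> x2"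
    and J1_notin: "\<exists>b\<in>J1 \<inter> m. b \<notin> mpow 2" and J2_notin: "\<exists>b\<in>J2 \<inter> m. b \<notin> mpow 2"

locale lifted_split = lifted_resolution R m M s d \<psi> \<eta> \<delta> \<Phi>0 \<Phi> + split_adic R m J1 J2
  for R (structure) and m and M :: "('a, 'c, 'd) module_scheme" and s d \<psi> \<eta> \<delta>
    and \<Phi>0 :: "(nat \<Rightarrow> 'a) \<Rightarrow> 'c" and \<Phi> :: "nat \<Rightarrow> (nat \<Rightarrow> 'a) \<Rightarrow> (nat \<Rightarrow> 'a)" and J1 J2
begin

text \<open>If \<open>y = \<Phi> x\<close>, then \<open>b x\<close> is a relation of order one, since \<open>b y = 0\<close>.\<close>

lemma gap_of_annihilated:
  assumes J: "ideal J R" "ideal J' R" "J \<inter> J' = {\<zero>}"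
    and b: "b \<in> J'" "b \<in> m" "b \<notin> mpow 2"
    and y: "y \<in> ({..<s (Suc i)} \<rightarrow>\<^sub>E J)" "\<Phi> i y = \<zero>\<^bsub>FR i\<^esub>"
      "y \<in> Mp (FR (Suc i)) (gap (Suc i))" "y \<notin> Mp (FR (Suc i)) (Suc (gap (Suc i)))"
  shows "s (Suc (Suc (Suc i))) \<noteq> 0 \<and> gap (Suc (Suc i)) = 1"
proof -
  interpret J: ideal J R by (rule J(1))
  interpret J': ideal J' R by (rule J(2))
  interpret F1: module R "FR (Suc i)" by (rule Fm)
  interpret F2: module R "FR (Suc (Suc i))" by (rule Fm)
  have bc: "b \<in> carrier R" using b(1) J'.Icarr by blast
  have yc: "y \<in> carrier (FR (Suc i))" using y(3) Mp_free_carr by blast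
  then obtain x where x: "x \<in> carrier (FR (Suc (Suc i)))" "y = \<Phi> (Suc i) x"
    using y(2) exact[of i] by blast
  \<comment> \<open>If \<open>x\<close> were in \<open>m F\<close>, then \<open>y\<close> would have
    order above \<open>gap (Suc i)\<close>; so some coordinate of \<open>x\<close> is a
    unit.\<close>
  have "x \<notin> Mp (FR (Suc (Suc i))) (Suc 0)" using \<Phi>_Mp[of x "Suc i" "Suc 0"] y(4) x(2) by auto
  then obtain t where t: "t < s (Suc (Suc i))" "x t \<notin> m"
    using x(1) unfolding Mp_free by (auto simp: free_module_simps PiE_iff)
  have u: "x t \<in> Units R" by (rule unit_of_notin[OF free_module_coord_closed[OF x(1) t(1)] t(2)])
  let ?bx = "b \<odot>\<^bsub>FR (Suc (Suc i))\<^esub> x"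
  have bxc: "?bx \<in> carrier (FR (Suc (Suc i)))" using bc x(1) by simp
  have "b \<odot>\<^bsub>FR (Suc i)\<^esub> y = \<zero>\<^bsub>FR (Suc i)\<^esub>"
  proof (rule free_module_eqI[OF _ F1.zero_closed])
    show "b \<odot>\<^bsub>FR (Suc i)\<^esub> y \<in> carrier (FR (Suc i))" using bc yc by simp
    fix k assume k: "k < s (Suc i)"
    have "y k \<in> J" using y(1) k by auto
    then have "b \<otimes> y k \<in> J \<inter> J'" using bc b(1) J.I_l_closed J'.I_r_closed J.Icarr by blast
    then show "(b \<odot>\<^bsub>FR (Suc i)\<^esub> y) k = \<zero>\<^bsub>FR (Suc i)\<^esub> k" using k J(3) by simp
  qed
  then have "\<Phi> (Suc i) ?bx = \<zero>\<^bsub>FR (Suc i)\<^esub>" using module_homD(3)[OF \<Phi>_hom bc x(1)] x(2) by simp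
  then have "?bx \<in> \<Phi> (Suc (Suc i)) ` carrier (FR (Suc (Suc (Suc i))))"
    unfolding exact using bxc by simp
  then obtain v where v: "v \<in> carrier (FR (Suc (Suc (Suc i))))" "?bx = \<Phi> (Suc (Suc i)) v" by blast
  \<comment> \<open>At the coordinate \<open>t\<close> the entry of this vector is \<open>b\<close>
    times a unit.\<close>
  have nin: "?bx \<notin> Mp (FR (Suc (Suc i))) 2"
  proof
    assume "?bx \<in> Mp (FR (Suc (Suc i))) 2"
    then have "b \<otimes> x t \<in> mpow 2" using Mp_free_coord[OF _ t(1)] t(1) by fastforce
    then have "(b \<otimes> x t) \<otimes> inv (x t) \<in> mpow 2"
      by (rule ideal.I_r_closed[OF mpow_ideal]) (use u in simp)
    moreover have "(b \<otimes> x t) \<otimes> inv (x t) = b" using bc u by (simp add: m_assoc Units_closed)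
    ultimately show False using b(3) by simp
  qed
  have s3: "s (Suc (Suc (Suc i))) \<noteq> 0"
  proof
    assume s0: "s (Suc (Suc (Suc i))) = 0"
    interpret F3: module R "FR (Suc (Suc (Suc i)))" by (rule Fm)
    have "v = \<zero>\<^bsub>FR (Suc (Suc (Suc i)))\<^esub>"
      using v(1) F3.zero_closed unfolding s0 by (rule free_module_0_eq)
    then have "?bx = \<zero>\<^bsub>FR (Suc (Suc i))\<^esub>" using v(2) module_hom_zero[OF Fm Fm \<Phi>_hom] by simp
    then show False using nin Mp_rules(2)[OF Fm] by simp
  qed
  \<comment> \<open>All boundaries lie in the power of \<open>m\<close> given by the gap, whereas
    \<open>b x\<close> is a boundary outside m^2 F.\<close>
  have "gap (Suc (Suc i)) < 2"
  proof (rule ccontr)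
    assume "\<not> gap (Suc (Suc i)) < 2"
    then have le: "2 \<le> 0 + gap (Suc (Suc i))" by simp
    have "v \<in> Mp (FR (Suc (Suc (Suc i)))) 0" using v(1) Mp_0[OF Fm] by simp
    from subsetD[OF Mp_antimono[OF Fm le] \<Phi>_Mp[OF this]] show False using nin v(2) by simp
  qed
  then show ?thesis using s3 degree_less[of "Suc (Suc i)"] by simp
qed

lemma gap_eq_1:
  assumes s2: "s (Suc (Suc i)) \<noteq> 0"
  shows "s (Suc (Suc (Suc i))) \<noteq> 0 \<and> gap (Suc (Suc i)) = 1"
proof -
  interpret F0: module R "FR i" by (rule Fm)
  interpret F1: module R "FR (Suc i)" by (rule Fm)
  interpret I1: ideal J1 R by (rule J1_ideal)
  interpret I2: ideal J2 R by (rule J2_ideal)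
  let ?a = "gap (Suc i)"
  have a: "?a \<noteq> 0" using degree_less[OF s2] by simp
  define e where "e = basis_vec R (s (Suc (Suc i))) 0"
  have ec: "e \<in> carrier (FR (Suc (Suc i)))" unfolding e_def by simp
  define y where "y = \<Phi> (Suc i) e"
  have ya: "y \<in> Mp (FR (Suc i)) ?a" unfolding y_def e_def using s2 by (intro \<Phi>_col) simp
  have yn: "y \<notin> Mp (FR (Suc i)) (Suc ?a)"
  proof
    assume "y \<in> Mp (FR (Suc i)) (Suc ?a)"
    then have "e \<in> Mp (FR (Suc (Suc i))) (Suc 0)" unfolding y_def by (rule order_reflect[OF ec])
    then show False unfolding Mp_1 e_def using s2 basis_vec_notin[OF m_ideal one_notin] by blast
  qed
  have "\<forall>t. \<exists>x1 x2. t < s (Suc i) \<longrightarrow> x1 \<in> J1 \<and> x1 \<in> mpow ?a \<and> x2 \<in> J2 \<and> x2 \<in> mpow ?a \<and> y t = x1 \<oplus> x2"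
    using J_split[OF a] Mp_free_coord[OF ya] by blast
  then obtain x1 x2 where x: "\<And>t. t < s (Suc i) \<Longrightarrow> x1 t \<in> J1 \<and> x1 t \<in> mpow ?a \<and> x2 t \<in> J2 \<and> x2 t \<in> mpow ?a \<and>
    y t = x1 t \<oplus> x2 t" by metis
  define y1 where "y1 = (\<lambda>t\<in>{..<s (Suc i)}. x1 t)"
  define y2 where "y2 = (\<lambda>t\<in>{..<s (Suc i)}. x2 t)"
  have yJ: "y1 \<in> ({..<s (Suc i)} \<rightarrow>\<^sub>E J1)" "y2 \<in> ({..<s (Suc i)} \<rightarrow>\<^sub>E J2)"
    and ym: "y1 \<in> Mp (FR (Suc i)) ?a" "y2 \<in> Mp (FR (Suc i)) ?a"
    using x unfolding y1_def y2_def Mp_free by auto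
  have yc: "y1 \<in> carrier (FR (Suc i))" "y2 \<in> carrier (FR (Suc i))" "y \<in> carrier (FR (Suc i))"
    using ym ya Mp_free_carr by auto
  have sum: "y = y1 \<oplus>\<^bsub>FR (Suc i)\<^esub> y2"
    by (rule free_module_eqI[OF yc(3)]) (use yc x in \<open>auto simp: y1_def y2_def\<close>)
  \<comment> \<open>By linearity \<open>\<Phi> i\<close> maps \<open>J1 F\<close> into
    \<open>J1 F\<close> and \<open>J2 F\<close> into \<open>J2 F\<close>. As \<open>J1\<close> and
    \<open>J2\<close> meet in zero, the images of \<open>y1\<close> and \<open>y2\<close> can cancel
    only if both vanish.\<close>
  have PJ: "\<Phi> i y1 \<in> ({..<s i} \<rightarrow>\<^sub>E J1)" "\<Phi> i y2 \<in> ({..<s i} \<rightarrow>\<^sub>E J2)"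
    using ideal_smult_hom[OF Fm Fm \<Phi>_hom J1_ideal, of y1 i] ideal_smult_hom[OF Fm Fm \<Phi>_hom J2_ideal, of y2 i] yJ
    unfolding ideal_smult_free_module[OF J1_ideal] ideal_smult_free_module[OF J2_ideal] by auto
  have Pc: "\<Phi> i y1 \<in> carrier (FR i)" "\<Phi> i y2 \<in> carrier (FR i)" using yc module_homD(1)[OF \<Phi>_hom] by auto
  have "y \<in> \<Phi> (Suc i) ` carrier (FR (Suc (Suc i)))" unfolding y_def using ec by blast
  then have "\<Phi> i y = \<zero>\<^bsub>FR i\<^esub>" unfolding exact by simp
  then have "\<Phi> i y1 \<oplus>\<^bsub>FR i\<^esub> \<Phi> i y2 = \<zero>\<^bsub>FR i\<^esub>"
    using module_homD(2)[OF \<Phi>_hom yc(1,2)] unfolding sum by simp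
  then have coord: "\<Phi> i y1 t \<oplus> \<Phi> i y2 t = \<zero>" if "t < s i" for t
    using that free_module_coord[OF that] by metis
  have z1: "\<Phi> i y1 t = \<zero>" and z2: "\<Phi> i y2 t = \<zero>" if t: "t < s i" for t
  proof -
    have c: "\<Phi> i y1 t \<in> J1" "\<Phi> i y2 t \<in> J2" using PJ t by auto
    have cc: "\<Phi> i y1 t \<in> carrier R" "\<Phi> i y2 t \<in> carrier R" using c I1.Icarr I2.Icarr by auto
    have "\<Phi> i y1 t = \<ominus> (\<Phi> i y2 t)" using coord[OF t] cc by (simp add: minus_equality)
    then have "\<Phi> i y1 t \<in> J1 \<inter> J2" using c I2.a_inv_closed by simp
    then show "\<Phi> i y1 t = \<zero>" using J_int by simp
    then show "\<Phi> i y2 t = \<zero>" using coord[OF t] cc by simp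
  qed
  have k: "\<Phi> i y1 = \<zero>\<^bsub>FR i\<^esub>" "\<Phi> i y2 = \<zero>\<^bsub>FR i\<^esub>"
    using free_module_eqI[OF Pc(1) F0.zero_closed] free_module_eqI[OF Pc(2) F0.zero_closed] z1 z2 by auto
  have "y1 \<notin> Mp (FR (Suc i)) (Suc ?a) \<or> y2 \<notin> Mp (FR (Suc i)) (Suc ?a)"
    using yn Mp_rules(3)[OF Fm] sum by blast
  then show ?thesis
  proof
    assume "y1 \<notin> Mp (FR (Suc i)) (Suc ?a)"
    moreover obtain b where "b \<in> J2" "b \<in> m" "b \<notin> mpow 2" using J2_notin by blast
    ultimately show ?thesis by (rule gap_of_annihilated[OF J1_ideal J2_ideal J_int _ _ _ yJ(1) k(1) ym(1), rotated 3])
  next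
    assume "y2 \<notin> Mp (FR (Suc i)) (Suc ?a)"
    moreover obtain b where "b \<in> J1" "b \<in> m" "b \<notin> mpow 2" using J1_notin by blast
    moreover have "J2 \<inter> J1 = {\<zero>}" using J_int by blast
    ultimately show ?thesis using gap_of_annihilated[OF J2_ideal J1_ideal _ _ _ _ yJ(2) k(2) ym(2)] by blast
  qed
qed

lemma degree_linear:
  assumes "s (Suc (Suc n)) \<noteq> 0" shows "\<delta> (Suc (Suc n)) = \<delta> 2 + n"
  using assms
proof (induct n)
  case 0
  then show ?case by (simp add: numeral_2_eq_2)
next
  case (Suc n)
  then have "s (Suc (Suc n)) \<noteq> 0"
    using minimal_rank_zero[OF A_cring res_min irrelevant_ideal_ideal one_notin_irrelevant, of "Suc (Suc n)"] by auto
  then show ?case using Suc(1) gap_eq_1[of n] degree_less[OF Suc(2)] by simp linarith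
qed

lemma second_syzygy_linear:
  assumes res': "minimal_graded_free_resolution A (gr M) s' d' \<psi>' \<eta>'"
  shows "has_linear_resolution A (graded_syzygy A s' d' \<psi>' 2)"
proof -
  have "j = \<delta> 2 + i" if nz: "graded_betti (\<lambda>i. s' (Suc (Suc i))) (\<lambda>i. d' (Suc (Suc i))) i j \<noteq> 0" for i j
  proof -
    have "{t. t < s' (Suc (Suc i)) \<and> d' (Suc (Suc i)) t = j} \<noteq> {}"
      using nz unfolding graded_betti_def by (metis card.empty)
    then obtain t where t: "t < s' (Suc (Suc i))" "d' (Suc (Suc i)) t = j" by blast
    show ?thesis using degrees_unique[OF res' t(1)] degree_linear[of i] t(2) by simp
  qed
  then show ?thesis
    using second_syzygy_resolution[OF res'] unfolding has_linear_resolution_def by blast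
qed

lemma column_order_1:
  assumes "minimal_free_resolution R m M r \<phi> \<epsilon>" "2 < j" "t < r j"
  shows "has_order R m (free_module R (r (j - 1))) (matrix_column R r \<phi> j t) 1"
proof -
  \<comment> \<open>The differential of index \<open>j\<close> is governed by
    \<open>gap (j - 1)\<close>, and \<open>gap_eq_1\<close> reaches the gaps with index at least
    two; this is where \<open>j > 2\<close> enters.\<close>
  define i where "i = j - 3"
  have j: "j = Suc (Suc (Suc i))" using assms(2) by (simp add: i_def)
  have "gap (Suc (Suc i)) = 1" if "s (Suc (Suc (Suc i))) \<noteq> 0"
  proof -
    have "s (Suc (Suc i)) \<noteq> 0"
      using that minimal_rank_zero[OF A_cring res_min irrelevant_ideal_ideal one_notin_irrelevant, of "Suc (Suc i)"]
      by auto
    then show ?thesis using gap_eq_1 by blast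
  qed
  then show ?thesis
    using column_order[OF assms(1), of t "Suc (Suc i)"] assms(3) unfolding j matrix_column_def by simp
qed

end

section \<open>Fibre products of local rings\<close>

lemma (in cring) ideal_of_closed:
  assumes "\<And>x. x \<in> I \<Longrightarrow> x \<in> carrier R" "\<zero> \<in> I" "\<And>x. x \<in> I \<Longrightarrow> \<ominus> x \<in> I"
    and "\<And>x y. x \<in> I \<Longrightarrow> y \<in> I \<Longrightarrow> x \<oplus> y \<in> I"
    and "\<And>r x. r \<in> carrier R \<Longrightarrow> x \<in> I \<Longrightarrow> r \<otimes> x \<in> I"
  shows "ideal I R"
proof (rule idealI[OF ring_axioms])
  show "subgroup I (add_monoid R)" by (rule add.subgroupI) (use assms in auto)
  fix x r assume "x \<in> I" "r \<in> carrier R"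
  then show "r \<otimes> x \<in> I" "x \<otimes> r \<in> I" using assms(1,5) m_comm[of x r] by auto
qed

lemma ideal_image:
  assumes S: "ring S" and h: "h \<in> ring_hom R S" and surj: "h ` carrier R = carrier S" and I: "ideal I R"
  shows "ideal (h ` I) S"
proof -
  interpret h: ring_hom_ring R S h
    by (rule ring_hom_ringI2[OF ideal.axioms(2)[OF I] S h])
  note zero = additive_subgroup.zero_closed[OF ideal.axioms(1)[OF I]]
    and minus = additive_subgroup.a_inv_closed[OF ideal.axioms(1)[OF I]]
    and add = additive_subgroup.a_closed[OF ideal.axioms(1)[OF I]]
    and carr = ideal.Icarr[OF I] and mult = ideal.I_l_closed[OF I] ideal.I_r_closed[OF I]
  show ?thesis
  proof (rule idealI[OF S])
    show "subgroup (h ` I) (add_monoid S)"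
    proof (rule h.S.add.subgroupI)
      show "h ` I \<noteq> {}" using imageI[OF zero, of h] by (metis empty_iff)
      fix a assume "a \<in> h ` I"
      then obtain x where x: "x \<in> I" "a = h x" by blast
      have "h (\<ominus>\<^bsub>R\<^esub> x) \<in> h ` I" using minus[OF x(1)] by (rule imageI)
      then show "\<ominus>\<^bsub>S\<^esub> a \<in> h ` I" using x carr by simp
      fix b assume "b \<in> h ` I"
      then obtain y where y: "y \<in> I" "b = h y" by blast
      have "h (x \<oplus>\<^bsub>R\<^esub> y) \<in> h ` I" using add[OF x(1) y(1)] by (rule imageI)
      then show "a \<oplus>\<^bsub>S\<^esub> b \<in> h ` I" using x y carr by simp
    qed (use carr in auto)
    fix a r assume "a \<in> h ` I" and r: "r \<in> carrier S"
    then obtain x where x: "x \<in> I" "a = h x" by blast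
    obtain r' where r': "r' \<in> carrier R" "r = h r'" using r surj by blast
    have "h (r' \<otimes>\<^bsub>R\<^esub> x) \<in> h ` I" using mult(1)[OF x(1) r'(1)] by (rule imageI)
    then show "r \<otimes>\<^bsub>S\<^esub> a \<in> h ` I" using x r' carr by simp
    have "h (x \<otimes>\<^bsub>R\<^esub> r') \<in> h ` I" using mult(2)[OF x(1) r'(1)] by (rule imageI)
    then show "a \<otimes>\<^bsub>S\<^esub> r \<in> h ` I" using x r' carr by simp
  qed
qed

lemma maximal_ideal_containing:
  assumes cr: "cring R" and no: "noetherian_ring R" and a: "a \<in> carrier R" "a \<notin> Units R"
  shows "\<exists>I. maximalideal I R \<and> a \<in> I"
proof -
  interpret cring R by fact
  interpret noetherian_ring R by fact
  let ?S = "{I. ideal I R \<and> a \<in> I \<and> I \<noteq> carrier R}"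
  have "PIdl\<^bsub>R\<^esub> a \<noteq> carrier R"
  proof
    assume "PIdl\<^bsub>R\<^esub> a = carrier R"
    then have "\<one>\<^bsub>R\<^esub> \<in> PIdl\<^bsub>R\<^esub> a" by simp
    then obtain b where "b \<in> carrier R" "\<one>\<^bsub>R\<^esub> = b \<otimes>\<^bsub>R\<^esub> a" by (auto simp: cgenideal_def)
    then have "a \<in> Units R" using a(1) m_comm[of a b] by (auto simp: Units_def)
    then show False using a(2) by simp
  qed
  then have "PIdl\<^bsub>R\<^esub> a \<in> ?S" using cgenideal_ideal[OF a(1)] cgenideal_self[OF a(1)] by simp
  then have ne: "?S \<noteq> {}" by (metis empty_iff)
  have "\<exists>I\<in>?S. \<forall>J\<in>?S. I \<subseteq> J \<longrightarrow> J = I" by (rule maximal_ideal_principle[OF _ ne]) simp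
  then obtain I where I: "I \<in> ?S" "\<forall>J\<in>?S. I \<subseteq> J \<longrightarrow> J = I" by (rule bexE)
  have "maximalideal I R"
  proof (rule maximalidealI)
    fix J assume J: "ideal J R" "I \<subseteq> J" "J \<subseteq> carrier R"
    have "a \<in> J" using I(1) J(2) by auto
    then show "J = I \<or> J = carrier R" using I(2)[rule_format, of J] J by blast
  qed (use I(1) in auto)
  then show ?thesis using I(1) by auto
qed

text \<open>The residue map is any surjection onto a field. Its kernel is a maximal ideal, hence the
  only one of the local ring, which identifies the map with the natural projection.\<close>

locale residue_map =
  fixes R :: "('a, 'x) ring_scheme" and k :: "('k, 'y) ring_scheme" and \<pi>
  assumes loc: "local_ring R" and noe: "noetherian_ring R" and k: "field k"
    and hom: "\<pi> \<in> ring_hom R k" and surj: "\<pi> ` carrier R = carrier k"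
begin

lemma cr: "cring R" using loc by (simp add: local_ring_def)

sublocale R: cring R by (rule cr)
sublocale k: field k by (rule k)
sublocale \<pi>: ring_hom_cring R k \<pi>
  by unfold_locales (rule hom)

lemma kernel_maximal: "maximalideal {a \<in> carrier R. \<pi> a = \<zero>\<^bsub>k\<^esub>} R"
proof (rule maximalidealI)
  show idl: "ideal {a \<in> carrier R. \<pi> a = \<zero>\<^bsub>k\<^esub>} R"
    by (rule idealI[OF R.ring_axioms]) (auto intro!: R.add.subgroupI)
  show "carrier R \<noteq> {a \<in> carrier R. \<pi> a = \<zero>\<^bsub>k\<^esub>}"
  proof
    assume "carrier R = {a \<in> carrier R. \<pi> a = \<zero>\<^bsub>k\<^esub>}"
    then have "\<one>\<^bsub>R\<^esub> \<in> {a \<in> carrier R. \<pi> a = \<zero>\<^bsub>k\<^esub>}" using R.one_closed by (rule subst)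
    then show False using k.one_not_zero by simp
  qed
  fix J assume J: "ideal J R" "{a \<in> carrier R. \<pi> a = \<zero>\<^bsub>k\<^esub>} \<subseteq> J" "J \<subseteq> carrier R"
  interpret J: ideal J R by (rule J(1))
  show "J = {a \<in> carrier R. \<pi> a = \<zero>\<^bsub>k\<^esub>} \<or> J = carrier R"
  proof (rule disjCI)
    assume "J \<noteq> carrier R"
    have "\<pi> a = \<zero>\<^bsub>k\<^esub>" if a: "a \<in> J" for a
    proof (rule ccontr)
      assume n: "\<pi> a \<noteq> \<zero>\<^bsub>k\<^esub>"
      have ac: "a \<in> carrier R" using a J.Icarr by blast
      then have u: "\<pi> a \<in> Units k" using n k.field_Units by simp
      then obtain b where b: "b \<in> carrier R" "\<pi> b = inv\<^bsub>k\<^esub> (\<pi> a)"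
        using surj k.Units_inv_closed by (metis imageE)
      have "\<pi> (a \<otimes>\<^bsub>R\<^esub> b \<ominus>\<^bsub>R\<^esub> \<one>\<^bsub>R\<^esub>) = \<zero>\<^bsub>k\<^esub>"
        using ac b u by (simp add: a_minus_def k.r_neg)
      then have c: "a \<otimes>\<^bsub>R\<^esub> b \<ominus>\<^bsub>R\<^esub> \<one>\<^bsub>R\<^esub> \<in> J" using J(2) ac b by auto
      have ab: "a \<otimes>\<^bsub>R\<^esub> b \<in> J" using a b J.I_r_closed by blast
      have "\<one>\<^bsub>R\<^esub> = a \<otimes>\<^bsub>R\<^esub> b \<oplus>\<^bsub>R\<^esub> (\<ominus>\<^bsub>R\<^esub> (a \<otimes>\<^bsub>R\<^esub> b \<ominus>\<^bsub>R\<^esub> \<one>\<^bsub>R\<^esub>))"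
        using ac b by (simp add: a_minus_def R.minus_add R.r_neg1 R.r_neg2)
      then have "\<one>\<^bsub>R\<^esub> \<in> J" using ab c J.a_closed J.a_inv_closed by metis
      then show False using J.one_imp_carrier \<open>J \<noteq> carrier R\<close> by simp
    qed
    then show "J = {a \<in> carrier R. \<pi> a = \<zero>\<^bsub>k\<^esub>}" using J(2,3) by blast
  qed
qed

lemma unit_of_nonzero:
  assumes a: "a \<in> carrier R" "\<pi> a \<noteq> \<zero>\<^bsub>k\<^esub>" shows "a \<in> Units R"
proof (rule ccontr)
  assume "a \<notin> Units R"
  then obtain I where I: "maximalideal I R" "a \<in> I"
    using maximal_ideal_containing[OF cr noe a(1)] by blast
  then have "I = {a \<in> carrier R. \<pi> a = \<zero>\<^bsub>k\<^esub>}"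
    using loc kernel_maximal unfolding local_ring_def by blast
  then show False using I(2) a(2) by simp
qed

text \<open>The form in which a factor differs from its residue field: it provides a nonzero element
  of the maximal ideal, from which an element outside the square is obtained.\<close>

lemma kernel_nontrivial:
  assumes "\<pi> \<notin> ring_iso R k"
  shows "\<exists>a\<in>carrier R. \<pi> a = \<zero>\<^bsub>k\<^esub> \<and> a \<noteq> \<zero>\<^bsub>R\<^esub>"
proof (rule ccontr)
  assume neg: "\<not> ?thesis"
  have "inj_on \<pi> (carrier R)"
  proof (rule inj_onI)
    fix x y assume xy: "x \<in> carrier R" "y \<in> carrier R" "\<pi> x = \<pi> y"
    then have "\<pi> (x \<ominus>\<^bsub>R\<^esub> y) = \<zero>\<^bsub>k\<^esub>" by (simp add: a_minus_def k.r_neg)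
    then have "x \<ominus>\<^bsub>R\<^esub> y = \<zero>\<^bsub>R\<^esub>" using neg xy by blast
    then show "x = y" using xy R.r_right_minus_eq by simp
  qed
  then have "\<pi> \<in> ring_iso R k" using hom surj by (simp add: ring_iso_def bij_betw_def)
  then show False using assms by simp
qed

end

context noetherian_local_adic
begin

text \<open>
  \<open>T\<close> is the projection of \<open>m\<close> onto the summand \<open>J\<close>. If \<open>J \<subseteq> m\<^sup>2\<close> then \<open>J \<subseteq> J m\<close>, so that \<open>J\<close> lies
  in all powers of \<open>m\<close>.
\<close>

lemma summand_not_in_square:
  assumes J: "ideal J R" and T: "\<And>x. x \<in> m \<Longrightarrow> T x \<in> J" "\<And>x. x \<in> J \<Longrightarrow> T x = x"
    "\<And>x y. x \<in> m \<Longrightarrow> y \<in> m \<Longrightarrow> T (x \<oplus> y) = T x \<oplus> T y"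
    "\<And>x y. x \<in> m \<Longrightarrow> y \<in> m \<Longrightarrow> T (x \<otimes> y) = T x \<otimes> y"
    and x: "x \<in> J" "x \<noteq> \<zero>"
  shows "\<exists>b\<in>J. b \<notin> mpow 2"
proof (rule ccontr)
  assume "\<not> ?thesis"
  then have sq: "J \<subseteq> mpow 2" by blast
  interpret J: ideal J R by (rule J)
  interpret m: ideal m R by (rule m_ideal)
  have m2: "mpow 2 = m \<cdot> m" using mpow_add[of 1 1] by (simp add: numeral_2_eq_2)
  have mm: "m \<cdot> m \<subseteq> m" using ideal_prod_inter[OF m_ideal m_ideal] by blast
  \<comment> \<open>On a product, \<open>T\<close> acts on the first factor and moves it into
    \<open>J\<close>; as sums are respected, m^2 is mapped into J m.\<close>
  have TJ: "T y \<in> J \<cdot> m" if "y \<in> m \<cdot> m" for y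
    using that
  proof (induct y rule: ideal_prod.induct)
    case (prod i j)
    then show ?case using T(1,4) ideal_prod.prod[of "T i" J j m R] by simp
  next
    case (sum u v)
    then have "T (u \<oplus> v) = T u \<oplus> T v" using mm by (intro T(3)) auto
    then show ?case using ideal_prod.sum[OF sum(2,4)] by simp
  qed
  have JJ: "J \<subseteq> J \<cdot> m" using TJ T(2) sq unfolding m2 by force
  have "J \<subseteq> mpow n" for n
  proof (induct n)
    case 0 then show ?case using J.a_subset by simp
  next
    case (Suc n)
    have "J \<cdot> m \<subseteq> mpow n \<cdot> m"
    proof
      fix y assume "y \<in> J \<cdot> m"
      then show "y \<in> mpow n \<cdot> m"
      proof (induct y rule: ideal_prod.induct)
        case (prod i j)
        then show ?case using Suc by (intro ideal_prod.prod) auto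
      next
        case (sum u v)
        then show ?case by (intro ideal_prod.sum)
      qed
    qed
    then show ?case using JJ mpow_add[of n 1] by simp
  qed
  then have xn: "x \<in> mpow n" for n using x(1) by blast
  \<comment> \<open>Krull's theorem speaks of modules; \<open>x\<close> is viewed as a vector of
    length one and the theorem is applied to the zero submodule.\<close>
  let ?F = "free_module R (Suc 0)"
  interpret F: module R ?F by (rule free_module_is_module)
  let ?v = "\<lambda>i\<in>{..<Suc 0}. x"
  have v: "?v \<in> Mp ?F n" for n unfolding Mp_free using xn by auto
  have vc: "?v \<in> carrier ?F" using Mp_carr[OF F.module_axioms v] .
  have z: "submodule {\<zero>\<^bsub>?F\<^esub>} R ?F" by (intro F.submoduleI) auto
  have "?v \<in> {\<zero>\<^bsub>?F\<^esub>}"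
    by (rule Krull_intersection[OF noetherian_free_module[OF is_cring noetherian_ring_axioms] z vc])
      (use v vc in \<open>simp add: a_minus_def\<close>)
  then have "?v = \<zero>\<^bsub>?F\<^esub>" by simp
  then have "?v 0 = \<zero>\<^bsub>?F\<^esub> 0" by (rule fun_cong)
  then show False using x(2) by simp
qed

end

locale fiber = A1: residue_map R1 k \<pi>1 + A2: residue_map R2 k \<pi>2
  for R1 :: "'a ring" and R2 :: "'b ring" and k :: "'k ring" and \<pi>1 \<pi>2 +
  assumes niso1: "\<pi>1 \<notin> ring_iso R1 k" and niso2: "\<pi>2 \<notin> ring_iso R2 k"
begin

definition R where "R = fiber_product R1 R2 \<pi>1 \<pi>2"

lemma R_simps:
  "x \<in> carrier R \<longleftrightarrow> fst x \<in> carrier R1 \<and> snd x \<in> carrier R2 \<and> \<pi>1 (fst x) = \<pi>2 (snd x)"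
  "x \<oplus>\<^bsub>R\<^esub> y = (fst x \<oplus>\<^bsub>R1\<^esub> fst y, snd x \<oplus>\<^bsub>R2\<^esub> snd y)"
  "x \<otimes>\<^bsub>R\<^esub> y = (fst x \<otimes>\<^bsub>R1\<^esub> fst y, snd x \<otimes>\<^bsub>R2\<^esub> snd y)"
  "\<zero>\<^bsub>R\<^esub> = (\<zero>\<^bsub>R1\<^esub>, \<zero>\<^bsub>R2\<^esub>)" "\<one>\<^bsub>R\<^esub> = (\<one>\<^bsub>R1\<^esub>, \<one>\<^bsub>R2\<^esub>)"
  by (auto simp: R_def fiber_product_def RDirProd_def DirProd_def monoid.defs split: prod.splits)

lemma R_cring: "cring R"
proof (rule cringI)
  show "abelian_group R"
  proof (rule abelian_groupI)
    fix x assume "x \<in> carrier R"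
    then show "\<exists>y\<in>carrier R. y \<oplus>\<^bsub>R\<^esub> x = \<zero>\<^bsub>R\<^esub>"
      by (intro bexI[of _ "(\<ominus>\<^bsub>R1\<^esub> fst x, \<ominus>\<^bsub>R2\<^esub> snd x)"]) (auto simp: R_simps A1.R.l_neg A2.R.l_neg)
  qed (auto simp: R_simps A1.R.a_ac A2.R.a_ac)
  show "comm_monoid R"
    by (rule comm_monoidI) (auto simp: R_simps A1.R.m_ac A2.R.m_ac)
qed (auto simp: R_simps A1.R.l_distr A2.R.l_distr)

sublocale R: cring R by (rule R_cring)

lemma R_minus: "x \<in> carrier R \<Longrightarrow> \<ominus>\<^bsub>R\<^esub> x = (\<ominus>\<^bsub>R1\<^esub> fst x, \<ominus>\<^bsub>R2\<^esub> snd x)"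
  by (rule R.minus_equality) (auto simp: R_simps A1.R.l_neg A2.R.l_neg)

lemma fst_onto: "a \<in> carrier R1 \<Longrightarrow> \<exists>b. (a, b) \<in> carrier R"
proof -
  assume a: "a \<in> carrier R1"
  have "\<pi>1 a \<in> \<pi>2 ` carrier R2" unfolding A2.surj by (rule A1.\<pi>.hom_closed[OF a])
  then obtain b where "b \<in> carrier R2" "\<pi>1 a = \<pi>2 b" by (rule imageE)
  then show ?thesis using a by (intro exI[of _ b]) (simp add: R_simps)
qed

lemma snd_onto: "b \<in> carrier R2 \<Longrightarrow> \<exists>a. (a, b) \<in> carrier R"
proof -
  assume b: "b \<in> carrier R2"
  have "\<pi>2 b \<in> \<pi>1 ` carrier R1" unfolding A1.surj by (rule A2.\<pi>.hom_closed[OF b])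
  then obtain a where "a \<in> carrier R1" "\<pi>2 b = \<pi>1 a" by (rule imageE)
  then show ?thesis using b by (intro exI[of _ a]) (simp add: R_simps)
qed

lemma fst_ideal:
  assumes "ideal I R" shows "ideal (fst ` I) R1"
proof (rule ideal_image[OF A1.R.ring_axioms _ _ assms])
  show "fst \<in> ring_hom R R1" by (auto simp: ring_hom_def R_simps)
  show "fst ` carrier R = carrier R1"
  proof (intro equalityI subsetI)
    fix a assume "a \<in> carrier R1"
    from fst_onto[OF this] obtain b where "(a, b) \<in> carrier R" by (rule exE)
    from imageI[OF this, of fst] show "a \<in> fst ` carrier R" by simp
  qed (auto simp: R_simps)
qed

lemma snd_ideal:
  assumes "ideal I R" shows "ideal (snd ` I) R2"
proof (rule ideal_image[OF A2.R.ring_axioms _ _ assms])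
  show "snd \<in> ring_hom R R2" by (auto simp: ring_hom_def R_simps)
  show "snd ` carrier R = carrier R2"
  proof (intro equalityI subsetI)
    fix a assume "a \<in> carrier R2"
    from snd_onto[OF this] obtain b where "(b, a) \<in> carrier R" by (rule exE)
    from imageI[OF this, of snd] show "a \<in> snd ` carrier R" by simp
  qed (auto simp: R_simps)
qed

text \<open>\<open>J1\<close> and \<open>J2\<close> are m1 x 0 and 0 x m2: when one component of an
  element of \<open>R\<close> is zero, the residue of the other must vanish.\<close>

definition J1 where "J1 = {x \<in> carrier R. snd x = \<zero>\<^bsub>R2\<^esub>}"
definition J2 where "J2 = {x \<in> carrier R. fst x = \<zero>\<^bsub>R1\<^esub>}"
definition m0 where "m0 = {x \<in> carrier R. \<pi>1 (fst x) = \<zero>\<^bsub>k\<^esub>}"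

lemma J_iff:
  "x \<in> J1 \<longleftrightarrow> fst x \<in> carrier R1 \<and> \<pi>1 (fst x) = \<zero>\<^bsub>k\<^esub> \<and> snd x = \<zero>\<^bsub>R2\<^esub>"
  "x \<in> J2 \<longleftrightarrow> snd x \<in> carrier R2 \<and> \<pi>2 (snd x) = \<zero>\<^bsub>k\<^esub> \<and> fst x = \<zero>\<^bsub>R1\<^esub>"
  "x \<in> m0 \<longleftrightarrow> fst x \<in> carrier R1 \<and> snd x \<in> carrier R2 \<and> \<pi>1 (fst x) = \<zero>\<^bsub>k\<^esub> \<and> \<pi>2 (snd x) = \<zero>\<^bsub>k\<^esub>"
  by (auto simp: J1_def J2_def m0_def R_simps)

lemma J1_ideal: "ideal J1 R"
proof (rule R.ideal_of_closed)
  show "x \<in> J1 \<Longrightarrow> \<ominus>\<^bsub>R\<^esub> x \<in> J1" for x by (subst R_minus) (auto simp: J_iff R_simps)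
qed (auto simp: J_iff R_simps)

lemma J2_ideal: "ideal J2 R"
proof (rule R.ideal_of_closed)
  show "x \<in> J2 \<Longrightarrow> \<ominus>\<^bsub>R\<^esub> x \<in> J2" for x by (subst R_minus) (auto simp: J_iff R_simps)
qed (auto simp: J_iff R_simps)

lemma m0_ideal: "ideal m0 R"
proof (rule R.ideal_of_closed)
  show "x \<in> m0 \<Longrightarrow> \<ominus>\<^bsub>R\<^esub> x \<in> m0" for x by (subst R_minus) (auto simp: J_iff R_simps)
qed (auto simp: J_iff R_simps)

text \<open>An ideal of \<open>R\<close> is an extension of an ideal of \<open>R1\<close> by an ideal of \<open>R2\<close> inside \<open>J2\<close>.\<close>

lemma R_noetherian: "noetherian_ring R"
proof (rule R.noetherian_ringI)
  interpret N1: noetherian_ring R1 by (rule A1.noe)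
  interpret N2: noetherian_ring R2 by (rule A2.noe)
  fix I assume I: "ideal I R"
  interpret I: ideal I R by (rule I)
  note I2 = R.i_intersect[OF I J2_ideal]
  obtain B where B: "B \<subseteq> carrier R1" "finite B" "fst ` I = Idl\<^bsub>R1\<^esub> B"
    using N1.finetely_gen[OF fst_ideal[OF I]] by blast
  obtain C where C: "C \<subseteq> carrier R2" "finite C" "snd ` (I \<inter> J2) = Idl\<^bsub>R2\<^esub> C"
    using N2.finetely_gen[OF snd_ideal[OF I2]] by blast
  have "B \<subseteq> fst ` I" using A1.R.genideal_self[OF B(1)] B(3) by simp
  then obtain S1 where S1: "finite S1" "S1 \<subseteq> I" "B = fst ` S1" using B(2) by (meson finite_subset_image)
  have "C \<subseteq> snd ` (I \<inter> J2)" using A2.R.genideal_self[OF C(1)] C(3) by simp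
  then obtain S2 where S2: "finite S2" "S2 \<subseteq> I \<inter> J2" "C = snd ` S2" using C(2) by (meson finite_subset_image)
  let ?S = "S1 \<union> S2"
  have Sc: "?S \<subseteq> carrier R" using S1 S2 I.a_subset by blast
  interpret J: ideal "Idl\<^bsub>R\<^esub> ?S" R by (rule R.genideal_ideal[OF Sc])
  have SJ: "?S \<subseteq> Idl\<^bsub>R\<^esub> ?S" by (rule R.genideal_self[OF Sc])
  have "I \<subseteq> Idl\<^bsub>R\<^esub> ?S"
  proof
    fix x assume x: "x \<in> I"
    have xc: "x \<in> carrier R" using x by (rule I.Icarr)
    have "Idl\<^bsub>R1\<^esub> B \<subseteq> fst ` (I \<inter> Idl\<^bsub>R\<^esub> ?S)"
      by (rule A1.R.genideal_minimal[OF fst_ideal[OF R.i_intersect[OF I J.is_ideal]]]) (use S1 SJ in auto)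
    then obtain w where w: "w \<in> I" "w \<in> Idl\<^bsub>R\<^esub> ?S" "fst x = fst w" using x B(3) by blast
    have wc: "w \<in> carrier R" using w(1) by (rule I.Icarr)
    have d: "x \<ominus>\<^bsub>R\<^esub> w \<in> I" using x w(1) by (simp add: a_minus_def)
    \<comment> \<open>After subtraction of \<open>w\<close> the first component is zero, so the
      difference lies in the part of \<open>I\<close> inside \<open>J2\<close>, where an element is
      determined by its second component.\<close>
    have "x \<ominus>\<^bsub>R\<^esub> w \<in> J2"
      using xc wc w(3) I.Icarr[OF d] by (simp add: J2_def a_minus_def R_minus R_simps A1.R.r_neg)
    then have "snd (x \<ominus>\<^bsub>R\<^esub> w) \<in> Idl\<^bsub>R2\<^esub> C" using d C(3) by blast
    moreover have "Idl\<^bsub>R2\<^esub> C \<subseteq> snd ` (Idl\<^bsub>R\<^esub> ?S \<inter> J2)"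
      by (rule A2.R.genideal_minimal[OF snd_ideal[OF R.i_intersect[OF J.is_ideal J2_ideal]]]) (use S2 SJ in auto)
    ultimately obtain u where u: "u \<in> Idl\<^bsub>R\<^esub> ?S" "u \<in> J2" "snd (x \<ominus>\<^bsub>R\<^esub> w) = snd u" by blast
    have "x \<ominus>\<^bsub>R\<^esub> w = u"
      using u(2,3) \<open>x \<ominus>\<^bsub>R\<^esub> w \<in> J2\<close> by (auto simp: J2_def prod_eq_iff)
    then have "(x \<ominus>\<^bsub>R\<^esub> w) \<oplus>\<^bsub>R\<^esub> w \<in> Idl\<^bsub>R\<^esub> ?S" using u(1) w(2) by simp
    then show "x \<in> Idl\<^bsub>R\<^esub> ?S" using xc wc by (simp add: a_minus_def R.a_assoc R.l_neg)
  qed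
  moreover have "Idl\<^bsub>R\<^esub> ?S \<subseteq> I" by (rule R.genideal_minimal[OF I]) (use S1 S2 in auto)
  ultimately show "\<exists>A\<subseteq>carrier R. finite A \<and> I = Idl\<^bsub>R\<^esub> A"
    using Sc S1(1) S2(1) by (intro exI[of _ ?S]) auto
qed

text \<open>The inverses of the two components have the same residue, both being inverse to the same
  element of \<open>k\<close>, so the pair of them belongs to \<open>R\<close>.\<close>

lemma unit_of_notin_m0:
  assumes x: "x \<in> carrier R" "x \<notin> m0" shows "x \<in> Units R"
proof -
  have n: "\<pi>1 (fst x) \<noteq> \<zero>\<^bsub>k\<^esub>" "\<pi>2 (snd x) \<noteq> \<zero>\<^bsub>k\<^esub>" "\<pi>1 (fst x) = \<pi>2 (snd x)"
    using x by (auto simp: m0_def R_simps)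
  have xc: "fst x \<in> carrier R1" "snd x \<in> carrier R2" using x(1) by (simp_all add: R_simps)
  have u: "fst x \<in> Units R1" "snd x \<in> Units R2"
    using A1.unit_of_nonzero[OF xc(1) n(1)] A2.unit_of_nonzero[OF xc(2) n(2)] .
  let ?y = "(inv\<^bsub>R1\<^esub> fst x, inv\<^bsub>R2\<^esub> snd x)"
  have ic: "inv\<^bsub>R1\<^esub> fst x \<in> carrier R1" "inv\<^bsub>R2\<^esub> snd x \<in> carrier R2" using u by auto
  have "\<pi>1 (fst x) \<otimes>\<^bsub>k\<^esub> \<pi>1 (inv\<^bsub>R1\<^esub> fst x) = \<one>\<^bsub>k\<^esub>"
    using A1.\<pi>.hom_mult[OF xc(1) ic(1)] u by simp
  moreover have "\<pi>2 (snd x) \<otimes>\<^bsub>k\<^esub> \<pi>2 (inv\<^bsub>R2\<^esub> snd x) = \<one>\<^bsub>k\<^esub>"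
    using A2.\<pi>.hom_mult[OF xc(2) ic(2)] u by simp
  ultimately have "\<pi>1 (inv\<^bsub>R1\<^esub> fst x) = \<pi>2 (inv\<^bsub>R2\<^esub> snd x)"
    using n xc ic A1.k.m_lcancel[of "\<pi>1 (fst x)" "\<pi>1 (inv\<^bsub>R1\<^esub> fst x)" "\<pi>2 (inv\<^bsub>R2\<^esub> snd x)"] by simp
  then have "?y \<in> carrier R" using ic by (simp add: R_simps)
  moreover have "?y \<otimes>\<^bsub>R\<^esub> x = \<one>\<^bsub>R\<^esub>" "x \<otimes>\<^bsub>R\<^esub> ?y = \<one>\<^bsub>R\<^esub>" using u by (simp_all add: R_simps)
  ultimately show ?thesis using x(1) unfolding Units_def by blast
qed

lemma one_notin_m0: "\<one>\<^bsub>R\<^esub> \<notin> m0"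
  using A1.k.one_not_zero by (simp add: m0_def R_simps)

lemma ideal_not_le_m0:
  assumes I: "ideal I R" "\<not> I \<subseteq> m0" shows "I = carrier R"
proof -
  interpret I: ideal I R by (rule I)
  obtain x where x: "x \<in> I" "x \<notin> m0" using I(2) by blast
  have u: "x \<in> Units R" using x I.Icarr by (intro unit_of_notin_m0) auto
  have "inv\<^bsub>R\<^esub> x \<otimes>\<^bsub>R\<^esub> x \<in> I" by (rule I.I_l_closed[OF x(1) R.Units_inv_closed[OF u]])
  then show ?thesis using I.one_imp_carrier unfolding R.Units_l_inv[OF u] by simp
qed

lemma m0_eq: "max_ideal R = m0"
proof -
  have nc: "m0 \<noteq> carrier R" using one_notin_m0 by auto
  have "maximalideal m0 R"
    by (rule maximalidealI[OF m0_ideal]) (use nc ideal_not_le_m0 in auto)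
  moreover have "I = m0" if "maximalideal I R" for I
  proof -
    interpret I: maximalideal I R by (rule that)
    have "I \<subseteq> m0" using ideal_not_le_m0[OF I.is_ideal] I.I_notcarr by blast
    then show ?thesis using I.I_maximal[OF m0_ideal] nc by (auto simp: m0_def)
  qed
  ultimately show ?thesis unfolding max_ideal_def by (intro the_equality)
qed

sublocale L: noetherian_local_adic R m0
  by (intro noetherian_local_adic.intro adic.intro adic_axioms.intro noetherian_local_adic_axioms.intro
    R_cring m0_ideal R_noetherian unit_of_notin_m0 one_notin_m0)

text \<open>The projections of \<open>m0\<close> onto its summands; on elements of \<open>R\<close>
  outside \<open>m0\<close> the values leave \<open>R\<close>.\<close>

definition T1 where "T1 x = (fst x, \<zero>\<^bsub>R2\<^esub>)"
definition T2 where "T2 x = (\<zero>\<^bsub>R1\<^esub>, snd x)"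

lemma m0_D: "x \<in> m0 \<Longrightarrow> fst x \<in> carrier R1 \<and> snd x \<in> carrier R2 \<and> \<pi>1 (fst x) = \<zero>\<^bsub>k\<^esub> \<and> \<pi>2 (snd x) = \<zero>\<^bsub>k\<^esub>"
  by (auto simp: m0_def R_simps)

lemma T_closed: "x \<in> m0 \<Longrightarrow> T1 x \<in> m0 \<inter> J1" "x \<in> m0 \<Longrightarrow> T2 x \<in> m0 \<inter> J2"
proof -
  assume "x \<in> m0"
  note m0_D[OF this]
  then show "T1 x \<in> m0 \<inter> J1" "T2 x \<in> m0 \<inter> J2"
    by (simp_all add: T1_def T2_def J1_def J2_def m0_def R_simps)
qed

lemma T_add: "x \<in> m0 \<Longrightarrow> y \<in> m0 \<Longrightarrow> T1 (x \<oplus>\<^bsub>R\<^esub> y) = T1 x \<oplus>\<^bsub>R\<^esub> T1 y"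
  "x \<in> m0 \<Longrightarrow> y \<in> m0 \<Longrightarrow> T2 (x \<oplus>\<^bsub>R\<^esub> y) = T2 x \<oplus>\<^bsub>R\<^esub> T2 y"
  by (simp_all add: T1_def T2_def R_simps)

lemma T_mult: "x \<in> carrier R \<Longrightarrow> y \<in> carrier R \<Longrightarrow> T1 (x \<otimes>\<^bsub>R\<^esub> y) = x \<otimes>\<^bsub>R\<^esub> T1 y"
  "x \<in> carrier R \<Longrightarrow> y \<in> carrier R \<Longrightarrow> T2 (x \<otimes>\<^bsub>R\<^esub> y) = x \<otimes>\<^bsub>R\<^esub> T2 y"
  "x \<in> carrier R \<Longrightarrow> y \<in> carrier R \<Longrightarrow> T1 (x \<otimes>\<^bsub>R\<^esub> y) = T1 x \<otimes>\<^bsub>R\<^esub> y"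
  "x \<in> carrier R \<Longrightarrow> y \<in> carrier R \<Longrightarrow> T2 (x \<otimes>\<^bsub>R\<^esub> y) = T2 x \<otimes>\<^bsub>R\<^esub> y"
  by (simp_all add: T1_def T2_def R_simps)

lemma m0_carr: "x \<in> m0 \<Longrightarrow> x \<in> carrier R" by (simp add: m0_def)

lemma J_le_m0: "J1 \<subseteq> m0" "J2 \<subseteq> m0"
  by (auto simp: J1_def J2_def m0_def R_simps)

text \<open>A projection of a product can be moved onto the last factor, where it stays in
  \<open>m0\<close>, and m0^n is m0^(n-1) m0.\<close>

lemma T_mpow:
  assumes n: "n \<noteq> 0" and x: "x \<in> L.mpow n" shows "T1 x \<in> L.mpow n" "T2 x \<in> L.mpow n"
proof -
  obtain k where k: "n = Suc k" using n by (cases n) auto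
  have P: "L.mpow n = L.mpow k \<cdot>\<^bsub>R\<^esub> m0" unfolding k using L.mpow_add[of k 1] by simp
  have le: "L.mpow k \<cdot>\<^bsub>R\<^esub> m0 \<subseteq> m0" using R.ideal_prod_inter[OF L.mpow_ideal m0_ideal] by blast
  have "T1 x \<in> L.mpow k \<cdot>\<^bsub>R\<^esub> m0 \<and> T2 x \<in> L.mpow k \<cdot>\<^bsub>R\<^esub> m0" if "x \<in> L.mpow k \<cdot>\<^bsub>R\<^esub> m0" for x
    using that
  proof (induct x rule: ideal_prod.induct)
    case (prod i j)
    then show ?case using T_closed[of j] L.mpow_carr[of i k] m0_carr[of j]
      by (auto simp: T_mult(1,2) intro!: ideal_prod.prod)
  next
    case (sum u v)
    then have "u \<in> m0" "v \<in> m0" using le by auto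
    then show ?case using sum by (auto simp: T_add intro!: ideal_prod.sum)
  qed
  then show "T1 x \<in> L.mpow n" "T2 x \<in> L.mpow n" using x P by auto
qed

lemma split_fiber: "split_adic R m0 J1 J2"
proof (rule split_adic.intro[OF L.noetherian_local_adic_axioms split_adic_axioms.intro[OF J1_ideal J2_ideal]])
  show "J1 \<inter> J2 = {\<zero>\<^bsub>R\<^esub>}" by (auto simp: J1_def J2_def R_simps prod_eq_iff)
next
  fix n x assume n: "n \<noteq> (0::nat)" and x: "x \<in> L.mpow n"
  have "L.mpow n \<subseteq> L.mpow 1" using n by (intro L.mpow_antimono) simp
  then have xm: "x \<in> m0" using x by auto
  have "x = T1 x \<oplus>\<^bsub>R\<^esub> T2 x" using m0_D[OF xm] by (auto simp: T1_def T2_def R_simps prod_eq_iff)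
  then show "\<exists>x1\<in>J1 \<inter> L.mpow n. \<exists>x2\<in>J2 \<inter> L.mpow n. x = x1 \<oplus>\<^bsub>R\<^esub> x2"
    using T_mpow[OF n x] T_closed[OF xm] by blast
next
  obtain a where a: "a \<in> carrier R1" "\<pi>1 a = \<zero>\<^bsub>k\<^esub>" "a \<noteq> \<zero>\<^bsub>R1\<^esub>" using A1.kernel_nontrivial[OF niso1] by blast
  have "(a, \<zero>\<^bsub>R2\<^esub>) \<in> J1" "(a, \<zero>\<^bsub>R2\<^esub>) \<noteq> \<zero>\<^bsub>R\<^esub>" using a by (auto simp: J1_def R_simps)
  then have "\<exists>b\<in>J1. b \<notin> L.mpow 2"
  proof (rule L.summand_not_in_square[OF J1_ideal, of T1, rotated 4])
    show "x \<in> m0 \<Longrightarrow> T1 x \<in> J1" for x using T_closed(1)[of x] by simp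
    show "x \<in> J1 \<Longrightarrow> T1 x = x" for x by (simp add: T1_def J1_def prod_eq_iff)
    show "x \<in> m0 \<Longrightarrow> y \<in> m0 \<Longrightarrow> T1 (x \<oplus>\<^bsub>R\<^esub> y) = T1 x \<oplus>\<^bsub>R\<^esub> T1 y" for x y by (rule T_add(1))
    show "x \<in> m0 \<Longrightarrow> y \<in> m0 \<Longrightarrow> T1 (x \<otimes>\<^bsub>R\<^esub> y) = T1 x \<otimes>\<^bsub>R\<^esub> y" for x y
      by (rule T_mult(3)[OF m0_carr m0_carr])
  qed
  then show "\<exists>b\<in>J1 \<inter> m0. b \<notin> L.mpow 2" using J_le_m0 by blast
next
  obtain a where a: "a \<in> carrier R2" "\<pi>2 a = \<zero>\<^bsub>k\<^esub>" "a \<noteq> \<zero>\<^bsub>R2\<^esub>" using A2.kernel_nontrivial[OF niso2] by blast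
  have "(\<zero>\<^bsub>R1\<^esub>, a) \<in> J2" "(\<zero>\<^bsub>R1\<^esub>, a) \<noteq> \<zero>\<^bsub>R\<^esub>" using a by (auto simp: J2_def R_simps)
  then have "\<exists>b\<in>J2. b \<notin> L.mpow 2"
  proof (rule L.summand_not_in_square[OF J2_ideal, of T2, rotated 4])
    show "x \<in> m0 \<Longrightarrow> T2 x \<in> J2" for x using T_closed(2)[of x] by simp
    show "x \<in> J2 \<Longrightarrow> T2 x = x" for x by (simp add: T2_def J2_def prod_eq_iff)
    show "x \<in> m0 \<Longrightarrow> y \<in> m0 \<Longrightarrow> T2 (x \<oplus>\<^bsub>R\<^esub> y) = T2 x \<oplus>\<^bsub>R\<^esub> T2 y" for x y by (rule T_add(2))
    show "x \<in> m0 \<Longrightarrow> y \<in> m0 \<Longrightarrow> T2 (x \<otimes>\<^bsub>R\<^esub> y) = T2 x \<otimes>\<^bsub>R\<^esub> y" for x y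
      by (rule T_mult(4)[OF m0_carr m0_carr])
  qed
  then show "\<exists>b\<in>J2 \<inter> m0. b \<notin> L.mpow 2" using J_le_m0 by blast
qed

end

lemma graded_betti_nonzero_iff: "graded_betti r d i j \<noteq> 0 \<longleftrightarrow> (\<exists>t<r i. d i t = j)"
  unfolding graded_betti_def by (subst card_0_eq[THEN arg_cong[of _ _ Not]]) auto

theorem corollary4p11:
  fixes R1 :: "'a ring" and R2 :: "'b ring" and k :: "'k ring"
    and \<pi>1 :: "'a \<Rightarrow> 'k" and \<pi>2 :: "'b \<Rightarrow> 'k"
    and R :: "('a \<times> 'b) ring" and m :: "('a \<times> 'b) set"
    and A :: "(nat \<Rightarrow> ('a \<times> 'b) set) graded_ring"
    and M :: "('a \<times> 'b, 'c) module"
    and r :: "nat \<Rightarrow> nat"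
    and \<phi> :: "nat \<Rightarrow> (nat \<Rightarrow> 'a \<times> 'b) \<Rightarrow> (nat \<Rightarrow> 'a \<times> 'b)"
    and \<epsilon> :: "(nat \<Rightarrow> 'a \<times> 'b) \<Rightarrow> 'c"
  assumes "koszul_local_ring R1" and "koszul_local_ring R2"
    and "field k"
    and "\<pi>1 \<in> ring_hom R1 k" and "\<pi>1 ` carrier R1 = carrier k"
    and "\<pi>2 \<in> ring_hom R2 k" and "\<pi>2 ` carrier R2 = carrier k"
    and "\<pi>1 \<notin> ring_iso R1 k" and "\<pi>2 \<notin> ring_iso R2 k"
    and "R = fiber_product R1 R2 \<pi>1 \<pi>2"
    and "m = max_ideal R"
    and "A = assoc_graded_ring R m"
    and "finitely_generated_module R M"
    and "has_pure_resolution A (assoc_graded_module R m M)"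
    and "minimal_free_resolution R m M r \<phi> \<epsilon>"
  shows "(\<forall>s d \<psi> \<eta>. minimal_graded_free_resolution A (assoc_graded_module R m M) s d \<psi> \<eta> \<longrightarrow>
            has_linear_resolution A (graded_syzygy A s d \<psi> 2)) \<and>
         (\<forall>j>2. \<forall>t<r j. has_order R m (free_module R (r (j - 1))) (matrix_column R r \<phi> j t) 1)"
proof -
  interpret S: fiber R1 R2 k \<pi>1 \<pi>2
    using assms(1-9)
    by (intro fiber.intro fiber_axioms.intro residue_map.intro)
      (auto simp: koszul_local_ring_def noetherian_local_ring_def)
  have R: "S.R = R" and m: "S.m0 = m" using S.R_def S.m0_eq assms(10,11) by simp_all
  interpret L: noetherian_local_adic R m using S.L.noetherian_local_adic_axioms unfolding R m .
  have res0: "free_resolution R M r \<phi> \<epsilon>" using assms(15) by (simp add: minimal_free_resolution_def)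
  \<comment> \<open>The augmentation presents \<open>M\<close> as an image of a free module of
    finite rank over a noetherian ring.\<close>
  have M: "noetherian_module R M"
    by (rule noetherian_module_image[OF noetherian_free_module[OF L.is_cring L.noetherian_ring_axioms]
      free_resolution_module[OF L.is_cring res0] free_resolutionD(1,3)[OF res0]])
  obtain s d \<psi> \<eta> where res: "minimal_graded_free_resolution A (assoc_graded_module R m M) s d \<psi> \<eta>"
    and pure: "\<And>i j j'. graded_betti s d i j \<noteq> 0 \<Longrightarrow> graded_betti s d i j' \<noteq> 0 \<Longrightarrow> j = j'"
    using assms(14) unfolding has_pure_resolution_def by blast
  have pure_degree: "d i t = d i 0" if "t < s i" for i t
  proof (rule pure[of i])
    show "graded_betti s d i (d i t) \<noteq> 0" unfolding graded_betti_nonzero_iff using that by blast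
    show "graded_betti s d i (d i 0) \<noteq> 0" unfolding graded_betti_nonzero_iff using that
      by (intro exI[of _ 0]) simp
  qed
  \<comment> \<open>The degree of the first basis vector serves as the common degree of a stage; at
    rank zero its value is immaterial.\<close>
  interpret P: pure_resolution R m M s d \<psi> \<eta> "\<lambda>i. d i 0"
    by (rule pure_resolution.intro[OF L.noetherian_local_adic_axioms
        pure_resolution_axioms.intro[OF M res[unfolded assms(12)] pure_degree]])
  obtain \<Phi>0 \<Phi> where lifted: "lifted_resolution R m M s d \<psi> \<eta> (\<lambda>i. d i 0) \<Phi>0 \<Phi>"
  proof -
    from P.lift_exists obtain \<Phi>0 \<Phi> where *: "P.GM.lifts (s 0) \<eta> \<Phi>0 (d 0 0)"
      "\<Phi>0 ` carrier (free_module R (s 0)) = carrier M"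
      "\<Phi> 0 ` carrier (free_module R (s (Suc 0))) = {v \<in> carrier (free_module R (s 0)). \<Phi>0 v = \<zero>\<^bsub>M\<^esub>}"
      "\<forall>i. P.flifts i (\<Phi> i) \<and> \<Phi> (Suc i) ` carrier (free_module R (s (Suc (Suc i))))
        = {v \<in> carrier (free_module R (s (Suc i))). \<Phi> i v = \<zero>\<^bsub>free_module R (s i)\<^esub>} \<and>
      (\<forall>c y. y \<in> \<Phi> i ` carrier (free_module R (s (Suc i))) \<longrightarrow>
        y \<in> ideal_pow_smult R m (free_module R (s i)) c \<longrightarrow>
        y \<in> \<Phi> i ` ideal_pow_smult R m (free_module R (s (Suc i))) (c - (d (Suc i) 0 - d i 0)))"
      by (elim exE conjE)
    have "lifted_resolution R m M s d \<psi> \<eta> (\<lambda>i. d i 0) \<Phi>0 \<Phi>"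
      by (rule lifted_resolution.intro[OF P.pure_resolution_axioms],
          unfold lifted_resolution_axioms_def, intro conjI allI impI) (use * in simp_all)
    then show ?thesis by (rule that)
  qed
  have "lifted_split R m M s d \<psi> \<eta> (\<lambda>i. d i 0) \<Phi>0 \<Phi> S.J1 S.J2"
    using lifted S.split_fiber unfolding lifted_split_def R m by (rule conjI)
  then interpret F: lifted_split R m M s d \<psi> \<eta> "\<lambda>i. d i 0" \<Phi>0 \<Phi> S.J1 S.J2 .
  show ?thesis
    unfolding assms(12)
  proof (intro conjI allI impI)
    show "minimal_graded_free_resolution (assoc_graded_ring R m) (assoc_graded_module R m M) s d \<psi> \<eta> \<Longrightarrow>
      has_linear_resolution (assoc_graded_ring R m) (graded_syzygy (assoc_graded_ring R m) s d \<psi> 2)" for s d \<psi> \<eta>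
      by (rule F.second_syzygy_linear)
    show "2 < j \<Longrightarrow> t < r j \<Longrightarrow>
      has_order R m (free_module R (r (j - 1))) (matrix_column R r \<phi> j t) 1" for j t
      by (rule F.column_order_1[OF assms(15)])
  qed
qed

end
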